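(* Consider the two-transmitter, two-receiver distributed-CSI channel described in the context, with CSI scalings $\alpha_i^{(j)}\in[0,1]$, $i,j\in\{1,2\}$. When both transmitted symbols are precoded with conventional Zero Forcing (cZF), the total multiplexing gain is $$\mathrm{M_G}^{\mathrm{cZF}}=2\min_{i,j\in\{1,2\}}\alpha_i^{(j)}.$$
   Context: Setting. Two transmitters TX1, TX2 and two receivers RX1, RX2, each with a single antenna. RX $i$ receives $y_i=\bm{h}_i^{H}\bm{x}+\eta_i$, where $\bm{h}_i^{H}\in\mathbb{C}^{1\times 2}$ is the channel from the two TXs to RX $i$, the entries of $\mathbf{H}=[\bm{h}_1^H;\bm{h}_2^H]$ are i.i.d. $\mathcal{CN}(0,1)$ (block fading), and $\eta_i\sim\mathcal{CN}(0,1)$ i.i.d. The normalized channel is $\tilde{\bm{h}}_i=\bm{h}_i/\|\bm{h}_i\|$. The transmit signal is $\bm{x}=\bm{t}_1s_1+\bm{t}_2s_2$ with independent symbols $s_i\sim\mathcal{CN}(0,1)$ and beamformers $\bm{t}_i\in\mathbb{C}^2$; $P$ is the transmit power (SNR). For $i\in\{1,2\}$ let $\bar i$ denote the other index. The rate of RX $i$ is $R_i(P)=\mathrm{E}_{\mathbf{H},\mathcal{W}}\big[\log_2\big(1+\frac{|\bm{h}_i^H\bm{t}_i|^2}{1+|\bm{h}_i^H\bm{t}_{\bar i}|^2}\big)\big]$, the expectation being over the channel and the random quantization codebooks; the multiplexing gain (MG) at RX $i$ is $\mathrm{M_G}_i=\lim_{P\to\infty}R_i(P)/\log_2 P$ and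 the total MG is $\mathrm{M_G}_1+\mathrm{M_G}_2$. Distributed CSI via random vector quantization. Every unit vector $\bm{u}\in\mathbb{C}^2$ is multiplied by a unit-modulus complex scalar making its first entry real, and identified with $\bm{u}_{\mathbb{R}^3}=[\mathrm{Re}(u_1),\mathrm{Re}(u_2),\mathrm{Im}(u_2)]^T\in\mathbb{R}^3$; the angle between two such vectors is $\angle(\bm{u},\bm{v})=\arccos\big(|\bm{u}_{\mathbb{R}^3}^T\bm{v}_{\mathbb{R}^3}|/(\|\bm{u}_{\mathbb{R}^3}\|\|\bm{v}_{\mathbb{R}^3}\|)\big)$. TX $j$ holds its own estimate $\tilde{\bm{h}}_i^{(j)}$ of $\tilde{\bm{h}}_i$, chosen as the codeword $\bm{c}$ of a random codebook (of $2^{B_i^{(j)}}$ independently, isotropically generated unit vectors, with the same phase normalization, independent across $i,j$) maximizing $|\bm{c}_{\mathbb{R}^3}^T\tilde{\bm{h}}_{i,\mathbb{R}^3}|$. The CSI scaling is $\alpha_i^{(j)}=\lim_{P\to\infty}B_i^{(j)}/\log_2 P\in[0,1]$. Distributed precoding. TX $j$ computes a full precoder $[\bm{t}_1^{(j)},\bm{t}_2^{(j)}]$ from its own estimates, but only its $j$-th row is transmitted: the effective beamformer for symbol $i$ is $\bm{t}_i=[t_{1i}^{(1)},t_{2i}^{(2)}]^T$, where $t_{ki}^{(j)}$ is the $k$-th entry of $\bm{t}_i^{(j)}$. Conventional ZF: with $\Pi^{\perp}_{\bm{u}}(\bm{v})=\bm{v}-\bm{u}\bm{u}^H\bm{v}/\|\bm{u}\|^2$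 the projection onto the orthogonal complement of $\bm{u}$, $\bm{t}_i^{(j)}=\sqrt{P/2}\,\Pi^{\perp}_{\tilde{\bm{h}}_{\bar i}^{(j)}}(\tilde{\bm{h}}_i^{(j)})/\|\Pi^{\perp}_{\tilde{\bm{h}}_{\bar i}^{(j)}}(\tilde{\bm{h}}_i^{(j)})\|$ for $j\in\{1,2\}$. *)

theory Defs
  imports "HOL-Probability.Probability"
begin

type_synonym cvec = "complex ^ 2"

text \<open>Indices of transmitters/receivers range over the two-element type 2 = {1,2}.\<close>

definition other :: "2 \<Rightarrow> 2" where
  "other i = (if i = 1 then 2 else 1)"

definition herm :: "cvec \<Rightarrow> cvec \<Rightarrow> complex" where
  "herm u v = (\<Sum>k\<in>UNIV. cnj (u $ k) * v $ k)"

definition unitize :: "cvec \<Rightarrow> cvec" where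
  "unitize u = u /\<^sub>R norm u"

text \<open>Phase normalization: multiply by a unit-modulus scalar making the first entry real (nonnegative).\<close>
definition phase_norm :: "cvec \<Rightarrow> cvec" where
  "phase_norm u = (if u $ 1 = 0 then u
                   else (cnj (u $ 1) / complex_of_real (cmod (u $ 1))) *s u)"

definition r3 :: "cvec \<Rightarrow> real ^ 3" where
  "r3 u = vector [Re (u $ 1), Re (u $ 2), Im (u $ 2)]"

text \<open>Circularly symmetric standard complex Gaussian vector CN(0,I) on C^2 and
  the channel matrix with i.i.d. CN(0,1) entries (row i is h_i).\<close>
definition cgauss_vec :: "cvec measure" where
  "cgauss_vec = density lborel (\<lambda>v. ennreal (exp (- (norm v)\<^sup>2) / pi ^ 2))"

definition chan_meas :: "(complex ^ 2 ^ 2) measure" where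
  "chan_meas = density lborel (\<lambda>H. ennreal (exp (- (norm H)\<^sup>2) / pi ^ 4))"

text \<open>Isotropic random codeword generated from a Gaussian vector g: normalize and phase-normalize.\<close>
definition codeword :: "cvec \<Rightarrow> cvec" where
  "codeword g = phase_norm (unitize g)"

definition codebook_meas :: "nat \<Rightarrow> (nat \<Rightarrow> cvec) measure" where
  "codebook_meas B = PiM {..<2 ^ B} (\<lambda>_. cgauss_vec)"

definition quantize :: "nat \<Rightarrow> (nat \<Rightarrow> cvec) \<Rightarrow> cvec \<Rightarrow> cvec" where
  "quantize N G h =
     (let sc = (\<lambda>k. \<bar>r3 (codeword (G k)) \<bullet> r3 (phase_norm h)\<bar>);
          k0 = (LEAST k. k < N \<and> (\<forall>k'<N. sc k' \<le> sc k))
      in codeword (G k0))"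

definition proj_perp :: "cvec \<Rightarrow> cvec \<Rightarrow> cvec" where
  "proj_perp u v = v - (herm u v / complex_of_real ((norm u)\<^sup>2)) *s u"

text \<open>Conventional ZF precoder computed from a set of estimates est (est l = estimate of normalized h_l).\<close>
definition czf :: "real \<Rightarrow> (2 \<Rightarrow> cvec) \<Rightarrow> 2 \<Rightarrow> cvec" where
  "czf P est i = sqrt (P / 2) *\<^sub>R unitize (proj_perp (est (other i)) (est i))"

text \<open>Estimate at TX j of the normalized channel of RX i; B i j P is the number of bits.\<close>
definition est :: "(2 \<Rightarrow> 2 \<Rightarrow> real \<Rightarrow> nat) \<Rightarrow> real \<Rightarrow> (complex ^ 2 ^ 2)
                    \<Rightarrow> (2 \<times> 2 \<Rightarrow> nat \<Rightarrow> cvec) \<Rightarrow> 2 \<Rightarrow> 2 \<Rightarrow> cvec" where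
  "est B P H W i j = quantize (2 ^ B i j P) (W (i, j)) (unitize (H $ i))"

text \<open>Effective beamformer for symbol i: entry k is taken from TX k's precoder.\<close>
definition eff_beam :: "(2 \<Rightarrow> 2 \<Rightarrow> real \<Rightarrow> nat) \<Rightarrow> real \<Rightarrow> (complex ^ 2 ^ 2)
                    \<Rightarrow> (2 \<times> 2 \<Rightarrow> nat \<Rightarrow> cvec) \<Rightarrow> 2 \<Rightarrow> cvec" where
  "eff_beam B P H W i = (\<chi> k. czf P (\<lambda>l. est B P H W l k) i $ k)"

definition sys_meas :: "(2 \<Rightarrow> 2 \<Rightarrow> real \<Rightarrow> nat) \<Rightarrow> real
                         \<Rightarrow> ((complex ^ 2 ^ 2) \<times> (2 \<times> 2 \<Rightarrow> nat \<Rightarrow> cvec)) measure" where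
  "sys_meas B P = chan_meas \<Otimes>\<^sub>M PiM UNIV (\<lambda>ij. codebook_meas (B (fst ij) (snd ij) P))"

definition rate_cZF :: "(2 \<Rightarrow> 2 \<Rightarrow> real \<Rightarrow> nat) \<Rightarrow> 2 \<Rightarrow> real \<Rightarrow> real" where
  "rate_cZF B i P = (\<integral>\<omega>. (case \<omega> of (H, W) \<Rightarrow>
      log 2 (1 + (cmod (herm (H $ i) (eff_beam B P H W i)))\<^sup>2
                / (1 + (cmod (herm (H $ i) (eff_beam B P H W (other i))))\<^sup>2)))
      \<partial>sys_meas B P)"

end

theory Submission
  imports Defs
begin

text \<open>
  A unit vector with real first entry is \<open>(1, z) / sqrt (1 + |z|\<^sup>2)\<close> for a unique slope \<open>z\<close>,
  and a transmitter that nulls the slope \<open>c\<close> and serves the slope \<open>d\<close> uses the beam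
  \<open>sgn (d - c) (- cnj c, 1) / sqrt (1 + |c|\<^sup>2)\<close>. Both receivers have multiplexing gain
  \<open>a = min \<alpha>\<close>, because for almost every fixed channel the signal power is of order \<open>P\<close> and the
  interference power is \<open>P powr (1 - a + o(1))\<close> in probability over the codebooks; averaging
  over the channel is dominated convergence.

  With \<open>N = 2 ^ B\<close> codewords the selected slope is within \<open>N powr (- 1 / 2 + o(1))\<close> of the true
  one, and the gains are locally Lipschitz in the four slopes; this bounds the interference from
  above. From below, the slope of a random codeword has a bounded density. Freeze the other
  three codebooks: the slopes for which the interference amplitude is below \<open>\<delta>\<close> and which lie within
  \<open>r\<close> of the true slope form a strip of area \<open>O(r \<delta>)\<close>. By the union bound the codebook puts a
  codeword there with probability \<open>O(N r \<delta>)\<close>, which is small for \<open>r\<close> near \<open>N powr (- 1 / 2)\<close> and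
  \<open>\<delta> = P powr (- \<epsilon>) * N powr (- 1 / 2)\<close>. For the estimate of the receiver's own channel the strip is cut
  out by the modulus of a beam entry, for the estimate of the other channel by its phase.
\<close>

section \<open>Lebesgue and Gaussian measure on pairs\<close>

text \<open>The interference is a sum of two terms computed by different transmitters. The modulus
  of each term is set by the slope that its transmitter nulls; the served slope enters only through
  a phase. The transmitters do not share estimates, so even a pure phase mismatch leaves
  interference, and therefore all four scalings enter the minimum. The obstacle is that errors might
  cancel. Ruling this out through the joint law of the selected codewords would be hard, since they
  are argmax choices depending on the channel. Treating one estimate as random and the rest as
  arbitrary constants asks only for a bounded slope density; the factor \<open>N\<close> lost in the
  union bound is regained by confining the strip to a small disc. A scaling equal to 0 is the
  degenerate case: the codebook may stay bounded and the slope need not converge. What a limit would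
  give (slopes off the imaginary axis, different imaginary parts, boundedness) is then replaced by
  bounds \<open>P powr (- \<eta>)\<close> and \<open>P powr \<eta>\<close> of high probability, with
  \<eta> arbitrarily small. These losses are the reason for all the small exponents below.\<close>

lemma borel_measurable_Complex [measurable (raw)]:
  assumes [measurable]: "f \<in> borel_measurable M" "g \<in> borel_measurable M"
  shows "(\<lambda>x. Complex (f x) (g x)) \<in> borel_measurable M"
  unfolding Complex_eq by measurable

text \<open>Lebesgue measure is determined by boxes, and a complex box pulls back to a product of
  two intervals. This opens Fubini in real and imaginary parts.\<close>

lemma lborel_complex_eq_distr:
  "(lborel :: complex measure) = distr (lborel \<Otimes>\<^sub>M lborel) borel (\<lambda>(x, y). Complex x y)"
proof (rule lborel_eqI)
  have [measurable]: "(\<lambda>(x, y). Complex x y) \<in> borel_measurable (lborel \<Otimes>\<^sub>M lborel)"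
    by measurable
  fix l u :: complex
  assume le: "\<And>b. b \<in> Basis \<Longrightarrow> l \<bullet> b \<le> u \<bullet> b"
  have le': "Re l \<le> Re u" "Im l \<le> Im u"
    using le[of 1] le[of \<i>] by (auto simp: Basis_complex_def inner_complex_def)
  have "(\<lambda>(x, y). Complex x y) -` box l u \<inter> space (lborel \<Otimes>\<^sub>M lborel)
      = {Re l <..< Re u} \<times> {Im l <..< Im u}"
    by (auto simp: box_def Basis_complex_def inner_complex_def space_pair_measure)
  then show "emeasure (distr (lborel \<Otimes>\<^sub>M lborel) borel (\<lambda>(x, y). Complex x y)) (box l u)
      = ennreal (\<Prod>b\<in>Basis. (u - l) \<bullet> b)"
    using le' by (simp add: emeasure_distr lborel.emeasure_pair_measure_Times Basis_complex_def
        inner_complex_def ennreal_mult)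
qed simp

text \<open>Polymorphic so that it serves at two levels: two complex numbers form a channel vector,
  two channel vectors form the channel matrix.\<close>

definition vec2 :: "'a \<times> 'a \<Rightarrow> 'a ^ 2" where
  "vec2 p = (\<chi> k. if k = 1 then fst p else snd p)"

lemma vec2_nth [simp]: "vec2 p $ 1 = fst p" "vec2 p $ 2 = snd p"
  by (simp_all add: vec2_def)

lemma norm_vec2_square: "(norm (vec2 p))\<^sup>2 = (norm (fst p))\<^sup>2 + (norm (snd p))\<^sup>2"
  by (simp add: norm_vec_def L2_set_def sum_2)

lemma measurable_vec2 [measurable]:
  "(vec2 :: 'a::euclidean_space \<times> 'a \<Rightarrow> 'a ^ 2) \<in> borel_measurable borel"
proof (rule borel_measurable_continuous_onI)
  show "continuous_on UNIV (vec2 :: 'a \<times> 'a \<Rightarrow> 'a ^ 2)"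
    unfolding vec2_def [abs_def]
  proof (rule continuous_on_vec_lambda)
    show "continuous_on UNIV (\<lambda>p :: 'a \<times> 'a. if k = 1 then fst p else snd p)" for k :: 2
      by (cases "k = 1") (simp_all add: continuous_on_fst continuous_on_snd)
  qed
qed

lemma lborel_vec2_eq_distr:
  "(lborel :: ('a::euclidean_space ^ 2) measure) = distr (lborel \<Otimes>\<^sub>M lborel) borel vec2"
proof (rule lborel_eqI)
  have [measurable]: "(vec2 :: 'a \<times> 'a \<Rightarrow> _) \<in> borel_measurable (lborel \<Otimes>\<^sub>M lborel)"
    unfolding lborel_prod by simp
  fix l u :: "'a ^ 2"
  assume le: "\<And>b. b \<in> Basis \<Longrightarrow> l \<bullet> b \<le> u \<bullet> b"
  have B: "(Basis :: ('a ^ 2) set) = axis 1 ` Basis \<union> axis 2 ` Basis"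
    unfolding Basis_vec_def UNIV_2 by auto
  have le1: "l $ k \<bullet> b \<le> u $ k \<bullet> b" if "b \<in> Basis" for k b
    using le[of "axis k b"] that by (auto simp: Basis_vec_def inner_axis)
  have pre: "vec2 -` box l u \<inter> space (lborel \<Otimes>\<^sub>M lborel) = box (l $ 1) (u $ 1) \<times> box (l $ 2) (u $ 2)"
    by (auto simp: box_def B ball_Un inner_axis space_pair_measure)
  have inj: "inj_on (axis k) (A :: 'a set)" for k :: 2 and A
    by (auto simp: inj_on_def axis_eq_axis)
  have dis: "axis (1 :: 2) ` Basis \<inter> axis 2 ` (Basis :: 'a set) = {}"
    by (auto simp: axis_eq_axis)
  have "(\<Prod>b\<in>Basis. (u - l) \<bullet> b) = (\<Prod>b\<in>Basis. (u $ 1 - l $ 1) \<bullet> b) * (\<Prod>b\<in>Basis. (u $ 2 - l $ 2) \<bullet> b)"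
    unfolding B by (subst prod.union_disjoint)
       (auto simp: dis prod.reindex[OF inj] inner_axis)
  then show "emeasure (distr (lborel \<Otimes>\<^sub>M lborel) borel vec2) (box l u) = ennreal (\<Prod>b\<in>Basis. (u - l) \<bullet> b)"
    using le1 by (simp add: emeasure_distr pre lborel.emeasure_pair_measure_Times emeasure_lborel_box
        ennreal_mult prod_nonneg inner_diff_left)
qed simp

lemma nn_integral_complex:
  assumes [measurable]: "f \<in> borel_measurable borel"
  shows "(\<integral>\<^sup>+z. f z \<partial>(lborel :: complex measure)) = (\<integral>\<^sup>+x. \<integral>\<^sup>+y. f (Complex x y) \<partial>lborel \<partial>lborel)"
proof -
  have [measurable]: "(\<lambda>(x, y). Complex x y) \<in> borel_measurable (lborel \<Otimes>\<^sub>M lborel)"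
    by measurable
  have [measurable]: "(\<lambda>x. f (case x of (x, y) \<Rightarrow> Complex x y)) \<in> borel_measurable (lborel \<Otimes>\<^sub>M lborel)"
    by (rule measurable_compose[of _ _ borel]) simp_all
  show ?thesis
    by (subst lborel_complex_eq_distr)
       (simp add: nn_integral_distr lborel.nn_integral_fst[symmetric])
qed

lemma nn_integral_vec2:
  fixes f :: "'a::euclidean_space ^ 2 \<Rightarrow> ennreal"
  assumes [measurable]: "f \<in> borel_measurable borel"
  shows "(\<integral>\<^sup>+v. f v \<partial>lborel) = (\<integral>\<^sup>+x. \<integral>\<^sup>+y. f (vec2 (x, y)) \<partial>lborel \<partial>lborel)"
proof -
  have [measurable]: "(vec2 :: 'a \<times> 'a \<Rightarrow> _) \<in> borel_measurable (lborel \<Otimes>\<^sub>M lborel)"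
    unfolding lborel_prod by simp
  have [measurable]: "(\<lambda>x. f (vec2 x)) \<in> borel_measurable (lborel \<Otimes>\<^sub>M lborel)"
    by (rule measurable_compose[of _ _ borel]) simp_all
  show ?thesis
    by (subst lborel_vec2_eq_distr)
       (simp add: nn_integral_distr lborel.nn_integral_fst[symmetric])
qed

text \<open>A multiple of the normal density of variance \<open>1 / (2 * s)\<close>. General
  \<open>s\<close> is kept because later bounds sacrifice half of the exponent and need
  \<open>s = 1 / 2\<close>.\<close>

lemma nn_integral_gauss_real:
  assumes "0 < s"
  shows "(\<integral>\<^sup>+x. ennreal (exp (- (s * x\<^sup>2))) \<partial>(lborel :: real measure)) = ennreal (sqrt (pi / s))"
proof -
  have eq: "exp (- (s * x\<^sup>2)) = sqrt (pi / s) * normal_density 0 (sqrt (1 / (2 * s))) x" for x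
    using assms by (simp add: normal_density_def real_sqrt_divide field_simps)
  have "(\<integral>\<^sup>+x. ennreal (exp (- (s * x\<^sup>2))) \<partial>lborel)
     = ennreal (sqrt (pi / s)) * (\<integral>\<^sup>+x. ennreal (normal_density 0 (sqrt (1 / (2 * s))) x) \<partial>lborel)"
    unfolding eq using assms by (subst nn_integral_cmult[symmetric]) (auto simp: ennreal_mult)
  also have "(\<integral>\<^sup>+x. ennreal (normal_density 0 (sqrt (1 / (2 * s))) x) \<partial>lborel) = 1"
    using assms by (subst nn_integral_eq_integral) auto
  finally show ?thesis by simp
qed

lemma nn_integral_gauss_complex:
  assumes "0 < s"
  shows "(\<integral>\<^sup>+z. ennreal (exp (- (s * (norm z)\<^sup>2))) \<partial>(lborel :: complex measure)) = ennreal (pi / s)"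
proof -
  have "(\<integral>\<^sup>+z. ennreal (exp (- (s * (norm z)\<^sup>2))) \<partial>(lborel :: complex measure))
      = (\<integral>\<^sup>+x. \<integral>\<^sup>+y. ennreal (exp (- (s * x\<^sup>2))) * ennreal (exp (- (s * y\<^sup>2))) \<partial>lborel \<partial>(lborel :: real measure))"
    by (subst nn_integral_complex)
       (simp_all add: cmod_def ennreal_mult[symmetric] mult_exp_exp algebra_simps)
  also have "\<dots> = ennreal (sqrt (pi / s)) * ennreal (sqrt (pi / s))"
    using assms by (simp add: nn_integral_cmult nn_integral_multc nn_integral_gauss_real)
  finally show ?thesis
    using assms by (simp add: ennreal_mult[symmetric])
qed

lemma nn_integral_gauss_vec2:
  fixes s :: real
  assumes "(\<integral>\<^sup>+x. ennreal (exp (- (s * (norm x)\<^sup>2))) \<partial>(lborel :: 'a::euclidean_space measure)) = ennreal c" "0 \<le> c"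
  shows "(\<integral>\<^sup>+x. ennreal (exp (- (s * (norm x)\<^sup>2))) \<partial>(lborel :: ('a ^ 2) measure)) = ennreal (c\<^sup>2)"
proof -
  have "(\<integral>\<^sup>+x. ennreal (exp (- (s * (norm x)\<^sup>2))) \<partial>(lborel :: ('a ^ 2) measure))
      = (\<integral>\<^sup>+x. \<integral>\<^sup>+y. ennreal (exp (- (s * (norm x)\<^sup>2))) * ennreal (exp (- (s * (norm y)\<^sup>2))) \<partial>(lborel :: 'a measure) \<partial>(lborel :: 'a measure))"
    by (subst nn_integral_vec2)
       (simp_all add: norm_vec2_square ennreal_mult[symmetric] mult_exp_exp algebra_simps)
  also have "\<dots> = ennreal c * ennreal c"
    using assms by (simp add: nn_integral_cmult nn_integral_multc)
  finally show ?thesis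
    using assms by (simp add: ennreal_mult[symmetric] power2_eq_square)
qed

lemma nn_integral_gauss_cvec:
  "0 < s \<Longrightarrow> (\<integral>\<^sup>+x. ennreal (exp (- (s * (norm x)\<^sup>2))) \<partial>(lborel :: cvec measure)) = ennreal ((pi / s)\<^sup>2)"
  by (rule nn_integral_gauss_vec2) (simp_all add: nn_integral_gauss_complex)

lemma nn_integral_gauss_chan:
  "0 < s \<Longrightarrow> (\<integral>\<^sup>+x. ennreal (exp (- (s * (norm x)\<^sup>2))) \<partial>(lborel :: (cvec ^ 2) measure)) = ennreal ((pi / s) ^ 4)"
  using nn_integral_gauss_vec2[OF nn_integral_gauss_cvec, of s] by simp

section \<open>Total mass of the Gaussian laws and second moment of the channel\<close>

lemma sets_cgauss_vec [simp, measurable_cong]: "sets cgauss_vec = sets borel"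
  by (simp add: cgauss_vec_def)

lemma space_cgauss_vec [simp]: "space cgauss_vec = UNIV"
  by (simp add: cgauss_vec_def)

lemma sets_chan_meas [simp, measurable_cong]: "sets chan_meas = sets borel"
  by (simp add: chan_meas_def)

lemma space_chan_meas [simp]: "space chan_meas = UNIV"
  by (simp add: chan_meas_def)

lemma prob_space_cgauss_vec: "prob_space cgauss_vec"
proof (rule prob_spaceI)
  have "emeasure cgauss_vec UNIV = (\<integral>\<^sup>+v. ennreal (1 / pi ^ 2) * ennreal (exp (- (norm v)\<^sup>2)) \<partial>(lborel :: cvec measure))"
    by (simp add: cgauss_vec_def emeasure_density ennreal_mult[symmetric])
  also have "\<dots> = 1"
    by (subst nn_integral_cmult)
       (use nn_integral_gauss_cvec[of 1] in \<open>simp_all flip: ennreal_mult\<close>)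
  finally show "emeasure cgauss_vec (space cgauss_vec) = 1" by simp
qed

lemma prob_space_chan_meas: "prob_space chan_meas"
proof (rule prob_spaceI)
  have "emeasure chan_meas UNIV = (\<integral>\<^sup>+v. ennreal (1 / pi ^ 4) * ennreal (exp (- (norm v)\<^sup>2)) \<partial>(lborel :: (cvec ^ 2) measure))"
    by (simp add: chan_meas_def emeasure_density ennreal_mult[symmetric])
  also have "\<dots> = 1"
    by (subst nn_integral_cmult)
       (use nn_integral_gauss_chan[of 1] in \<open>simp_all flip: ennreal_mult\<close>)
  finally show "emeasure chan_meas (space chan_meas) = 1" by simp
qed

text \<open>Trades a polynomial factor for half of the Gaussian exponent; used for the second moment
  of the channel and for the slope density.\<close>

lemma mult_exp_minus_le: "t * exp (- t) \<le> exp (- (1 / 2 * t))" for t :: real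
proof -
  have "t \<le> exp (t / 2)"
  proof (cases "0 \<le> t")
    case True
    have "0 \<le> (t / 2 - 1)\<^sup>2" by simp
    then have "t \<le> 1 + t / 2 + (t / 2)\<^sup>2 / 2"
      by (simp add: power2_eq_square algebra_simps)
    also have "\<dots> \<le> exp (t / 2)"
      using True by (intro exp_lower_Taylor_quadratic) auto
    finally show ?thesis .
  qed (use exp_gt_zero[of "t / 2"] in linarith)
  then have "t * exp (- t) \<le> exp (t / 2) * exp (- t)" by (intro mult_right_mono) auto
  then show ?thesis by (simp add: mult_exp_exp)
qed

lemma integrable_norm_square_chan_meas: "integrable chan_meas (\<lambda>H. (norm H)\<^sup>2)"
  unfolding chan_meas_def
proof (subst integrable_density)
  show "integrable lborel (\<lambda>H :: complex^2^2. (exp (- (norm H)\<^sup>2) / pi ^ 4) *\<^sub>R (norm H)\<^sup>2)"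
  proof (rule integrableI_bounded)
    have "(\<integral>\<^sup>+H. ennreal (norm ((exp (- (norm H)\<^sup>2) / pi ^ 4) *\<^sub>R (norm H)\<^sup>2)) \<partial>(lborel :: (complex^2^2) measure))
       \<le> (\<integral>\<^sup>+H. ennreal (1 / pi ^ 4) * ennreal (exp (- (1 / 2 * (norm H)\<^sup>2))) \<partial>(lborel :: (complex^2^2) measure))"
    proof (rule nn_integral_mono)
      fix H :: "complex^2^2"
      show "ennreal (norm ((exp (- (norm H)\<^sup>2) / pi ^ 4) *\<^sub>R (norm H)\<^sup>2))
         \<le> ennreal (1 / pi ^ 4) * ennreal (exp (- (1 / 2 * (norm H)\<^sup>2)))"
        using mult_exp_minus_le[of "(norm H)\<^sup>2"]
        by (simp add: ennreal_mult[symmetric] divide_right_mono mult.commute)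
    qed
    also have "\<dots> < \<infinity>"
      by (subst nn_integral_cmult) (simp_all only: nn_integral_gauss_chan, auto simp: ennreal_mult_less_top)
    finally show "(\<integral>\<^sup>+H. ennreal (norm ((exp (- (norm H)\<^sup>2) / pi ^ 4) *\<^sub>R (norm H)\<^sup>2)) \<partial>(lborel :: (complex^2^2) measure)) < \<infinity>" .
  qed simp
qed auto

lemma borel_measurable_vec_nth [measurable (raw)]:
  fixes f :: "'b \<Rightarrow> 'a::euclidean_space ^ 'n"
  assumes "f \<in> borel_measurable M"
  shows "(\<lambda>x. f x $ k) \<in> borel_measurable M"
  by (rule measurable_compose[OF assms]) (intro borel_measurable_continuous_onI continuous_intros)

text \<open>The Jacobian of multiplication by \<open>c\<close> is |c|^2. The real 2x2 matrix of the
  map is factored into one-dimensional affine substitutions by Gaussian elimination with pivot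
  \<open>Re c\<close>; a zero pivot means that \<open>c\<close> is imaginary and merely exchanges
  and scales the coordinates.\<close>

lemma nn_integral_complex_mult:
  fixes c :: complex
  assumes [measurable]: "f \<in> borel_measurable borel" and c: "c \<noteq> 0"
  shows "(\<integral>\<^sup>+z. f z \<partial>lborel) = ennreal ((cmod c)\<^sup>2) * (\<integral>\<^sup>+z. f (c * z) \<partial>lborel)"
proof -
  define a b where "a = Re c" and "b = Im c"
  have mult: "c * Complex x y = Complex (a * x - b * y) (b * x + a * y)" for x y
    by (simp add: complex_eq_iff a_def b_def)
  have [measurable]: "(\<lambda>z. f (c * z)) \<in> borel_measurable borel" by measurable
  show ?thesis
  proof (cases "a = 0")
    case True
    with c have b: "b \<noteq> 0" by (auto simp: a_def b_def complex_eq_iff)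
    have cc: "(cmod c)\<^sup>2 = \<bar>b\<bar> * \<bar>b\<bar>"
      using True cmod_power2[of c] by (simp add: a_def b_def power2_eq_square)
    have "(\<integral>\<^sup>+z. f z \<partial>lborel) = (\<integral>\<^sup>+x. \<integral>\<^sup>+y. f (Complex x y) \<partial>lborel \<partial>lborel)"
      by (rule nn_integral_complex) simp
    also have "\<dots> = ennreal \<bar>- b\<bar> * (\<integral>\<^sup>+y. \<integral>\<^sup>+v. f (Complex (0 + - b * y) v) \<partial>lborel \<partial>lborel)"
      by (rule nn_integral_real_affine) (use b in auto)
    also have "(\<lambda>y. \<integral>\<^sup>+v. f (Complex (0 + - b * y) v) \<partial>lborel)
        = (\<lambda>y. ennreal \<bar>b\<bar> * (\<integral>\<^sup>+x. f (Complex (0 + - b * y) (0 + b * x)) \<partial>lborel))"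
      by (intro ext nn_integral_real_affine) (use b in auto)
    also have "(\<integral>\<^sup>+y. ennreal \<bar>b\<bar> * (\<integral>\<^sup>+x. f (Complex (0 + - b * y) (0 + b * x)) \<partial>lborel) \<partial>lborel)
        = ennreal \<bar>b\<bar> * (\<integral>\<^sup>+y. (\<integral>\<^sup>+x. f (Complex (0 + - b * y) (0 + b * x)) \<partial>lborel) \<partial>lborel)"
      by (rule nn_integral_cmult) measurable
    also have "(\<integral>\<^sup>+y. (\<integral>\<^sup>+x. f (Complex (0 + - b * y) (0 + b * x)) \<partial>lborel) \<partial>lborel)
        = (\<integral>\<^sup>+x. (\<integral>\<^sup>+y. f (Complex (0 + - b * y) (0 + b * x)) \<partial>lborel) \<partial>lborel)"
      by (rule lborel_pair.Fubini') measurable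
    also have "\<dots> = (\<integral>\<^sup>+z. f (c * z) \<partial>lborel)"
      by (subst nn_integral_complex) (simp_all add: mult True)
    finally show ?thesis
      unfolding cc by (simp add: ennreal_mult mult.assoc del: abs_mult_self_eq)
  next
    case False
    \<comment> \<open>The second pivot of the elimination: with x' = a x - b y, the imaginary part b
      x + a y equals (b / a) x' + k y, and a k is the determinant.\<close>
    define k where "k = (a\<^sup>2 + b\<^sup>2) / a"
    have k: "k \<noteq> 0" using False by (simp add: k_def sum_power2_eq_zero_iff)
    have cc: "(cmod c)\<^sup>2 = \<bar>k\<bar> * \<bar>a\<bar>"
      using False by (simp add: cmod_power2 a_def b_def k_def abs_mult[symmetric])
    have eq: "b / a * (- b * y + a * x) + k * y = b * x + a * y" for x y
      using False by (simp add: k_def field_simps power2_eq_square)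
    have "(\<integral>\<^sup>+z. f z \<partial>lborel) = (\<integral>\<^sup>+x. \<integral>\<^sup>+y. f (Complex x y) \<partial>lborel \<partial>lborel)"
      by (rule nn_integral_complex) simp
    also have "(\<lambda>x. \<integral>\<^sup>+y. f (Complex x y) \<partial>lborel)
        = (\<lambda>x. ennreal \<bar>k\<bar> * (\<integral>\<^sup>+y. f (Complex x (b / a * x + k * y)) \<partial>lborel))"
      by (intro ext nn_integral_real_affine) (use k in auto)
    also have "(\<integral>\<^sup>+x. ennreal \<bar>k\<bar> * (\<integral>\<^sup>+y. f (Complex x (b / a * x + k * y)) \<partial>lborel) \<partial>lborel)
        = ennreal \<bar>k\<bar> * (\<integral>\<^sup>+x. \<integral>\<^sup>+y. f (Complex x (b / a * x + k * y)) \<partial>lborel \<partial>lborel)"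
      by (rule nn_integral_cmult) measurable
    also have "(\<integral>\<^sup>+x. \<integral>\<^sup>+y. f (Complex x (b / a * x + k * y)) \<partial>lborel \<partial>lborel)
        = (\<integral>\<^sup>+y. \<integral>\<^sup>+x. f (Complex x (b / a * x + k * y)) \<partial>lborel \<partial>lborel)"
      by (rule lborel_pair.Fubini') measurable
    also have "(\<lambda>y. \<integral>\<^sup>+x. f (Complex x (b / a * x + k * y)) \<partial>lborel)
        = (\<lambda>y. ennreal \<bar>a\<bar> * (\<integral>\<^sup>+x. f (Complex (- b * y + a * x) (b / a * (- b * y + a * x) + k * y)) \<partial>lborel))"
      by (intro ext nn_integral_real_affine) (use False in auto)
    also have "\<dots> = (\<lambda>y. ennreal \<bar>a\<bar> * (\<integral>\<^sup>+x. f (c * Complex x y) \<partial>lborel))"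
      unfolding eq mult by (simp add: algebra_simps)
    also have "(\<integral>\<^sup>+y. ennreal \<bar>a\<bar> * (\<integral>\<^sup>+x. f (c * Complex x y) \<partial>lborel) \<partial>lborel)
        = ennreal \<bar>a\<bar> * (\<integral>\<^sup>+y. \<integral>\<^sup>+x. f (c * Complex x y) \<partial>lborel \<partial>lborel)"
      by (rule nn_integral_cmult) measurable
    also have "(\<integral>\<^sup>+y. \<integral>\<^sup>+x. f (c * Complex x y) \<partial>lborel \<partial>lborel)
        = (\<integral>\<^sup>+x. \<integral>\<^sup>+y. f (c * Complex x y) \<partial>lborel \<partial>lborel)"
      by (rule lborel_pair.Fubini') measurable
    also have "\<dots> = (\<integral>\<^sup>+z. f (c * z) \<partial>lborel)"
      by (subst nn_integral_complex) simp_all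
    finally show ?thesis
      unfolding cc by (simp add: ennreal_mult mult.assoc)
  qed
qed

section \<open>The slope of a Gaussian vector\<close>

definition ratio :: "cvec \<Rightarrow> complex" where
  "ratio g = g $ 2 / g $ 1"

lemma measurable_ratio [measurable]: "ratio \<in> borel_measurable borel"
  unfolding ratio_def by measurable

lemma nn_integral_cgauss_vec:
  assumes [measurable]: "f \<in> borel_measurable borel"
  shows "(\<integral>\<^sup>+g. f g \<partial>cgauss_vec)
    = (\<integral>\<^sup>+u. \<integral>\<^sup>+v. ennreal (exp (- ((cmod u)\<^sup>2 + (cmod v)\<^sup>2)) / pi\<^sup>2) * f (vec2 (u, v)) \<partial>lborel \<partial>lborel)"
proof -
  have "(\<integral>\<^sup>+g. f g \<partial>cgauss_vec) = (\<integral>\<^sup>+g. ennreal (exp (- (norm g)\<^sup>2) / pi\<^sup>2) * f g \<partial>lborel)"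
    unfolding cgauss_vec_def by (rule nn_integral_density) auto
  also have "\<dots> = (\<integral>\<^sup>+u. \<integral>\<^sup>+v. ennreal (exp (- ((cmod u)\<^sup>2 + (cmod v)\<^sup>2)) / pi\<^sup>2) * f (vec2 (u, v)) \<partial>lborel \<partial>lborel)"
    by (subst nn_integral_vec2) (simp_all add: norm_vec2_square)
  finally show ?thesis .
qed

text \<open>For fixed u, the substitution v = u z turns the second entry into the slope and
  contributes the factor |u|^2. Integrating out u would give the density 1 / (pi (1 + |z|^2)^2), but
  only bounds on it are required, so the double integral is kept.\<close>

lemma emeasure_cgauss_ratio:
  assumes [measurable]: "A \<in> sets borel"
  shows "emeasure cgauss_vec {g. ratio g \<in> A}
    = (\<integral>\<^sup>+u. \<integral>\<^sup>+z. ennreal ((cmod u)\<^sup>2 * exp (- (cmod u)\<^sup>2 * (1 + (cmod z)\<^sup>2)) / pi\<^sup>2) * indicator A z \<partial>lborel \<partial>lborel)"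
proof -
  have [measurable]: "{g. ratio g \<in> A} \<in> sets borel" by measurable
  have "emeasure cgauss_vec {g. ratio g \<in> A} = (\<integral>\<^sup>+g. indicator {g. ratio g \<in> A} g \<partial>cgauss_vec)"
    by (subst nn_integral_indicator) auto
  also have "\<dots> = (\<integral>\<^sup>+u. \<integral>\<^sup>+v. ennreal (exp (- ((cmod u)\<^sup>2 + (cmod v)\<^sup>2)) / pi\<^sup>2)
                    * indicator A (v / u) \<partial>lborel \<partial>lborel)"
    by (subst nn_integral_cgauss_vec)
       (auto intro!: nn_integral_cong simp: indicator_def ratio_def)
  also have "\<dots> = (\<integral>\<^sup>+u. \<integral>\<^sup>+z. ennreal ((cmod u)\<^sup>2 * exp (- (cmod u)\<^sup>2 * (1 + (cmod z)\<^sup>2)) / pi\<^sup>2) * indicator A z \<partial>lborel \<partial>lborel)"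
  proof (rule nn_integral_cong_AE, rule AE_mp[OF AE_lborel_singleton[of 0]], intro AE_I2 impI)
    fix u :: complex assume u: "u \<noteq> 0"
    have "(\<integral>\<^sup>+v. ennreal (exp (- ((cmod u)\<^sup>2 + (cmod v)\<^sup>2)) / pi\<^sup>2) * indicator A (v / u) \<partial>lborel)
       = ennreal ((cmod u)\<^sup>2) * (\<integral>\<^sup>+z. ennreal (exp (- ((cmod u)\<^sup>2 + (cmod (u * z))\<^sup>2)) / pi\<^sup>2) * indicator A (u * z / u) \<partial>lborel)"
      by (rule nn_integral_complex_mult) (use u in simp_all)
    also have "\<dots> = (\<integral>\<^sup>+z. ennreal ((cmod u)\<^sup>2) * (ennreal (exp (- ((cmod u)\<^sup>2 + (cmod (u * z))\<^sup>2)) / pi\<^sup>2) * indicator A (u * z / u)) \<partial>lborel)"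
      by (rule nn_integral_cmult[symmetric]) simp
    also have "\<dots> = (\<integral>\<^sup>+z. ennreal ((cmod u)\<^sup>2 * exp (- (cmod u)\<^sup>2 * (1 + (cmod z)\<^sup>2)) / pi\<^sup>2) * indicator A z \<partial>lborel)"
      using u by (intro nn_integral_cong)
        (simp add: mult.assoc[symmetric] ennreal_mult[symmetric] norm_mult power_mult_distrib ring_distribs)
    finally show "(\<integral>\<^sup>+v. ennreal (exp (- ((cmod u)\<^sup>2 + (cmod v)\<^sup>2)) / pi\<^sup>2) * indicator A (v / u) \<partial>lborel)
      = (\<integral>\<^sup>+z. ennreal ((cmod u)\<^sup>2 * exp (- (cmod u)\<^sup>2 * (1 + (cmod z)\<^sup>2)) / pi\<^sup>2) * indicator A z \<partial>lborel)" .
  qed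
  finally show ?thesis .
qed

text \<open>The slope density is at most 1: dropping |z| from the exponent and absorbing |u|^2
  leaves (1 / pi^2) * 2 pi = 2 / pi.\<close>

lemma emeasure_cgauss_ratio_le:
  assumes [measurable]: "A \<in> sets borel"
  shows "emeasure cgauss_vec {g. ratio g \<in> A} \<le> emeasure lborel A"
proof -
  have "emeasure cgauss_vec {g. ratio g \<in> A}
     \<le> (\<integral>\<^sup>+u. \<integral>\<^sup>+z. ennreal (1 / pi\<^sup>2) * ennreal (exp (- (1 / 2 * (cmod u)\<^sup>2))) * indicator A z \<partial>lborel \<partial>lborel)"
    unfolding emeasure_cgauss_ratio[OF assms]
  proof (intro nn_integral_mono mult_right_mono)
    fix u z :: complex
    have "(cmod u)\<^sup>2 * exp (- (cmod u)\<^sup>2 * (1 + (cmod z)\<^sup>2)) \<le> (cmod u)\<^sup>2 * exp (- (cmod u)\<^sup>2)"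
      by (intro mult_left_mono) (auto simp: ring_distribs)
    also have "\<dots> \<le> exp (- (1 / 2 * (cmod u)\<^sup>2))" by (rule mult_exp_minus_le)
    finally show "ennreal ((cmod u)\<^sup>2 * exp (- (cmod u)\<^sup>2 * (1 + (cmod z)\<^sup>2)) / pi\<^sup>2)
        \<le> ennreal (1 / pi\<^sup>2) * ennreal (exp (- (1 / 2 * (cmod u)\<^sup>2)))"
      by (simp add: ennreal_mult[symmetric] divide_right_mono)
  qed auto
  also have "\<dots> = (\<integral>\<^sup>+u. ennreal (1 / pi\<^sup>2) * ennreal (exp (- (1 / 2 * (cmod u)\<^sup>2))) * emeasure lborel A \<partial>lborel)"
    by (subst nn_integral_cmult_indicator) auto
  also have "\<dots> = (\<integral>\<^sup>+u. ennreal (1 / pi\<^sup>2) * ennreal (exp (- (1 / 2 * (cmod u)\<^sup>2))) \<partial>lborel) * emeasure lborel A"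
    by (rule nn_integral_multc) simp
  also have "(\<integral>\<^sup>+u. ennreal (1 / pi\<^sup>2) * ennreal (exp (- (1 / 2 * (cmod u)\<^sup>2))) \<partial>lborel)
      = ennreal (1 / pi\<^sup>2) * ennreal (pi / (1 / 2))"
    by (subst nn_integral_cmult) (use nn_integral_gauss_complex[of "1/2"] in simp_all)
  also have "\<dots> * emeasure lborel A \<le> 1 * emeasure lborel A"
    using pi_gt3 by (intro mult_right_mono) (simp_all add: ennreal_mult[symmetric] power2_eq_square)
  finally show ?thesis by simp
qed

text \<open>The slope density is bounded below near \<zeta>, so a disc of radius r has probability
  of order at least r^2. The restriction r \<le> 1 keeps the slopes in a fixed bounded region and
  the constant uniform.\<close>

lemma measure_cgauss_ratio_cball_ge:
  fixes \<zeta> :: complex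
  shows "\<exists>c>0. \<forall>r\<in>{0..1}. c * r\<^sup>2 \<le> measure cgauss_vec {g. cmod (ratio g - \<zeta>) \<le> r}"
proof -
  interpret prob_space cgauss_vec by (rule prob_space_cgauss_vec)
  define R where "R = 1 + cmod \<zeta>"
  define d where "d = 1/4 * exp (- 2 * (1 + R\<^sup>2)) / pi\<^sup>2"
  have d: "d > 0" by (simp add: d_def)
  \<comment> \<open>A square of area 1/4 on which |u|^2 lies between 1/4 and 2, so that the
    integrand is at least \<open>d\<close> there.\<close>
  define U where "U = cbox (Complex (1/2) (1/2)) (Complex 1 1)"
  have U: "emeasure lborel U = ennreal (1/4)"
    unfolding U_def by (subst emeasure_lborel_cbox) (auto simp: Basis_complex_def inner_complex_def)
  have Ub: "1/4 \<le> (cmod u)\<^sup>2 \<and> (cmod u)\<^sup>2 \<le> 2" if "u \<in> U" for u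
  proof -
    have "1/2 \<le> Re u" "1/2 \<le> Im u" "Re u \<le> 1" "Im u \<le> 1"
      using that by (auto simp: U_def cbox_def Basis_complex_def inner_complex_def)
    then have "(1/2)\<^sup>2 \<le> (Re u)\<^sup>2" "(Re u)\<^sup>2 \<le> 1\<^sup>2" "0 \<le> (Im u)\<^sup>2" "(Im u)\<^sup>2 \<le> 1\<^sup>2"
      by (intro power_mono zero_le_power2; simp)+
    moreover have "(1/2)\<^sup>2 = (1/4 :: real)" by (simp add: power_divide)
    ultimately show ?thesis unfolding cmod_power2 power_one by linarith
  qed
  show ?thesis
  proof (intro exI[of _ "d / 4"] conjI ballI)
    show "0 < d / 4" using d by simp
    fix r :: real assume r: "r \<in> {0..1}"
    define A where "A = cbox (\<zeta> - Complex (r/2) (r/2)) (\<zeta> + Complex (r/2) (r/2))"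
    have [measurable]: "A \<in> sets borel" "U \<in> sets borel" by (auto simp: A_def U_def)
    have A: "emeasure lborel A = ennreal (r\<^sup>2)"
      unfolding A_def using r
      by (subst emeasure_lborel_cbox) (auto simp: Basis_complex_def inner_complex_def power2_eq_square)
    have As: "cmod (z - \<zeta>) \<le> r" if "z \<in> A" for z
    proof -
      have "\<bar>Re (z - \<zeta>)\<bar> \<le> r/2" "\<bar>Im (z - \<zeta>)\<bar> \<le> r/2"
        using that unfolding abs_le_iff
        by (auto simp: A_def cbox_def Basis_complex_def inner_complex_def)
      then show ?thesis using cmod_le[of "z - \<zeta>"] by linarith
    qed
    have Ab: "(cmod z)\<^sup>2 \<le> R\<^sup>2" if "z \<in> A" for z
    proof (intro power_mono)
      show "cmod z \<le> R"
        using As[OF that] norm_triangle_sub[of z \<zeta>] r by (simp add: R_def)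
    qed simp
    have "ennreal (d / 4 * r\<^sup>2) = (\<integral>\<^sup>+u. indicator U u * (ennreal d * emeasure lborel A) \<partial>lborel)"
      using d by (subst nn_integral_multc) (auto simp: U A ennreal_mult[symmetric])
    also have "\<dots> = (\<integral>\<^sup>+u. (\<integral>\<^sup>+z. indicator U u * ennreal d * indicator A z \<partial>lborel) \<partial>lborel)"
      by (subst nn_integral_cmult_indicator) (auto simp: mult.assoc)
    also have "\<dots> \<le> (\<integral>\<^sup>+u. \<integral>\<^sup>+z. ennreal ((cmod u)\<^sup>2 * exp (- (cmod u)\<^sup>2 * (1 + (cmod z)\<^sup>2)) / pi\<^sup>2) * indicator A z \<partial>lborel \<partial>lborel)"
    proof (intro nn_integral_mono)
      fix u z :: complex
      have "d \<le> (cmod u)\<^sup>2 * exp (- (cmod u)\<^sup>2 * (1 + (cmod z)\<^sup>2)) / pi\<^sup>2" if uz: "u \<in> U" "z \<in> A"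
      proof -
        have "(cmod u)\<^sup>2 * (1 + (cmod z)\<^sup>2) \<le> 2 * (1 + R\<^sup>2)"
          using Ub[OF uz(1)] Ab[OF uz(2)] by (intro mult_mono) auto
        then have "exp (- 2 * (1 + R\<^sup>2)) \<le> exp (- (cmod u)\<^sup>2 * (1 + (cmod z)\<^sup>2))" by simp
        then have "1/4 * exp (- 2 * (1 + R\<^sup>2)) \<le> (cmod u)\<^sup>2 * exp (- (cmod u)\<^sup>2 * (1 + (cmod z)\<^sup>2))"
          using Ub[OF uz(1)] by (intro mult_mono) auto
        then show ?thesis unfolding d_def by (rule divide_right_mono) simp
      qed
      then show "indicator U u * ennreal d * indicator A z
        \<le> ennreal ((cmod u)\<^sup>2 * exp (- (cmod u)\<^sup>2 * (1 + (cmod z)\<^sup>2)) / pi\<^sup>2) * indicator A z"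
        by (auto simp: indicator_def intro!: ennreal_leI)
    qed
    also have "\<dots> = emeasure cgauss_vec {g. ratio g \<in> A}"
      by (rule emeasure_cgauss_ratio[symmetric]) simp
    also have "\<dots> \<le> emeasure cgauss_vec {g. cmod (ratio g - \<zeta>) \<le> r}"
      using As by (intro emeasure_mono) auto
    finally show "d / 4 * r\<^sup>2 \<le> measure cgauss_vec {g. cmod (ratio g - \<zeta>) \<le> r}"
      by (simp add: emeasure_eq_measure)
  qed
qed

lemma emeasure_lborel_ball_complex_le:
  assumes "0 \<le> r"
  shows "emeasure lborel {z :: complex. cmod (z - c) \<le> r} \<le> ennreal (4 * r\<^sup>2)"
proof -
  have "emeasure lborel {z :: complex. cmod (z - c) \<le> r} \<le> emeasure lborel (cbox (c - Complex r r) (c + Complex r r))"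
  proof (intro emeasure_mono)
    show "{z. cmod (z - c) \<le> r} \<subseteq> cbox (c - Complex r r) (c + Complex r r)"
    proof
      fix z assume "z \<in> {z. cmod (z - c) \<le> r}"
      then have "\<bar>Re (z - c)\<bar> \<le> r" "\<bar>Im (z - c)\<bar> \<le> r"
        using abs_Re_le_cmod[of "z - c"] abs_Im_le_cmod[of "z - c"] by auto
      then show "z \<in> cbox (c - Complex r r) (c + Complex r r)"
        by (auto simp: cbox_def Basis_complex_def inner_complex_def)
    qed
  qed simp
  also have "\<dots> = ennreal (4 * r\<^sup>2)"
    using assms by (subst emeasure_lborel_cbox) (auto simp: Basis_complex_def inner_complex_def power2_eq_square)
  finally show ?thesis .
qed

lemma nn_integral_cgauss_vec_swap:
  assumes [measurable]: "f \<in> borel_measurable borel"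
  shows "(\<integral>\<^sup>+g. f g \<partial>cgauss_vec) = (\<integral>\<^sup>+g. f (vec2 (g $ 2, g $ 1)) \<partial>cgauss_vec)"
proof -
  have [measurable]: "(\<lambda>p. vec2 p :: cvec) \<in> borel_measurable (borel \<Otimes>\<^sub>M borel)"
    unfolding borel_prod by simp
  have [measurable]: "(\<lambda>p. vec2 p :: cvec) \<in> borel_measurable (lborel \<Otimes>\<^sub>M lborel)"
    unfolding lborel_prod by simp
  have [measurable]: "(\<lambda>p. vec2 (snd p, fst p) :: cvec) \<in> borel_measurable (lborel \<Otimes>\<^sub>M lborel)"
    by (rule measurable_compose[of _ _ "borel \<Otimes>\<^sub>M borel"]) measurable
  have "(\<integral>\<^sup>+g. f g \<partial>cgauss_vec)
     = (\<integral>\<^sup>+u. \<integral>\<^sup>+v. ennreal (exp (- ((cmod u)\<^sup>2 + (cmod v)\<^sup>2)) / pi\<^sup>2) * f (vec2 (u, v)) \<partial>lborel \<partial>lborel)"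
    by (rule nn_integral_cgauss_vec) simp
  also have "\<dots> = (\<integral>\<^sup>+v. \<integral>\<^sup>+u. ennreal (exp (- ((cmod u)\<^sup>2 + (cmod v)\<^sup>2)) / pi\<^sup>2) * f (vec2 (u, v)) \<partial>lborel \<partial>lborel)"
    by (rule lborel_pair.Fubini') (simp add: split_beta)
  also have "\<dots> = (\<integral>\<^sup>+g. f (vec2 (g $ 2, g $ 1)) \<partial>cgauss_vec)"
    by (subst nn_integral_cgauss_vec) (simp_all add: add.commute)
  finally show ?thesis .
qed

text \<open>Exchanging the two entries preserves the Gaussian law and inverts the slope, so a large
  slope has the probability of a slope in a disc of radius 1 / R. This tail bound carries the case
  of a zero scaling.\<close>

lemma measure_cgauss_ratio_gt_le:
  assumes "0 < R"
  shows "measure cgauss_vec {g. R < cmod (ratio g)} \<le> 4 / R\<^sup>2"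
proof -
  interpret prob_space cgauss_vec by (rule prob_space_cgauss_vec)
  have [measurable]: "{z :: complex. cmod (z - 0) \<le> 1 / R} \<in> sets borel" by measurable
  have "emeasure cgauss_vec {g. R < cmod (ratio g)} = (\<integral>\<^sup>+g. indicator {g. R < cmod (ratio g)} g \<partial>cgauss_vec)"
    by (subst nn_integral_indicator) auto
  also have "\<dots> = (\<integral>\<^sup>+g. indicator {g. R < cmod (ratio g)} (vec2 (g $ 2, g $ 1)) \<partial>cgauss_vec)"
    by (rule nn_integral_cgauss_vec_swap) measurable
  also have "\<dots> \<le> (\<integral>\<^sup>+g. indicator {g. ratio g \<in> {z. cmod (z - 0) \<le> 1 / R}} g \<partial>cgauss_vec)"
  proof (intro nn_integral_mono)
    fix g :: cvec
    have "cmod (g $ 2 / g $ 1) \<le> 1 / R" if "R < cmod (g $ 1 / g $ 2)"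
    proof -
      have "inverse (cmod (g $ 1 / g $ 2)) \<le> inverse R"
        using that assms by (intro le_imp_inverse_le) auto
      then show ?thesis by (simp add: norm_divide field_simps)
    qed
    then show "indicator {g. R < cmod (ratio g)} (vec2 (g $ 2, g $ 1))
        \<le> (indicator {g. ratio g \<in> {z. cmod (z - 0) \<le> 1 / R}} g :: ennreal)"
      by (auto simp: indicator_def ratio_def)
  qed
  also have "\<dots> = emeasure cgauss_vec {g. ratio g \<in> {z. cmod (z - 0) \<le> 1 / R}}"
    by (subst nn_integral_indicator) auto
  also have "\<dots> \<le> emeasure lborel {z :: complex. cmod (z - 0) \<le> 1 / R}"
    by (rule emeasure_cgauss_ratio_le) measurable
  also have "\<dots> \<le> ennreal (4 * (1 / R)\<^sup>2)"
    by (rule emeasure_lborel_ball_complex_le) (use assms in simp)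
  finally show ?thesis
    by (simp add: emeasure_eq_measure power_divide)
qed

lemma AE_cgauss_vec_nth_1_nonzero: "AE g in cgauss_vec. g $ 1 \<noteq> 0"
proof -
  have "(\<integral>\<^sup>+g. indicator {g. g $ 1 = 0} g \<partial>cgauss_vec)
     = (\<integral>\<^sup>+u. \<integral>\<^sup>+v. ennreal (exp (- ((cmod u)\<^sup>2 + (cmod v)\<^sup>2)) / pi\<^sup>2) * indicator {g :: cvec. g $ 1 = 0} (vec2 (u, v)) \<partial>lborel \<partial>lborel)"
    by (rule nn_integral_cgauss_vec) measurable
  also have "\<dots> = (\<integral>\<^sup>+u. 0 \<partial>(lborel :: complex measure))"
    by (rule nn_integral_cong_AE, rule AE_mp[OF AE_lborel_singleton[of 0]]) (auto intro!: AE_I2)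
  finally have "emeasure cgauss_vec {g. g $ 1 = 0} = 0"
    by (subst (asm) nn_integral_indicator) auto
  then show ?thesis
    by (subst AE_iff_measurable[where N = "{g. g $ 1 = 0}"]) auto
qed

text \<open>The squared norm of a matrix is the sum over its rows, so the density factors and the
  two rows are independent Gaussian vectors.\<close>

lemma chan_meas_eq_distr: "chan_meas = distr (cgauss_vec \<Otimes>\<^sub>M cgauss_vec) borel vec2"
proof -
  interpret prob_space cgauss_vec by (rule prob_space_cgauss_vec)
  have [measurable]: "(vec2 :: cvec \<times> cvec \<Rightarrow> _) \<in> borel_measurable (lborel \<Otimes>\<^sub>M lborel)"
    unfolding lborel_prod by simp
  have "chan_meas = density (distr (lborel \<Otimes>\<^sub>M lborel) borel vec2) (\<lambda>H. ennreal (exp (- (norm H)\<^sup>2) / pi ^ 4))"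
    unfolding chan_meas_def by (subst lborel_vec2_eq_distr) (rule refl)
  also have "\<dots> = distr (density (lborel \<Otimes>\<^sub>M lborel) (\<lambda>p. ennreal (exp (- (norm (vec2 p :: complex^2^2))\<^sup>2) / pi ^ 4))) borel vec2"
    by (rule density_distr) auto
  also have "density (lborel \<Otimes>\<^sub>M lborel) (\<lambda>p. ennreal (exp (- (norm (vec2 p :: complex^2^2))\<^sup>2) / pi ^ 4))
     = cgauss_vec \<Otimes>\<^sub>M cgauss_vec"
    unfolding cgauss_vec_def
  proof (subst pair_measure_density)
    show "sigma_finite_measure (density lborel (\<lambda>v :: cvec. ennreal (exp (- (norm v)\<^sup>2) / pi\<^sup>2)))"
      using sigma_finite_measure_axioms by (simp add: cgauss_vec_def)
    show "density (lborel \<Otimes>\<^sub>M lborel) (\<lambda>p. ennreal (exp (- (norm (vec2 p :: complex^2^2))\<^sup>2) / pi ^ 4))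
      = density (lborel \<Otimes>\<^sub>M lborel) (\<lambda>(x, y). ennreal (exp (- (norm (x :: cvec))\<^sup>2) / pi\<^sup>2) * ennreal (exp (- (norm (y :: cvec))\<^sup>2) / pi\<^sup>2))"
      by (intro arg_cong[of _ _ "density _"])
         (auto simp: fun_eq_iff norm_vec2_square ennreal_mult[symmetric] mult_exp_exp simp flip: power_add)
  qed (auto intro: lborel.sigma_finite_measure_axioms)
  finally show ?thesis .
qed

section \<open>Quantizer and precoder in the slope coordinate\<close>

text \<open>The norm of the vector (1, z), that is, the normalising factor in the slope
  coordinate.\<close>

definition hyp :: "complex \<Rightarrow> real" where
  "hyp z = sqrt (1 + (cmod z)\<^sup>2)"

lemma hyp_ge_1: "1 \<le> hyp z"
  by (simp add: hyp_def)

lemma hyp_pos [simp]: "0 < hyp z" "hyp z \<noteq> 0" "0 \<le> hyp z"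
  using hyp_ge_1[of z] by linarith+

lemma hyp_square: "(hyp z)\<^sup>2 = 1 + (cmod z)\<^sup>2"
  by (simp add: hyp_def)

lemma cmod_le_hyp: "cmod z \<le> hyp z"
  unfolding hyp_def by (rule real_le_rsqrt) simp

lemma hyp_le: "hyp z \<le> 1 + cmod z"
  unfolding hyp_def by (rule real_le_lsqrt) (auto simp: power2_sum)

definition line_rep :: "complex \<Rightarrow> cvec" where
  "line_rep z = vec2 (complex_of_real (1 / hyp z), z / complex_of_real (hyp z))"

lemma norm_cvec_square: "(norm (g :: cvec))\<^sup>2 = (cmod (g $ 1))\<^sup>2 + (cmod (g $ 2))\<^sup>2"
  by (simp add: norm_vec_def L2_set_def sum_2)

lemma vec2_eqI: "g $ 1 = fst p \<Longrightarrow> g $ 2 = snd p \<Longrightarrow> g = vec2 p"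
  by (simp add: vec_eq_iff forall_2)

text \<open>Scaling and phase rotation leave the slope unchanged; the phase normalisation makes the
  first entry |g_1| / |g|, which is 1 / \<open>hyp (ratio g)\<close>.\<close>

lemma codeword_eq_line_rep:
  assumes g: "g $ 1 \<noteq> 0"
  shows "codeword g = line_rep (ratio g)"
proof -
  have "(norm g)\<^sup>2 = (cmod (g $ 1) * hyp (ratio g))\<^sup>2"
    using g by (simp add: norm_cvec_square power_mult_distrib hyp_square ratio_def norm_divide field_simps)
  then have n: "norm g = cmod (g $ 1) * hyp (ratio g)"
    by (simp add: power2_eq_iff_nonneg)
  have u: "unitize g $ k = g $ k / complex_of_real (norm g)" for k
    unfolding unitize_def vector_scaleR_component by (simp add: scaleR_conv_of_real divide_inverse mult.commute)
  have ng: "norm g \<noteq> 0" using g by auto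
  have ph: "cnj (unitize g $ 1) / complex_of_real (cmod (unitize g $ 1)) = cnj (g $ 1) / complex_of_real (cmod (g $ 1))"
    using ng g by (simp add: u norm_divide)
  have cc: "cnj (g $ 1) * g $ 1 = complex_of_real (cmod (g $ 1)) * complex_of_real (cmod (g $ 1))"
    using complex_norm_square[of "g $ 1"] by (simp add: power2_eq_square mult.commute)
  have [simp]: "complex_of_real (cmod (g $ 1)) \<noteq> 0" "complex_of_real (hyp (ratio g)) \<noteq> 0"
    using g by auto
  show ?thesis
    unfolding line_rep_def
  proof (rule vec2_eqI)
    have "codeword g $ 1 = cnj (g $ 1) * g $ 1 / (complex_of_real (cmod (g $ 1)) * complex_of_real (norm g))"
      using g ng by (simp add: codeword_def phase_norm_def ph) (simp add: u)
    also have "\<dots> = complex_of_real (1 / hyp (ratio g))"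
      unfolding cc n using g by (simp add: field_simps)
    finally show "codeword g $ 1 = fst (complex_of_real (1 / hyp (ratio g)), ratio g / complex_of_real (hyp (ratio g)))"
      by simp
    have "codeword g $ 2 = cnj (g $ 1) * g $ 2 / (complex_of_real (cmod (g $ 1)) * complex_of_real (norm g))"
      using g ng by (simp add: codeword_def phase_norm_def ph) (simp add: u)
    also have "g $ 2 = ratio g * g $ 1"
      using g by (simp add: ratio_def)
    also have "cnj (g $ 1) * (ratio g * g $ 1) = ratio g * (cnj (g $ 1) * g $ 1)" by simp
    also have "ratio g * (cnj (g $ 1) * g $ 1) / (complex_of_real (cmod (g $ 1)) * complex_of_real (norm g))
       = ratio g / complex_of_real (hyp (ratio g))"
      unfolding cc n using g by (simp add: field_simps)
    finally show "codeword g $ 2 = snd (complex_of_real (1 / hyp (ratio g)), ratio g / complex_of_real (hyp (ratio g)))"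
      by simp
  qed
qed

text \<open>The absolute cosine between the real vectors (1, Re z, Im z) and (1, Re \<zeta>, Im
  \<zeta>). It is the inner product in \<open>r3\<close> and not the modulus of the Hermitian
  product, hence the real part.\<close>

definition similarity :: "complex \<Rightarrow> complex \<Rightarrow> real" where
  "similarity z \<zeta> = \<bar>1 + Re (z * cnj \<zeta>)\<bar> / (hyp z * hyp \<zeta>)"

lemma similarity_eq: "\<bar>r3 (line_rep z) \<bullet> r3 (line_rep \<zeta>)\<bar> = similarity z \<zeta>"
proof -
  have "r3 (line_rep z) \<bullet> r3 (line_rep \<zeta>) = (1 + Re (z * cnj \<zeta>)) / (hyp z * hyp \<zeta>)"
    by (simp add: r3_def inner_vec_def sum_3 line_rep_def add_divide_distrib)
  then show ?thesis
    by (simp add: similarity_def abs_divide abs_mult)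
qed

text \<open>Lagrange's identity in R^3: the numerator is the squared norm of the cross product of
  (1, Re z, Im z) and (1, Re \<zeta>, Im \<zeta>), so the quotient is the squared sine of their
  angle.\<close>

lemma similarity_square:
  "1 - (similarity z \<zeta>)\<^sup>2 = ((cmod (z - \<zeta>))\<^sup>2 + (Im (z * cnj \<zeta>))\<^sup>2) / ((1 + (cmod z)\<^sup>2) * (1 + (cmod \<zeta>)\<^sup>2))"
proof -
  have pos: "(1 + (cmod z)\<^sup>2) * (1 + (cmod \<zeta>)\<^sup>2) \<noteq> 0"
    by (smt (verit) mult_pos_pos zero_le_power2)
  have sq: "(similarity z \<zeta>)\<^sup>2 = (1 + Re (z * cnj \<zeta>))\<^sup>2 / ((1 + (cmod z)\<^sup>2) * (1 + (cmod \<zeta>)\<^sup>2))"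
    by (simp only: similarity_def power_divide power_mult_distrib hyp_square power2_abs)
  have num: "(1 + (cmod z)\<^sup>2) * (1 + (cmod \<zeta>)\<^sup>2) - (1 + Re (z * cnj \<zeta>))\<^sup>2 = (cmod (z - \<zeta>))\<^sup>2 + (Im (z * cnj \<zeta>))\<^sup>2"
    by (simp only: cmod_power2 minus_complex.simps complex_cnj times_complex.simps) (simp add: power2_eq_square algebra_simps)
  show ?thesis
    unfolding sq num[symmetric] diff_divide_distrib using pos by simp
qed

text \<open>The imaginary part does not change when z is replaced by z - \<zeta>, so it is at most
  |z - \<zeta>| |\<zeta>|; the resulting factor 1 + |\<zeta>|^2 cancels against the
  denominator.\<close>

lemma similarity_square_le: "1 - (similarity z \<zeta>)\<^sup>2 \<le> (cmod (z - \<zeta>))\<^sup>2"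
proof -
  have "Im (z * cnj \<zeta>) = Im ((z - \<zeta>) * cnj \<zeta>)" by (simp add: algebra_simps)
  then have "\<bar>Im (z * cnj \<zeta>)\<bar> \<le> cmod (z - \<zeta>) * cmod \<zeta>"
    using abs_Im_le_cmod[of "(z - \<zeta>) * cnj \<zeta>"] by (simp add: norm_mult)
  then have "(Im (z * cnj \<zeta>))\<^sup>2 \<le> (cmod (z - \<zeta>) * cmod \<zeta>)\<^sup>2"
    by (rule abs_le_square_iff[THEN iffD1, OF order_trans]) simp
  then have "(cmod (z - \<zeta>))\<^sup>2 + (Im (z * cnj \<zeta>))\<^sup>2 \<le> (cmod (z - \<zeta>))\<^sup>2 * (1 + (cmod \<zeta>)\<^sup>2)"
    by (simp add: power_mult_distrib algebra_simps)
  moreover have "1 * (1 + (cmod \<zeta>)\<^sup>2) \<le> (1 + (cmod z)\<^sup>2) * (1 + (cmod \<zeta>)\<^sup>2)"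
    by (intro mult_right_mono) auto
  then have "(cmod (z - \<zeta>))\<^sup>2 * (1 + (cmod \<zeta>)\<^sup>2) \<le> (cmod (z - \<zeta>))\<^sup>2 * ((1 + (cmod z)\<^sup>2) * (1 + (cmod \<zeta>)\<^sup>2))"
    by (intro mult_left_mono) auto
  ultimately have "(cmod (z - \<zeta>))\<^sup>2 + (Im (z * cnj \<zeta>))\<^sup>2 \<le> (cmod (z - \<zeta>))\<^sup>2 * ((1 + (cmod z)\<^sup>2) * (1 + (cmod \<zeta>)\<^sup>2))"
    by linarith
  then show ?thesis
    unfolding similarity_square by (subst pos_divide_le_eq) (auto intro!: mult_pos_pos add_pos_nonneg)
qed

lemma dist_square_le_similarity:
  "(cmod (z - \<zeta>))\<^sup>2 \<le> (1 - (similarity z \<zeta>)\<^sup>2) * ((1 + (cmod z)\<^sup>2) * (1 + (cmod \<zeta>)\<^sup>2))"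
proof -
  have "(1 + (cmod z)\<^sup>2) * (1 + (cmod \<zeta>)\<^sup>2) \<noteq> 0"
    by (smt (verit) mult_pos_pos zero_le_power2)
  then show ?thesis unfolding similarity_square by simp
qed

text \<open>Converting similarity back to distance costs the factor 1 + |z|^2, for which no bound is
  known in advance. It is at most 2 K + 2 D^2, and the smallness of \<rho> makes the D^2
  contribution at most D^2 / 2, which is absorbed on the left.\<close>

lemma more_similar_imp_close:
  assumes w: "cmod (w - \<zeta>) \<le> \<rho>" and \<rho>: "4 * (1 + (cmod \<zeta>)\<^sup>2) * \<rho>\<^sup>2 \<le> 1"
    and le: "similarity w \<zeta> \<le> similarity z \<zeta>"
  shows "cmod (z - \<zeta>) \<le> 2 * (1 + (cmod \<zeta>)\<^sup>2) * \<rho>"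
proof -
  define K D where "K = 1 + (cmod \<zeta>)\<^sup>2" and "D = cmod (z - \<zeta>)"
  have K: "1 \<le> K" by (simp add: K_def)
  have \<rho>0: "0 \<le> \<rho>" using w norm_ge_zero order_trans by blast
  have "0 \<le> similarity w \<zeta>" by (simp add: similarity_def)
  then have "(similarity w \<zeta>)\<^sup>2 \<le> (similarity z \<zeta>)\<^sup>2" using le by (intro power_mono)
  then have "1 - (similarity z \<zeta>)\<^sup>2 \<le> (cmod (w - \<zeta>))\<^sup>2"
    using similarity_square_le[of w \<zeta>] by simp
  also have "\<dots> \<le> \<rho>\<^sup>2" using w by (intro power_mono) auto
  finally have s: "1 - (similarity z \<zeta>)\<^sup>2 \<le> \<rho>\<^sup>2" .
  have "cmod z \<le> cmod \<zeta> + D" using norm_triangle_sub[of z \<zeta>] by (simp add: D_def)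
  then have "(cmod z)\<^sup>2 \<le> (cmod \<zeta> + D)\<^sup>2" by (intro power_mono) auto
  also have "\<dots> \<le> 2 * (cmod \<zeta>)\<^sup>2 + 2 * D\<^sup>2"
    using sum_squares_bound[of "cmod \<zeta>" D] by (simp add: power2_sum)
  finally have zz: "1 + (cmod z)\<^sup>2 \<le> 2 * K + 2 * D\<^sup>2" by (simp add: K_def)
  have "D\<^sup>2 \<le> (1 - (similarity z \<zeta>)\<^sup>2) * ((1 + (cmod z)\<^sup>2) * K)"
    using dist_square_le_similarity[of z \<zeta>] by (simp add: D_def K_def)
  also have "\<dots> \<le> \<rho>\<^sup>2 * ((2 * K + 2 * D\<^sup>2) * K)"
    using s zz K by (intro mult_mono mult_right_mono) auto
  also have "\<dots> = 2 * K\<^sup>2 * \<rho>\<^sup>2 + (4 * K * \<rho>\<^sup>2) * (D\<^sup>2 / 2)"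
    by (simp add: power2_eq_square algebra_simps)
  also have "(4 * K * \<rho>\<^sup>2) * (D\<^sup>2 / 2) \<le> 1 * (D\<^sup>2 / 2)"
    using \<rho> by (intro mult_right_mono) (auto simp: K_def)
  finally have "D\<^sup>2 \<le> (2 * K * \<rho>)\<^sup>2"
    by (simp add: power_mult_distrib)
  moreover have "0 \<le> 2 * K * \<rho>" using \<rho>0 K by simp
  ultimately have "D \<le> 2 * K * \<rho>" by (rule power2_le_imp_le)
  then show ?thesis by (simp add: D_def K_def)
qed

text \<open>The first maximiser, isolated from \<open>quantize\<close> so that its measurability and
  maximality can be stated for an arbitrary score.\<close>

definition pick :: "nat \<Rightarrow> (nat \<Rightarrow> real) \<Rightarrow> nat" where
  "pick N sc = (LEAST k. k < N \<and> (\<forall>k'<N. sc k' \<le> sc k))"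

lemma pick:
  assumes "0 < N"
  shows "pick N sc < N" "\<And>k. k < N \<Longrightarrow> sc k \<le> sc (pick N sc)"
proof -
  have "Max (sc ` {..<N}) \<in> sc ` {..<N}" using assms by (intro Max_in) auto
  then obtain k where "k < N" "sc k = Max (sc ` {..<N})" by auto
  then have "k < N \<and> (\<forall>k'<N. sc k' \<le> sc k)" by simp
  then have "pick N sc < N \<and> (\<forall>k'<N. sc k' \<le> sc (pick N sc))"
    unfolding pick_def by (rule LeastI)
  then show "pick N sc < N" "\<And>k. k < N \<Longrightarrow> sc k \<le> sc (pick N sc)" by auto
qed

lemma pick_cong: "(\<And>k. k < N \<Longrightarrow> sc k = sc' k) \<Longrightarrow> pick N sc = pick N sc'"
  unfolding pick_def by (rule arg_cong[of _ _ Least]) auto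

text \<open>The quantizer read in the slope coordinate: it sees the channel only through
  \<zeta>.\<close>

definition sel :: "nat \<Rightarrow> complex \<Rightarrow> (nat \<Rightarrow> cvec) \<Rightarrow> complex" where
  "sel N \<zeta> G = ratio (G (pick N (\<lambda>k. similarity (ratio (G k)) \<zeta>)))"

lemma sel_in: "0 < N \<Longrightarrow> \<exists>k<N. sel N \<zeta> G = ratio (G k)"
  unfolding sel_def using pick(1) by blast

lemma sel_close:
  assumes "k < N" "cmod (ratio (G k) - \<zeta>) \<le> \<rho>" "4 * (1 + (cmod \<zeta>)\<^sup>2) * \<rho>\<^sup>2 \<le> 1"
  shows "cmod (sel N \<zeta> G - \<zeta>) \<le> 2 * (1 + (cmod \<zeta>)\<^sup>2) * \<rho>"
proof -
  have "0 < N" using assms(1) by simp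
  then have "similarity (ratio (G k)) \<zeta> \<le> similarity (sel N \<zeta> G) \<zeta>"
    unfolding sel_def using pick(2)[of N k "\<lambda>k. similarity (ratio (G k)) \<zeta>"] assms(1) by simp
  with assms(2,3) show ?thesis by (rule more_similar_imp_close)
qed

lemma quantize_eq_line_rep_sel:
  assumes "0 < N" "\<And>k. k < N \<Longrightarrow> G k $ 1 \<noteq> 0" "h $ 1 \<noteq> 0"
  shows "quantize N G (unitize h) = line_rep (sel N (ratio h) G)"
proof -
  have ph: "phase_norm (unitize h) = line_rep (ratio h)"
    using codeword_eq_line_rep[OF assms(3)] by (simp add: codeword_def)
  have p: "pick N (\<lambda>k. \<bar>r3 (codeword (G k)) \<bullet> r3 (phase_norm (unitize h))\<bar>) = pick N (\<lambda>k. similarity (ratio (G k)) (ratio h))"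
    by (rule pick_cong) (simp add: ph codeword_eq_line_rep assms(2) similarity_eq)
  have "quantize N G (unitize h) = codeword (G (pick N (\<lambda>k. \<bar>r3 (codeword (G k)) \<bullet> r3 (phase_norm (unitize h))\<bar>)))"
    by (simp add: quantize_def pick_def)
  also have "\<dots> = line_rep (sel N (ratio h) G)"
    unfolding p sel_def by (intro codeword_eq_line_rep assms(2) pick(1) assms(1))
  finally show ?thesis .
qed

text \<open>In C^2 the complement of (1, c) is the line through (- cnj c, 1), so the projection is a
  multiple \<open>a\<close> of a unit vector determined by \<open>c\<close>, and normalisation
  retains only the phase of \<open>a\<close>, which is that of d - c. For d = c both sides are 0
  because \<open>sgn 0 = 0\<close>.\<close>

lemma unitize_proj_perp_line_rep:
  "unitize (proj_perp (line_rep c) (line_rep d)) = sgn (d - c) *s vec2 (- cnj c / complex_of_real (hyp c), 1 / complex_of_real (hyp c))"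
proof -
  have nc: "(norm (line_rep c))\<^sup>2 = 1"
    unfolding norm_cvec_square line_rep_def
    by (simp add: norm_divide power_divide hyp_square add_divide_distrib[symmetric] add_pos_nonneg)
       (smt (verit) zero_le_power2)
  have hh: "complex_of_real (hyp c) * complex_of_real (hyp c) = 1 + c * cnj c"
    unfolding complex_norm_square[symmetric] of_real_mult[symmetric] power2_eq_square[of "hyp c", symmetric] hyp_square by simp
  define a where "a = (d - c) / (complex_of_real (hyp d) * complex_of_real (hyp c))"
  have herm: "herm (line_rep c) (line_rep d) = (1 + cnj c * d) / (complex_of_real (hyp c) * complex_of_real (hyp d))"
    by (simp add: herm_def sum_2 line_rep_def add_divide_distrib)
  have hc: "complex_of_real (hyp c) \<noteq> 0" "complex_of_real (hyp d) \<noteq> 0" by auto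
  have pr: "proj_perp (line_rep c) (line_rep d) = vec2 (a * (- cnj c / complex_of_real (hyp c)), a * (1 / complex_of_real (hyp c)))"
  proof (rule vec2_eqI)
    have "proj_perp (line_rep c) (line_rep d) $ 1
      = ((complex_of_real (hyp c) * complex_of_real (hyp c)) - (1 + cnj c * d)) / (complex_of_real (hyp c) * complex_of_real (hyp c) * complex_of_real (hyp d))"
      unfolding proj_perp_def herm nc using hc by (simp add: line_rep_def) (simp add: field_simps)
    also have "\<dots> = a * (- cnj c / complex_of_real (hyp c))"
      unfolding a_def using hc by (subst (1) hh) (simp add: field_simps)
    finally show "proj_perp (line_rep c) (line_rep d) $ 1 = fst (a * (- cnj c / complex_of_real (hyp c)), a * (1 / complex_of_real (hyp c)))" by simp
    have "proj_perp (line_rep c) (line_rep d) $ 2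
      = (d * (complex_of_real (hyp c) * complex_of_real (hyp c)) - c * (1 + cnj c * d)) / (complex_of_real (hyp c) * complex_of_real (hyp c) * complex_of_real (hyp d))"
      unfolding proj_perp_def herm nc using hc by (simp add: line_rep_def) (simp add: field_simps)
    also have "\<dots> = a * (1 / complex_of_real (hyp c))"
      unfolding a_def using hc by (subst (1) hh) (simp add: field_simps)
    finally show "proj_perp (line_rep c) (line_rep d) $ 2 = snd (a * (- cnj c / complex_of_real (hyp c)), a * (1 / complex_of_real (hyp c)))" by simp
  qed
  have "(norm (proj_perp (line_rep c) (line_rep d)))\<^sup>2 = (cmod a)\<^sup>2"
  proof -
    have "(norm (proj_perp (line_rep c) (line_rep d)))\<^sup>2 = (cmod a)\<^sup>2 * ((1 + (cmod c)\<^sup>2) / (hyp c)\<^sup>2)"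
      unfolding pr norm_cvec_square
      by (simp add: norm_mult norm_divide power_mult_distrib power_divide add_divide_distrib ring_distribs)
    then show ?thesis by (simp add: hyp_square[symmetric])
  qed
  then have np: "norm (proj_perp (line_rep c) (line_rep d)) = cmod a"
    by (simp add: power2_eq_iff_nonneg)
  have sg: "inverse (cmod a) *\<^sub>R a = sgn (d - c)"
  proof -
    have "a = complex_of_real (1 / (hyp d * hyp c)) * (d - c)" by (simp add: a_def)
    then have "sgn a = complex_of_real (sgn (1 / (hyp d * hyp c))) * sgn (d - c)"
      by (simp only: sgn_mult sgn_of_real)
    also have "sgn (1 / (hyp d * hyp c)) = 1" by (intro sgn_pos) simp
    finally show ?thesis by (simp add: sgn_div_norm)
  qed
  have "unitize (proj_perp (line_rep c) (line_rep d)) $ k = (inverse (cmod a) *\<^sub>R a) * vec2 (- cnj c / complex_of_real (hyp c), 1 / complex_of_real (hyp c)) $ k" for k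
    unfolding unitize_def np vector_scaleR_component unfolding pr
    using exhaust_2[of k] by auto
  then show ?thesis by (simp add: vec_eq_iff sg)
qed

text \<open>\<open>amp \<zeta> c\<^sub>1 c\<^sub>2 d\<^sub>1 d\<^sub>2\<close> is the normalised gain, towards a receiver whose channel has
  slope \<open>\<zeta>\<close>, of the beam whose entry \<open>j\<close> is computed by transmitter \<open>j\<close>, which nulls the
  slope \<open>c\<^sub>j\<close> and serves the slope \<open>d\<^sub>j\<close>.\<close>

definition amp :: "complex \<Rightarrow> complex \<Rightarrow> complex \<Rightarrow> complex \<Rightarrow> complex \<Rightarrow> complex" where
  "amp \<zeta> c1 c2 d1 d2 = - cnj c1 / complex_of_real (hyp c1) * sgn (d1 - c1) + cnj \<zeta> * (1 / complex_of_real (hyp c2) * sgn (d2 - c2))"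

text \<open>Pulling out the first channel entry leaves a function of slopes alone. The nulled slope
  belongs to \<open>other m\<close>, and entry k uses the slopes held by transmitter k.\<close>

lemma herm_eff_beam:
  assumes est: "\<And>l j. est B P H W l j = line_rep (Z l j)" and H: "H $ i $ 1 \<noteq> 0"
  shows "herm (H $ i) (eff_beam B P H W m)
    = complex_of_real (sqrt (P / 2)) * cnj (H $ i $ 1)
      * amp (ratio (H $ i)) (Z (other m) 1) (Z (other m) 2) (Z m 1) (Z m 2)"
proof -
  have e: "eff_beam B P H W m $ k = complex_of_real (sqrt (P / 2)) *
      (sgn (Z m k - Z (other m) k) * vec2 (- cnj (Z (other m) k) / complex_of_real (hyp (Z (other m) k)), 1 / complex_of_real (hyp (Z (other m) k))) $ k)" for k
    unfolding eff_beam_def czf_def est unitize_proj_perp_line_rep vec_lambda_beta vector_scaleR_component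
      vector_smult_component by (simp add: scaleR_conv_of_real)
  have r: "cnj (H $ i $ 2) = cnj (H $ i $ 1) * cnj (ratio (H $ i))"
    using H by (simp add: ratio_def)
  show ?thesis
    unfolding herm_def sum_2 e amp_def r vec2_nth fst_conv snd_conv by (simp only: ring_distribs mult_ac)
qed

lemma cmod_amp_le: "cmod (amp \<zeta> c1 c2 d1 d2) \<le> 1 + cmod \<zeta>"
proof -
  have s: "cmod (sgn z) \<le> 1" for z :: complex by (simp add: norm_sgn)
  have "cmod (amp \<zeta> c1 c2 d1 d2) \<le> cmod c1 / hyp c1 * cmod (sgn (d1 - c1)) + cmod \<zeta> * (1 / hyp c2 * cmod (sgn (d2 - c2)))"
    unfolding amp_def by (rule norm_triangle_le) (simp add: norm_mult norm_divide)
  also have "\<dots> \<le> 1 * 1 + cmod \<zeta> * (1 * 1)"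
    using cmod_le_hyp hyp_ge_1 s by (intro add_mono mult_mono) (auto simp: divide_le_eq)
  finally show ?thesis by simp
qed

section \<open>Measurability and codebook probabilities\<close>

text \<open>Fubini over horizontal lines: a nonempty slice lies within D of one of its points, and
  the heights fill an interval of length 2 r. The strips below can thus be measured by comparing two
  of their points at equal height, without describing their curved boundaries.\<close>

lemma emeasure_lborel_le_slices:
  fixes A :: "complex set"
  assumes [measurable]: "A \<in> sets borel" and r: "0 \<le> r" and D: "0 \<le> D"
    and Im: "\<And>z. z \<in> A \<Longrightarrow> \<bar>Im z - c\<bar> \<le> r"
    and Re: "\<And>z z'. z \<in> A \<Longrightarrow> z' \<in> A \<Longrightarrow> Im z = Im z' \<Longrightarrow> \<bar>Re z - Re z'\<bar> \<le> D"
  shows "emeasure lborel A \<le> ennreal (4 * r * D)"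
proof -
  have "emeasure lborel A = (\<integral>\<^sup>+z. indicator A z \<partial>lborel)" by simp
  also have "\<dots> = (\<integral>\<^sup>+x. \<integral>\<^sup>+y. indicator A (Complex x y) \<partial>lborel \<partial>lborel)"
    by (rule nn_integral_complex) simp
  also have "\<dots> = (\<integral>\<^sup>+y. \<integral>\<^sup>+x. indicator A (Complex x y) \<partial>lborel \<partial>lborel)"
    by (rule lborel_pair.Fubini') measurable
  also have "\<dots> \<le> (\<integral>\<^sup>+y. ennreal (2 * D) * indicator {c - r..c + r} y \<partial>lborel)"
  proof (rule nn_integral_mono)
    fix y :: real
    show "(\<integral>\<^sup>+x. indicator A (Complex x y) \<partial>lborel) \<le> ennreal (2 * D) * indicator {c - r..c + r} y"
    proof (cases "\<exists>x. Complex x y \<in> A")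
      case True
      then obtain x0 where x0: "Complex x0 y \<in> A" by blast
      have y: "y \<in> {c - r..c + r}" using Im[OF x0] by (simp add: abs_le_iff)
      have "(\<integral>\<^sup>+x. indicator A (Complex x y) \<partial>lborel) \<le> (\<integral>\<^sup>+x. indicator {x0 - D..x0 + D} x \<partial>lborel)"
      proof (rule nn_integral_mono)
        fix x :: real
        show "indicator A (Complex x y) \<le> (indicator {x0 - D..x0 + D} x :: ennreal)"
          using Re[OF x0, of "Complex x y"] by (auto simp: indicator_def abs_le_iff)
      qed
      also have "\<dots> = ennreal (2 * D)" using D by simp
      finally show ?thesis using y by simp
    next
      case False
      then have "indicator A (Complex x y) = (0 :: ennreal)" for x by auto
      then show ?thesis by simp
    qed
  qed
  also have "\<dots> = ennreal (2 * D) * ennreal (2 * r)"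
    using r by (subst nn_integral_cmult_indicator) auto
  finally show ?thesis
    using r D by (simp add: ennreal_mult[symmetric] mult_ac)
qed

section \<open>Measurability of the quantizer and the precoder\<close>

lemma borel_measurable_vec2 [measurable (raw)]:
  fixes f g :: "'b \<Rightarrow> 'a::euclidean_space"
  assumes [measurable]: "f \<in> borel_measurable M" "g \<in> borel_measurable M"
  shows "(\<lambda>x. vec2 (f x, g x)) \<in> borel_measurable M"
proof -
  have "(\<lambda>x. (f x, g x)) \<in> borel_measurable M" by measurable
  then show ?thesis by (rule measurable_compose) (rule measurable_vec2)
qed

lemma borel_measurable_cvecI:
  fixes f :: "'b \<Rightarrow> 'a::euclidean_space ^ 2"
  assumes [measurable]: "(\<lambda>x. f x $ 1) \<in> borel_measurable M" "(\<lambda>x. f x $ 2) \<in> borel_measurable M"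
  shows "f \<in> borel_measurable M"
proof -
  have eq: "f = (\<lambda>x. vec2 (f x $ 1, f x $ 2))" by (auto simp: fun_eq_iff intro!: vec2_eqI)
  show ?thesis by (subst eq) measurable
qed

lemma borel_measurable_smult_cvec [measurable (raw)]:
  fixes f :: "'b \<Rightarrow> cvec"
  assumes [measurable]: "c \<in> borel_measurable M" "f \<in> borel_measurable M"
  shows "(\<lambda>x. c x *s f x) \<in> borel_measurable M"
  by (rule borel_measurable_cvecI) simp_all

lemma borel_measurable_cnj [measurable (raw)]:
  assumes "f \<in> borel_measurable M"
  shows "(\<lambda>x. cnj (f x)) \<in> borel_measurable M"
  using assms by (rule measurable_compose)
    (intro borel_measurable_continuous_onI continuous_on_cnj continuous_on_id)

lemma borel_measurable_sgn_complex [measurable (raw)]: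
  fixes f :: "'b \<Rightarrow> complex"
  assumes [measurable]: "f \<in> borel_measurable M"
  shows "(\<lambda>x. sgn (f x)) \<in> borel_measurable M"
  unfolding sgn_div_norm by measurable

lemma measurable_unitize [measurable]: "unitize \<in> borel_measurable borel"
  unfolding unitize_def by measurable

lemma measurable_phase_norm [measurable]: "phase_norm \<in> borel_measurable borel"
  unfolding phase_norm_def by measurable

lemma measurable_codeword [measurable]: "codeword \<in> borel_measurable borel"
  unfolding codeword_def by measurable

lemma borel_measurable_herm [measurable (raw)]:
  assumes [measurable]: "f \<in> borel_measurable M" "g \<in> borel_measurable M"
  shows "(\<lambda>x. herm (f x) (g x)) \<in> borel_measurable M"
  unfolding herm_def sum_2 by measurable

lemma borel_measurable_proj_perp [measurable (raw)]:
  assumes [measurable]: "f \<in> borel_measurable M" "g \<in> borel_measurable M"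
  shows "(\<lambda>x. proj_perp (f x) (g x)) \<in> borel_measurable M"
  unfolding proj_perp_def by measurable

lemma r3_inner: "r3 u \<bullet> r3 v = Re (u $ 1) * Re (v $ 1) + Re (u $ 2) * Re (v $ 2) + Im (u $ 2) * Im (v $ 2)"
  by (simp add: r3_def inner_vec_def sum_3)

lemma measurable_pick:
  assumes sc: "\<And>k. k < N \<Longrightarrow> sc k \<in> borel_measurable M"
  shows "(\<lambda>x. pick N (\<lambda>k. sc k x)) \<in> measurable M (count_space UNIV)"
  unfolding pick_def
proof (rule measurable_Least)
  fix k
  show "(\<lambda>x. k < N \<and> (\<forall>k'<N. sc k' x \<le> sc k x)) \<in> measurable M (count_space UNIV)"
  proof (cases "k < N")
    case True
    have "{x \<in> space M. \<forall>k'\<in>{..<N}. sc k' x \<le> sc k x} \<in> sets M"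
    proof (rule sets.sets_Collect_finite_All)
      fix k' assume "k' \<in> {..<N}"
      then have [measurable]: "sc k' \<in> borel_measurable M" "sc k \<in> borel_measurable M"
        using sc True by auto
      show "{x \<in> space M. sc k' x \<le> sc k x} \<in> sets M" by measurable
    qed simp
    moreover have "(\<lambda>x. k < N \<and> (\<forall>k'<N. sc k' x \<le> sc k x)) = (\<lambda>x. \<forall>k'\<in>{..<N}. sc k' x \<le> sc k x)"
      using True by auto
    ultimately show ?thesis by (simp only: Measurable.pred_def)
  qed simp
qed

text \<open>The selected index takes finitely many values, so the space splits into finitely many
  measurable pieces on each of which a fixed index is used.\<close>

lemma measurable_at_pick:
  assumes N: "0 < N" and sc: "\<And>k. k < N \<Longrightarrow> sc k \<in> borel_measurable M"
    and f: "\<And>k. k < N \<Longrightarrow> f k \<in> measurable M L"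
  shows "(\<lambda>x. f (pick N (\<lambda>k. sc k x)) x) \<in> measurable M L"
proof (rule measurable_compose_countable'[where I = "{..<N}"])
  show "(\<lambda>x. pick N (\<lambda>k. sc k x)) \<in> measurable M (count_space {..<N})"
  proof (subst measurable_count_space_eq2, safe)
    fix k assume "k < N"
    show "(\<lambda>x. pick N (\<lambda>k. sc k x)) -` {k} \<inter> space M \<in> sets M"
      by (rule measurable_sets[OF measurable_pick[OF sc]]) auto
  qed (auto intro: pick(1)[OF N])
qed (use f in auto)

lemma measurable_quantize:
  assumes N: "0 < N" and [measurable]: "h \<in> borel_measurable M"
    and G: "\<And>k. k < N \<Longrightarrow> (\<lambda>x. G x k) \<in> borel_measurable M"
  shows "(\<lambda>x. quantize N (G x) (h x)) \<in> borel_measurable M"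
proof -
  have "(\<lambda>x. codeword (G x (pick N (\<lambda>k. \<bar>r3 (codeword (G x k)) \<bullet> r3 (phase_norm (h x))\<bar>)))) \<in> borel_measurable M"
  proof (rule measurable_at_pick[OF N, where f = "\<lambda>k x. codeword (G x k)"
        and sc = "\<lambda>k x. \<bar>r3 (codeword (G x k)) \<bullet> r3 (phase_norm (h x))\<bar>"])
    fix k assume "k < N"
    then have [measurable]: "(\<lambda>x. G x k) \<in> borel_measurable M" by (rule G)
    show "(\<lambda>x. \<bar>r3 (codeword (G x k)) \<bullet> r3 (phase_norm (h x))\<bar>) \<in> borel_measurable M"
      unfolding r3_inner by measurable
    show "(\<lambda>x. codeword (G x k)) \<in> borel_measurable M" by measurable
  qed
  then show ?thesis by (simp add: quantize_def pick_def)
qed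

lemma borel_measurable_similarity [measurable (raw)]:
  assumes [measurable]: "f \<in> borel_measurable M"
  shows "(\<lambda>x. similarity (f x) \<zeta>) \<in> borel_measurable M"
  unfolding similarity_def hyp_def by measurable

lemma measurable_sel:
  assumes N: "0 < N" and G: "\<And>k. k < N \<Longrightarrow> (\<lambda>x. G x k) \<in> borel_measurable M"
  shows "(\<lambda>x. sel N \<zeta> (G x)) \<in> borel_measurable M"
  unfolding sel_def
proof (rule measurable_at_pick[OF N, where f = "\<lambda>k x. ratio (G x k)"
      and sc = "\<lambda>k x. similarity (ratio (G x k)) \<zeta>"])
  fix k assume "k < N"
  then have [measurable]: "(\<lambda>x. G x k) \<in> borel_measurable M" by (rule G)
  show "(\<lambda>x. similarity (ratio (G x k)) \<zeta>) \<in> borel_measurable M" by measurable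
  show "(\<lambda>x. ratio (G x k)) \<in> borel_measurable M" by measurable
qed

section \<open>Probabilities over one codebook, and conditioning on the other codebooks\<close>

lemma prob_space_codebook_meas: "prob_space (codebook_meas b)"
  unfolding codebook_meas_def by (intro prob_space_PiM prob_space_cgauss_vec)

lemma measurable_codebook_component:
  assumes "k < 2 ^ b"
  shows "(\<lambda>G. G k) \<in> borel_measurable (codebook_meas b)"
proof -
  have "(\<lambda>G. G k) \<in> measurable (codebook_meas b) cgauss_vec"
    unfolding codebook_meas_def by (rule measurable_component_singleton) (use assms in simp)
  also have "measurable (codebook_meas b) cgauss_vec = borel_measurable (codebook_meas b)"
    by (rule measurable_cong_sets) simp_all
  finally show ?thesis .
qed

lemma measurable_sel_codebook [measurable]:
  "sel (2 ^ b) \<zeta> \<in> borel_measurable (codebook_meas b)"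
proof -
  have "(\<lambda>G. sel (2 ^ b) \<zeta> G) \<in> borel_measurable (codebook_meas b)"
  proof (rule measurable_sel[where G = "\<lambda>G. G" and N = "2 ^ b" and M = "codebook_meas b"])
    show "(\<lambda>G. G k) \<in> borel_measurable (codebook_meas b)" if "k < 2 ^ b" for k
      using that by (rule measurable_codebook_component)
  qed (rule zero_less_power, rule pos2)
  then show ?thesis .
qed

text \<open>The winner is some codeword, so a winner in \<open>A\<close> forces at least one of the
  2 ^ b identically distributed slopes into \<open>A\<close>.\<close>

lemma emeasure_sel_le:
  assumes [measurable]: "A \<in> sets borel"
  shows "emeasure (codebook_meas b) {G \<in> space (codebook_meas b). sel (2 ^ b) \<zeta> G \<in> A}
    \<le> ennreal (2 ^ b) * emeasure cgauss_vec {g. ratio g \<in> A}"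
proof -
  interpret product_prob_space "\<lambda>_ :: nat. cgauss_vec" "{..<2 ^ b}"
    by (intro product_prob_spaceI prob_space_cgauss_vec)
  let ?S = "space (codebook_meas b)"
  have [measurable]: "{g. ratio g \<in> A} \<in> sets borel" by measurable
  have m: "{G \<in> ?S. ratio (G k) \<in> A} \<in> sets (codebook_meas b)" if "k < 2 ^ b" for k
  proof -
    have [measurable]: "(\<lambda>G. G k) \<in> borel_measurable (codebook_meas b)"
      using that by (rule measurable_codebook_component)
    show ?thesis by measurable
  qed
  have "{G \<in> ?S. sel (2 ^ b) \<zeta> G \<in> A} \<subseteq> (\<Union>k<2 ^ b. {G \<in> ?S. ratio (G k) \<in> A})"
  proof
    fix G assume "G \<in> {G \<in> ?S. sel (2 ^ b) \<zeta> G \<in> A}"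
    then show "G \<in> (\<Union>k<2 ^ b. {G \<in> ?S. ratio (G k) \<in> A})"
      using sel_in[of "2 ^ b" \<zeta> G] by auto
  qed
  then have "emeasure (codebook_meas b) {G \<in> ?S. sel (2 ^ b) \<zeta> G \<in> A}
      \<le> emeasure (codebook_meas b) (\<Union>k<2 ^ b. {G \<in> ?S. ratio (G k) \<in> A})"
    using m by (intro emeasure_mono) auto
  also have "\<dots> \<le> (\<Sum>k<2 ^ b. emeasure (codebook_meas b) {G \<in> ?S. ratio (G k) \<in> A})"
    using m by (intro emeasure_subadditive_finite) auto
  also have "\<dots> = (\<Sum>k<(2::nat) ^ b. emeasure cgauss_vec {g. ratio g \<in> A})"
  proof (intro sum.cong refl)
    fix k :: nat assume "k \<in> {..<2 ^ b}"
    then show "emeasure (codebook_meas b) {G \<in> ?S. ratio (G k) \<in> A} = emeasure cgauss_vec {g. ratio g \<in> A}"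
      using emeasure_PiM_Collect_single[of k "{g. ratio g \<in> A}"] by (simp add: codebook_meas_def)
  qed
  also have "\<dots> = ennreal (2 ^ b) * emeasure cgauss_vec {g. ratio g \<in> A}"
    by (simp add: ennreal_power[symmetric])
  finally show ?thesis .
qed

text \<open>By \<open>sel_close\<close>, a distant winner means that all codewords missed the disc
  of radius \<rho>. With hitting probability p \<ge> c \<rho>^2 this has probability (1 - p)^N \<le>
  exp (- p N).\<close>

lemma measure_sel_far_le:
  "\<exists>c>0. \<forall>b \<rho>. 0 \<le> \<rho> \<longrightarrow> \<rho> \<le> 1 \<longrightarrow> 4 * (1 + (cmod \<zeta>)\<^sup>2) * \<rho>\<^sup>2 \<le> 1 \<longrightarrow>
     measure (codebook_meas b) {G \<in> space (codebook_meas b). 2 * (1 + (cmod \<zeta>)\<^sup>2) * \<rho> < cmod (sel (2 ^ b) \<zeta> G - \<zeta>)}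
       \<le> exp (- c * \<rho>\<^sup>2 * 2 ^ b)"
proof -
  obtain c where c: "c > 0" "\<And>r. r \<in> {0..1} \<Longrightarrow> c * r\<^sup>2 \<le> measure cgauss_vec {g. cmod (ratio g - \<zeta>) \<le> r}"
    using measure_cgauss_ratio_cball_ge[of \<zeta>] by blast
  show ?thesis
  proof (intro exI[of _ c] conjI allI impI)
    fix b :: nat and \<rho> :: real
    assume \<rho>: "0 \<le> \<rho>" "\<rho> \<le> 1" "4 * (1 + (cmod \<zeta>)\<^sup>2) * \<rho>\<^sup>2 \<le> 1"
    interpret g: prob_space cgauss_vec by (rule prob_space_cgauss_vec)
    interpret C: prob_space "codebook_meas b" by (rule prob_space_codebook_meas)
    interpret G: product_prob_space "\<lambda>_ :: nat. cgauss_vec" "{..<2 ^ b}"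
      by (intro product_prob_spaceI prob_space_cgauss_vec)
    define p where "p = measure cgauss_vec {g. cmod (ratio g - \<zeta>) \<le> \<rho>}"
    let ?S = "space (codebook_meas b)" and ?F = "{g. \<rho> < cmod (ratio g - \<zeta>)}"
    have p: "c * \<rho>\<^sup>2 \<le> p" "p \<le> 1" using c(2)[of \<rho>] \<rho> by (auto simp: p_def)
    have F: "measure cgauss_vec ?F = 1 - p"
    proof -
      have "?F = space cgauss_vec - {g. cmod (ratio g - \<zeta>) \<le> \<rho>}" by auto
      then show ?thesis unfolding p_def by (simp only:) (rule g.prob_compl, measurable)
    qed
    have ms: "{G \<in> ?S. \<forall>k\<in>{..<2 ^ b}. G k \<in> ?F} \<in> sets (codebook_meas b)"
    proof (rule sets.sets_Collect_finite_All)
      fix k :: nat assume "k \<in> {..<2 ^ b}"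
      then have [measurable]: "(\<lambda>G. G k) \<in> borel_measurable (codebook_meas b)"
        using measurable_codebook_component by auto
      show "{G \<in> ?S. G k \<in> ?F} \<in> sets (codebook_meas b)" by measurable
    qed simp
    have "measure (codebook_meas b) {G \<in> ?S. 2 * (1 + (cmod \<zeta>)\<^sup>2) * \<rho> < cmod (sel (2 ^ b) \<zeta> G - \<zeta>)}
       \<le> measure (codebook_meas b) {G \<in> ?S. \<forall>k\<in>{..<2 ^ b}. G k \<in> ?F}"
    proof (intro C.finite_measure_mono[OF _ ms] subsetI CollectI conjI ballI)
      fix G k assume G: "G \<in> {G \<in> ?S. 2 * (1 + (cmod \<zeta>)\<^sup>2) * \<rho> < cmod (sel (2 ^ b) \<zeta> G - \<zeta>)}"
      then show "G \<in> ?S" by simp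
      assume "k \<in> {..<(2::nat) ^ b}"
      then show "\<rho> < cmod (ratio (G k) - \<zeta>)"
        using sel_close[of k "2 ^ b" G \<zeta> \<rho>] \<rho> G by fastforce
    qed
    also have "\<dots> = (1 - p) ^ (2 ^ b)"
    proof -
      have "emeasure (codebook_meas b) {G \<in> ?S. \<forall>k\<in>{..<2 ^ b}. G k \<in> ?F} = (\<Prod>k\<in>{..<(2::nat) ^ b}. emeasure cgauss_vec ?F)"
        unfolding codebook_meas_def by (rule G.emeasure_PiM_Collect) auto
      also have "\<dots> = ennreal ((1 - p) ^ (2 ^ b))"
        using p(2) by (simp add: g.emeasure_eq_measure F ennreal_power)
      finally show ?thesis using p(2) by (simp add: C.emeasure_eq_measure)
    qed
    also have "\<dots> \<le> exp (- p) ^ (2 ^ b)"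
      using p(2) exp_ge_add_one_self[of "- p"] by (intro power_mono) auto
    also have "\<dots> = exp (- (p * 2 ^ b))"
      by (simp add: exp_of_nat_mult[symmetric] mult.commute)
    also have "\<dots> \<le> exp (- c * \<rho>\<^sup>2 * 2 ^ b)"
      using p(1) by (simp add: mult_right_mono)
    finally show "measure (codebook_meas b) {G \<in> ?S. 2 * (1 + (cmod \<zeta>)\<^sup>2) * \<rho> < cmod (sel (2 ^ b) \<zeta> G - \<zeta>)}
       \<le> exp (- c * \<rho>\<^sup>2 * 2 ^ b)" .
  qed (use c in simp)
qed

lemma emeasure_PiM_le_sections:
  fixes M :: "'i::finite \<Rightarrow> 'a measure"
  assumes prob: "\<And>i. prob_space (M i)"
    and E: "E \<in> sets (PiM UNIV M)"
    and le: "\<And>w. (\<And>x. x \<in> space (M k) \<Longrightarrow> w(k := x) \<in> space (PiM UNIV M)) \<Longrightarrow> emeasure (M k) {x \<in> space (M k). w(k := x) \<in> E} \<le> c"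
  shows "emeasure (PiM UNIV M) E \<le> c"
proof -
  interpret product_prob_space M UNIV by (intro product_prob_spaceI prob)
  interpret R: prob_space "PiM (UNIV - {k}) M" by (intro prob_space_PiM prob)
  have U: "UNIV = insert k (UNIV - {k})" by auto
  have "emeasure (PiM UNIV M) E = (\<integral>\<^sup>+w. indicator E w \<partial>PiM UNIV M)"
    using E by simp
  also have "\<dots> = (\<integral>\<^sup>+w. indicator E w \<partial>PiM (insert k (UNIV - {k})) M)"
    using U by simp
  also have "\<dots> = (\<integral>\<^sup>+w. (\<integral>\<^sup>+x. indicator E (w(k := x)) \<partial>M k) \<partial>PiM (UNIV - {k}) M)"
    using E U by (intro product_nn_integral_insert) auto
  also have "\<dots> \<le> (\<integral>\<^sup>+w. c \<partial>PiM (UNIV - {k}) M)"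
  proof (rule nn_integral_mono)
    fix w assume w: "w \<in> space (PiM (UNIV - {k}) M)"
    then have sp: "w(k := x) \<in> space (PiM UNIV M)" if "x \<in> space (M k)" for x
      using that by (auto simp: space_PiM PiE_iff extensional_def)
    have ms: "{x \<in> space (M k). w(k := x) \<in> E} \<in> sets (M k)"
    proof -
      have "(\<lambda>x. w(k := x)) \<in> measurable (M k) (PiM UNIV M)"
        by (rule measurable_fun_upd[where J = "UNIV - {k}"]) (use w in auto)
      from measurable_sets[OF this E] show ?thesis
        by (simp add: vimage_def Int_def conj_commute)
    qed
    have "(\<integral>\<^sup>+x. indicator E (w(k := x)) \<partial>M k) = (\<integral>\<^sup>+x. indicator {x \<in> space (M k). w(k := x) \<in> E} x \<partial>M k)"
      by (intro nn_integral_cong) (auto simp: indicator_def)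
    also have "\<dots> \<le> c" using ms le[OF sp] by simp
    finally show "(\<integral>\<^sup>+x. indicator E (w(k := x)) \<partial>M k) \<le> c" .
  qed
  also have "\<dots> = c" by (simp add: R.emeasure_space_1)
  finally show ?thesis .
qed

section \<open>Events of high probability for a fixed channel\<close>

lemma borel_measurable_amp [measurable (raw)]:
  assumes [measurable]: "f1 \<in> borel_measurable M" "f2 \<in> borel_measurable M"
    "g1 \<in> borel_measurable M" "g2 \<in> borel_measurable M"
  shows "(\<lambda>x. amp \<zeta> (f1 x) (f2 x) (g1 x) (g2 x)) \<in> borel_measurable M"
  unfolding amp_def hyp_def by measurable

definition code_meas :: "(2 \<Rightarrow> 2 \<Rightarrow> real \<Rightarrow> nat) \<Rightarrow> real \<Rightarrow> (2 \<times> 2 \<Rightarrow> nat \<Rightarrow> cvec) measure" where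
  "code_meas B P = PiM UNIV (\<lambda>ij. codebook_meas (B (fst ij) (snd ij) P))"

lemma prob_space_code_meas: "prob_space (code_meas B P)"
  unfolding code_meas_def by (intro prob_space_PiM prob_space_codebook_meas)

lemma measurable_code_component [measurable]:
  "(\<lambda>W. W (l, j)) \<in> measurable (code_meas B P) (codebook_meas (B l j P))"
  unfolding code_meas_def
  using measurable_component_singleton[of "(l, j)" UNIV "\<lambda>ij. codebook_meas (B (fst ij) (snd ij) P)"]
  by simp

text \<open>The true slopes \<zeta> are a parameter: the channel is held fixed and randomness comes
  from the codebooks alone.\<close>

definition slope :: "(2 \<Rightarrow> 2 \<Rightarrow> real \<Rightarrow> nat) \<Rightarrow> (2 \<Rightarrow> complex) \<Rightarrow> real \<Rightarrow> (2 \<times> 2 \<Rightarrow> nat \<Rightarrow> cvec) \<Rightarrow> 2 \<Rightarrow> 2 \<Rightarrow> complex" where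
  "slope B \<zeta> P W l j = sel (2 ^ B l j P) (\<zeta> l) (W (l, j))"

lemma measurable_slope [measurable]:
  "(\<lambda>W. slope B \<zeta> P W l j) \<in> borel_measurable (code_meas B P)"
  unfolding slope_def by (rule measurable_compose[OF measurable_code_component measurable_sel_codebook])

lemma slope_upd_other: "(l, j) \<noteq> (l', j') \<Longrightarrow> slope B \<zeta> P (W((l, j) := x)) l' j' = slope B \<zeta> P W l' j'"
  by (auto simp: slope_def)

lemma powr_scale_tendsto_0: "s < 0 \<Longrightarrow> ((\<lambda>P. c * P powr s) \<longlongrightarrow> (0::real)) at_top"
  by (rule tendsto_mult_right_zero, rule tendsto_neg_powr) (auto simp: filterlim_ident)

lemma eventually_powr_small: "s < 0 \<Longrightarrow> 0 < d \<Longrightarrow> \<forall>\<^sub>F P in at_top. c * P powr s < (d::real)"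
  using order_tendstoD(2)[OF powr_scale_tendsto_0] by blast

lemma eventually_le_powr: 
  assumes "0 < s"
  shows "\<forall>\<^sub>F P in at_top. c \<le> P powr (s::real)"
proof -
  have "\<forall>\<^sub>F P in at_top. c * P powr (- s) < 1" using assms by (intro eventually_powr_small) auto
  then show ?thesis using eventually_gt_at_top[of 0]
  proof eventually_elim
    case (elim P)
    then show ?case by (simp add: powr_minus field_simps)
  qed
qed

text \<open>The last two conditions hold for almost every channel and are transversality conditions
  for horizontal slices. Along a horizontal line the modulus of z varies at a definite rate only
  away from Re z = 0, and the phase of z - c only if Im z differs from Im c.\<close>

locale fixed_channel =
  fixes B :: "2 \<Rightarrow> 2 \<Rightarrow> real \<Rightarrow> nat" and \<alpha> :: "2 \<Rightarrow> 2 \<Rightarrow> real" and \<zeta> :: "2 \<Rightarrow> complex"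
  assumes \<alpha>_nonneg: "0 \<le> \<alpha> l j"
    and bits_lim: "((\<lambda>P. real (B l j P) / log 2 P) \<longlongrightarrow> \<alpha> l j) at_top"
    and Re_nz: "Re (\<zeta> l) \<noteq> 0"
    and Im_ne: "Im (\<zeta> 1) \<noteq> Im (\<zeta> 2)"
begin

abbreviation "M \<equiv> code_meas B"
abbreviation "Z \<equiv> slope B \<zeta>"

lemma eventually_codebook_size:
  assumes "0 < \<eta>"
  shows "\<forall>\<^sub>F P in at_top. P powr (\<alpha> l j - \<eta>) \<le> 2 ^ B l j P \<and> 2 ^ B l j P \<le> P powr (\<alpha> l j + \<eta>)"
proof -
  have "\<forall>\<^sub>F P in at_top. \<alpha> l j - \<eta> < real (B l j P) / log 2 P" "\<forall>\<^sub>F P in at_top. real (B l j P) / log 2 P < \<alpha> l j + \<eta>"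
    using assms by (auto intro!: order_tendstoD[OF bits_lim])
  then show ?thesis using eventually_gt_at_top[of 1]
  proof eventually_elim
    case (elim P)
    have lg: "0 < log 2 P" using elim(3) by simp
    have pw: "P powr s = 2 powr (s * log 2 P)" for s
      using elim(3) by (simp add: powr_def log_def)
    have b: "(2::real) ^ B l j P = 2 powr real (B l j P)" by (simp add: powr_realpow)
    have "(\<alpha> l j - \<eta>) * log 2 P \<le> real (B l j P)" "real (B l j P) \<le> (\<alpha> l j + \<eta>) * log 2 P"
      using elim lg by (simp_all add: field_simps)
    then show ?case unfolding pw b by simp
  qed
qed

text \<open>The exceptional sets are part of the definition, so that the event itself need not be measurable.\<close>

definition whp :: "(real \<Rightarrow> (2 \<times> 2 \<Rightarrow> nat \<Rightarrow> cvec) \<Rightarrow> bool) \<Rightarrow> bool" where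
  "whp E \<longleftrightarrow> (\<exists>A. (\<forall>P. A P \<in> sets (M P)) \<and> ((\<lambda>P. measure (M P) (A P)) \<longlongrightarrow> 0) at_top
      \<and> (\<forall>\<^sub>F P in at_top. \<forall>W\<in>space (M P) - A P. E P W))"

lemma whp_mp:
  assumes "whp E" and "\<forall>\<^sub>F P in at_top. \<forall>W. E P W \<longrightarrow> F P W"
  shows "whp F"
proof -
  obtain A where A: "\<And>P. A P \<in> sets (M P)" "((\<lambda>P. measure (M P) (A P)) \<longlongrightarrow> 0) at_top"
      "\<forall>\<^sub>F P in at_top. \<forall>W\<in>space (M P) - A P. E P W"
    using assms(1) unfolding whp_def by blast
  from A(3) assms(2) have "\<forall>\<^sub>F P in at_top. \<forall>W\<in>space (M P) - A P. F P W"
    by eventually_elim blast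
  with A(1,2) show ?thesis unfolding whp_def by blast
qed

lemma whp_conj:
  assumes "whp E" "whp F"
  shows "whp (\<lambda>P W. E P W \<and> F P W)"
proof -
  obtain A where A: "\<And>P. A P \<in> sets (M P)" "((\<lambda>P. measure (M P) (A P)) \<longlongrightarrow> 0) at_top"
      "\<forall>\<^sub>F P in at_top. \<forall>W\<in>space (M P) - A P. E P W"
    using assms(1) unfolding whp_def by blast
  obtain A' where A': "\<And>P. A' P \<in> sets (M P)" "((\<lambda>P. measure (M P) (A' P)) \<longlongrightarrow> 0) at_top"
      "\<forall>\<^sub>F P in at_top. \<forall>W\<in>space (M P) - A' P. F P W"
    using assms(2) unfolding whp_def by blast
  show ?thesis
    unfolding whp_def
  proof (intro exI[of _ "\<lambda>P. A P \<union> A' P"] conjI allI)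
    show "A P \<union> A' P \<in> sets (M P)" for P using A(1) A'(1) by auto
    have le: "measure (M P) (A P \<union> A' P) \<le> measure (M P) (A P) + measure (M P) (A' P)" for P
      using A(1) A'(1) prob_space.finite_measure[OF prob_space_code_meas]
      by (intro measure_Un_le) auto
    have s: "((\<lambda>P. measure (M P) (A P) + measure (M P) (A' P)) \<longlongrightarrow> 0) at_top"
      using tendsto_add[OF A(2) A'(2)] by simp
    show "((\<lambda>P. measure (M P) (A P \<union> A' P)) \<longlongrightarrow> 0) at_top"
      by (rule tendsto_sandwich[OF _ _ tendsto_const s]) (auto simp: le)
    show "\<forall>\<^sub>F P in at_top. \<forall>W\<in>space (M P) - (A P \<union> A' P). E P W \<and> F P W"
      using A(3) A'(3) by eventually_elim auto
  qed
qed

lemma whpI: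
  assumes "\<And>P. {W \<in> space (M P). \<not> E P W} \<in> sets (M P)"
    and "\<forall>\<^sub>F P in at_top. measure (M P) {W \<in> space (M P). \<not> E P W} \<le> b P" and "(b \<longlongrightarrow> 0) at_top"
  shows "whp E"
  unfolding whp_def
proof (intro exI[of _ "\<lambda>P. {W \<in> space (M P). \<not> E P W}"] conjI allI)
  show "((\<lambda>P. measure (M P) {W \<in> space (M P). \<not> E P W}) \<longlongrightarrow> 0) at_top"
    by (rule tendsto_sandwich[OF _ assms(2) tendsto_const assms(3)]) auto
qed (use assms(1) in auto)

lemma measure_slope:
  assumes [measurable]: "A \<in> sets borel"
  shows "emeasure (M P) {W \<in> space (M P). Z P W l j \<in> A}
    = emeasure (codebook_meas (B l j P)) {G \<in> space (codebook_meas (B l j P)). sel (2 ^ B l j P) (\<zeta> l) G \<in> A}"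
proof -
  interpret product_prob_space "\<lambda>ij. codebook_meas (B (fst ij) (snd ij) P)" UNIV
    by (intro product_prob_spaceI prob_space_codebook_meas)
  let ?S = "{G \<in> space (codebook_meas (B l j P)). sel (2 ^ B l j P) (\<zeta> l) G \<in> A}"
  have S: "?S \<in> sets (codebook_meas (B l j P))" by measurable
  have "{W \<in> space (M P). Z P W l j \<in> A} = {W \<in> space (M P). W (l, j) \<in> ?S}"
    using measurable_space[OF measurable_code_component, of _ B P l j] by (auto simp: slope_def)
  also have "emeasure (M P) \<dots> = emeasure (codebook_meas (B l j P)) ?S"
    using emeasure_PiM_Collect_single[of "(l, j)" ?S] S by (simp add: code_meas_def)
  finally show ?thesis .
qed

text \<open>For a positive scaling the slope converges, with failure probability at most exp (-
  const * P powr e). For scaling 0 the assertion only says that the slope grows no faster than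
  \<open>P powr \<epsilon>\<close>, and the quadratic tail of a single slope beats the codebook
  size.\<close>

lemma slope_close:
  assumes "0 < \<epsilon>"
  shows "whp (\<lambda>P W. cmod (Z P W l j - \<zeta> l) \<le> P powr (- \<alpha> l j / 2 + \<epsilon>))"
proof (cases "\<alpha> l j = 0")
  case True
  show ?thesis
  proof (rule whpI)
    show "\<forall>\<^sub>F P in at_top. measure (M P) {W \<in> space (M P). \<not> cmod (Z P W l j - \<zeta> l) \<le> P powr (- \<alpha> l j / 2 + \<epsilon>)}
        \<le> 16 * P powr (- \<epsilon>)"
      using eventually_codebook_size[OF assms, of l j] eventually_le_powr[OF assms, of "2 * cmod (\<zeta> l)"] eventually_gt_at_top[of 0]
    proof eventually_elim
      case (elim P)
      interpret prob_space "M P" by (rule prob_space_code_meas)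
      interpret g: prob_space cgauss_vec by (rule prob_space_cgauss_vec)
      \<comment> \<open>Half of the threshold; the other half covers |\<zeta> l| for large
        P.\<close>
      define R where "R = P powr \<epsilon> / 2"
      have R: "0 < R" using elim(3) by (simp add: R_def)
      have "emeasure (M P) {W \<in> space (M P). \<not> cmod (Z P W l j - \<zeta> l) \<le> P powr (- \<alpha> l j / 2 + \<epsilon>)}
         \<le> emeasure (M P) {W \<in> space (M P). Z P W l j \<in> {z. R < cmod z}}"
      proof (intro emeasure_mono subsetI CollectI conjI)
        fix W assume W: "W \<in> {W \<in> space (M P). \<not> cmod (Z P W l j - \<zeta> l) \<le> P powr (- \<alpha> l j / 2 + \<epsilon>)}"
        then show "W \<in> space (M P)" by simp
        show "R < cmod (Z P W l j)"
          using W True elim(2) norm_triangle_ineq4[of "Z P W l j" "\<zeta> l"] by (simp add: R_def)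
      qed measurable
      also have "\<dots> \<le> ennreal (2 ^ B l j P) * emeasure cgauss_vec {g. ratio g \<in> {z. R < cmod z}}"
        by (subst measure_slope, measurable, rule emeasure_sel_le, measurable)
      also have "\<dots> = ennreal (2 ^ B l j P * measure cgauss_vec {g. R < cmod (ratio g)})"
        by (simp add: g.emeasure_eq_measure ennreal_mult)
      finally have "measure (M P) {W \<in> space (M P). \<not> cmod (Z P W l j - \<zeta> l) \<le> P powr (- \<alpha> l j / 2 + \<epsilon>)}
         \<le> 2 ^ B l j P * measure cgauss_vec {g. R < cmod (ratio g)}"
        by (simp add: emeasure_eq_measure)
      also have "\<dots> \<le> P powr \<epsilon> * (4 / R\<^sup>2)"
        using elim(1) True measure_cgauss_ratio_gt_le[OF R] by (intro mult_mono) auto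
      also have "\<dots> = 16 * P powr (- \<epsilon>)"
        using elim(3) by (simp add: R_def power2_eq_square powr_minus field_simps)
      finally show ?case .
    qed
    show "((\<lambda>P. 16 * P powr (- \<epsilon>)) \<longlongrightarrow> 0) at_top"
      using assms by (intro powr_scale_tendsto_0) simp
  qed measurable
next
  case False
  then have \<alpha>: "0 < \<alpha> l j" using \<alpha>_nonneg[of l j] by simp
  \<comment> \<open>Capping at a quarter of the scaling keeps the exponent - \<alpha> / 2 + e
    negative, so that \<rho> tends to 0 and meets the smallness condition of
    \<open>far\<close>.\<close>
  define e where "e = min \<epsilon> (\<alpha> l j / 4)"
  have e: "0 < e" "e \<le> \<epsilon>" "e \<le> \<alpha> l j / 4" using assms \<alpha> by (auto simp: e_def)
  define K where "K = 1 + (cmod (\<zeta> l))\<^sup>2"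
  have K: "1 \<le> K" by (simp add: K_def)
  obtain c where c: "c > 0" and far: "\<And>b \<rho>. 0 \<le> \<rho> \<Longrightarrow> \<rho> \<le> 1 \<Longrightarrow> 4 * K * \<rho>\<^sup>2 \<le> 1 \<Longrightarrow>
     measure (codebook_meas b) {G \<in> space (codebook_meas b). 2 * K * \<rho> < cmod (sel (2 ^ b) (\<zeta> l) G - \<zeta> l)}
       \<le> exp (- c * \<rho>\<^sup>2 * 2 ^ b)"
    using measure_sel_far_le[of "\<zeta> l"] unfolding K_def by blast
  have neg: "- \<alpha> l j / 2 + e < 0" using e \<alpha> by simp
  show ?thesis
  proof (rule whpI)
    show "\<forall>\<^sub>F P in at_top. measure (M P) {W \<in> space (M P). \<not> cmod (Z P W l j - \<zeta> l) \<le> P powr (- \<alpha> l j / 2 + \<epsilon>)}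
        \<le> exp (- (c / (4 * K\<^sup>2) * P powr e))"
      using eventually_codebook_size[OF e(1), of l j] eventually_powr_small[OF neg zero_less_one, of 1] eventually_gt_at_top[of 1]
    proof eventually_elim
      case (elim P)
      interpret prob_space "M P" by (rule prob_space_code_meas)
      interpret C: prob_space "codebook_meas (B l j P)" by (rule prob_space_codebook_meas)
      \<comment> \<open>The codeword radius for which the winner's radius 2 K \<rho> is exactly the
        target.\<close>
      define \<rho> where "\<rho> = P powr (- \<alpha> l j / 2 + e) / (2 * K)"
      have K\<rho>: "2 * K * \<rho> = P powr (- \<alpha> l j / 2 + e)" using K by (simp add: \<rho>_def)
      have \<rho>0: "0 \<le> \<rho>" using K by (simp add: \<rho>_def)
      have "2 * K * \<rho> \<le> 1" using elim(2) by (simp add: K\<rho>)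
      moreover have "1 * \<rho> \<le> (2 * K) * \<rho>" using K \<rho>0 by (intro mult_right_mono) auto
      ultimately have \<rho>1: "\<rho> \<le> 1" by linarith
      have sq: "(2 * K * \<rho>)\<^sup>2 \<le> 1"
        using \<open>2 * K * \<rho> \<le> 1\<close> K \<rho>0 by (intro power_le_one) auto
      have "4 * K * \<rho>\<^sup>2 \<le> 4 * (K * K) * \<rho>\<^sup>2"
        using K by (intro mult_right_mono mult_left_mono) (auto simp: mult_le_cancel_left1)
      also have "\<dots> = (2 * K * \<rho>)\<^sup>2" by (simp add: power2_eq_square)
      finally have \<rho>2: "4 * K * \<rho>\<^sup>2 \<le> 1" using sq by linarith
      have mono: "P powr (- \<alpha> l j / 2 + e) \<le> P powr (- \<alpha> l j / 2 + \<epsilon>)"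
        using elim(3) e by (intro powr_mono) auto
      have "emeasure (M P) {W \<in> space (M P). \<not> cmod (Z P W l j - \<zeta> l) \<le> P powr (- \<alpha> l j / 2 + \<epsilon>)}
         \<le> emeasure (M P) {W \<in> space (M P). Z P W l j \<in> {z. 2 * K * \<rho> < cmod (z - \<zeta> l)}}"
        using mono by (intro emeasure_mono) (auto simp: K\<rho>)
      also have "\<dots> = ennreal (measure (codebook_meas (B l j P)) {G \<in> space (codebook_meas (B l j P)). 2 * K * \<rho> < cmod (sel (2 ^ B l j P) (\<zeta> l) G - \<zeta> l)})"
        by (subst measure_slope) (simp_all add: C.emeasure_eq_measure)
      finally have "measure (M P) {W \<in> space (M P). \<not> cmod (Z P W l j - \<zeta> l) \<le> P powr (- \<alpha> l j / 2 + \<epsilon>)}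
         \<le> measure (codebook_meas (B l j P)) {G \<in> space (codebook_meas (B l j P)). 2 * K * \<rho> < cmod (sel (2 ^ B l j P) (\<zeta> l) G - \<zeta> l)}"
        by (simp add: emeasure_eq_measure)
      also have "\<dots> \<le> exp (- c * \<rho>\<^sup>2 * 2 ^ B l j P)"
        by (rule far) (use \<rho>0 \<rho>1 \<rho>2 in auto)
      also have "\<dots> \<le> exp (- (c / (4 * K\<^sup>2) * P powr e))"
      proof -
        have "P powr e = (P powr (- \<alpha> l j / 2 + e))\<^sup>2 * P powr (\<alpha> l j - e)"
          using elim(3) by (simp add: power2_eq_square powr_add[symmetric])
        also have "\<dots> \<le> (P powr (- \<alpha> l j / 2 + e))\<^sup>2 * 2 ^ B l j P"
          using elim(1) by (intro mult_left_mono) auto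
        finally have "c / (4 * K\<^sup>2) * P powr e \<le> c / (4 * K\<^sup>2) * ((P powr (- \<alpha> l j / 2 + e))\<^sup>2 * 2 ^ B l j P)"
          using c by (intro mult_left_mono) auto
        also have "\<dots> = c * \<rho>\<^sup>2 * 2 ^ B l j P"
          by (simp add: \<rho>_def power_divide power_mult_distrib)
        finally show ?thesis by simp
      qed
      finally show ?case .
    qed
    have "filterlim (\<lambda>P. c / (4 * K\<^sup>2) * P powr e) at_top at_top"
    proof (rule filterlim_tendsto_pos_mult_at_top[OF tendsto_const])
      show "0 < c / (4 * K\<^sup>2)" using c K by simp
      show "filterlim (\<lambda>P. P powr e) at_top at_top"
        using e(1) by (intro real_powr_at_top)
    qed
    then show "((\<lambda>P. exp (- (c / (4 * K\<^sup>2) * P powr e))) \<longlongrightarrow> 0) at_top"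
      by (intro filterlim_compose[OF exp_at_bot]) (simp add: filterlim_uminus_at_bot)
  qed measurable
qed

text \<open>Union bound over the codebook, conditionally on the other codebooks: \<open>Q\<close> must not look at
  the codebook \<open>(l, j)\<close>.\<close>

lemma whp_avoid:
  assumes \<epsilon>: "0 < \<epsilon>" and \<gamma>: "0 < \<gamma>"
    and meas: "\<And>P. {W \<in> space (M P). Q P W (Z P W l j)} \<in> sets (M P)"
    and indep: "\<And>P W x z. Q P (W((l, j) := x)) z = Q P W z"
    and measQ: "\<And>P W. {z. Q P W z} \<in> sets borel"
    and small: "\<forall>\<^sub>F P in at_top. \<forall>W. emeasure lborel {z. Q P W z \<and> cmod (z - \<zeta> l) \<le> P powr (- \<alpha> l j / 2 + \<epsilon>)}
       \<le> ennreal (C * P powr (- \<alpha> l j - \<gamma>))"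
  shows "whp (\<lambda>P W. \<not> Q P W (Z P W l j))"
proof -
  \<comment> \<open>The disc makes the area small enough for the union bound;
    \<open>slope_close\<close> removes this extra condition at the end.\<close>
  define Q' where "Q' P W z \<longleftrightarrow> Q P W z \<and> cmod (z - \<zeta> l) \<le> P powr (- \<alpha> l j / 2 + \<epsilon>)" for P W z
  have "whp (\<lambda>P W. \<not> Q' P W (Z P W l j))"
  proof (rule whpI)
    have ms: "{W \<in> space (M P). Q' P W (Z P W l j)} \<in> sets (M P)" for P
      unfolding Q'_def by (rule sets.sets_Collect_conj[OF _ meas]) measurable
    then show "{W \<in> space (M P). \<not> \<not> Q' P W (Z P W l j)} \<in> sets (M P)" for P by simp
    \<comment> \<open>Half of \<gamma> pays for the inexact codebook size N \<le> P powr (\<alpha> +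
      \<gamma> / 2); the other half remains as decay.\<close>
    have \<gamma>2: "0 < \<gamma> / 2" using \<gamma> by simp
    show "\<forall>\<^sub>F P in at_top. measure (M P) {W \<in> space (M P). \<not> \<not> Q' P W (Z P W l j)} \<le> max 0 C * P powr (- \<gamma> / 2)"
      using small eventually_codebook_size[OF \<gamma>2, of l j] eventually_gt_at_top[of 0]
    proof eventually_elim
      case (elim P)
      interpret prob_space "M P" by (rule prob_space_code_meas)
      have "emeasure (M P) {W \<in> space (M P). Q' P W (Z P W l j)}
         \<le> ennreal (2 ^ B l j P) * ennreal (C * P powr (- \<alpha> l j - \<gamma>))"
        using ms[of P] unfolding code_meas_def
      proof (rule emeasure_PiM_le_sections[where k = "(l, j)", OF prob_space_codebook_meas], fold code_meas_def)
        fix w assume sp: "\<And>x. x \<in> space (codebook_meas (B (fst (l, j)) (snd (l, j)) P)) \<Longrightarrow> w((l, j) := x) \<in> space (M P)"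
        let ?A = "{z. Q' P w z}"
        have A: "?A \<in> sets borel"
        proof -
          have "{z. cmod (z - \<zeta> l) \<le> P powr (- \<alpha> l j / 2 + \<epsilon>)} \<in> sets borel" by measurable
          with measQ[of P w] have "{z. Q P w z} \<inter> {z. cmod (z - \<zeta> l) \<le> P powr (- \<alpha> l j / 2 + \<epsilon>)} \<in> sets borel" by auto
          then show ?thesis unfolding Q'_def Collect_conj_eq .
        qed
        have "{x \<in> space (codebook_meas (B l j P)). w((l, j) := x) \<in> {W \<in> space (M P). Q' P W (Z P W l j)}}
          = {x \<in> space (codebook_meas (B l j P)). sel (2 ^ B l j P) (\<zeta> l) x \<in> ?A}"
          using sp by (auto simp: Q'_def indep slope_def)
        also have "emeasure (codebook_meas (B l j P)) \<dots> \<le> ennreal (2 ^ B l j P) * emeasure cgauss_vec {g. ratio g \<in> ?A}"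
          by (rule emeasure_sel_le[OF A])
        also have "\<dots> \<le> ennreal (2 ^ B l j P) * ennreal (C * P powr (- \<alpha> l j - \<gamma>))"
          using emeasure_cgauss_ratio_le[OF A] elim(1) unfolding Q'_def
          by (intro mult_left_mono) (auto intro: order_trans)
        finally show "emeasure (codebook_meas (B (fst (l, j)) (snd (l, j)) P))
            {x \<in> space (codebook_meas (B (fst (l, j)) (snd (l, j)) P)). w((l, j) := x) \<in> {W \<in> space (M P). Q' P W (Z P W l j)}}
          \<le> ennreal (2 ^ B l j P) * ennreal (C * P powr (- \<alpha> l j - \<gamma>))" by simp
      qed
      also have "\<dots> \<le> ennreal (P powr (\<alpha> l j + \<gamma> / 2)) * ennreal (max 0 C * P powr (- \<alpha> l j - \<gamma>))"
        using elim(2) by (intro mult_mono ennreal_leI mult_right_mono) auto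
      also have "\<dots> = ennreal (max 0 C * P powr (- \<gamma> / 2))"
      proof -
        have "P powr (\<alpha> l j + \<gamma> / 2) * P powr (- \<alpha> l j - \<gamma>) = P powr (- \<gamma> / 2)"
          by (simp add: powr_add[symmetric])
        then show ?thesis by (simp add: ennreal_mult[symmetric] mult.left_commute)
      qed
      finally show ?case by (simp add: emeasure_eq_measure)
    qed
    show "((\<lambda>P. max 0 C * P powr (- \<gamma> / 2)) \<longlongrightarrow> 0) at_top"
      using \<gamma> by (intro powr_scale_tendsto_0) simp
  qed
  from whp_conj[OF this slope_close[OF \<epsilon>, of l j]] show ?thesis
    by (rule whp_mp) (intro always_eventually allI impI, auto simp: Q'_def)
qed

end

section \<open>Sensitivity of the beam gains\<close>

text \<open>At equal height, the difference of the squared moduli is (Re z - Re z') (Re z + Re z').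
  The common sign \<open>s\<close> prevents the second factor from cancelling, so it is at least 2
  \<kappa>.\<close>

lemma same_slice_modulus_diff:
  assumes \<tau>: "\<bar>1 / (hyp z)\<^sup>2 - 1 / (hyp z')\<^sup>2\<bar> \<le> \<tau>" and R: "cmod z \<le> R" "cmod z' \<le> R"
    and Im: "Im z = Im z'" and \<kappa>: "0 < \<kappa>" and s: "s = 1 \<or> s = -1" "\<kappa> \<le> s * Re z" "\<kappa> \<le> s * Re z'"
  shows "\<bar>Re z - Re z'\<bar> \<le> \<tau> * (1 + R\<^sup>2)\<^sup>2 / (2 * \<kappa>)"
proof -
  have h: "0 < (hyp z)\<^sup>2" "0 < (hyp z')\<^sup>2" by auto
  have hR: "(hyp z)\<^sup>2 \<le> 1 + R\<^sup>2" "(hyp z')\<^sup>2 \<le> 1 + R\<^sup>2"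
    unfolding hyp_square using R by (auto intro: power_mono)
  have \<tau>0: "0 \<le> \<tau>" using \<tau> by linarith
  have "(Re z - Re z') * (Re z + Re z') = (hyp z)\<^sup>2 - (hyp z')\<^sup>2"
    unfolding hyp_square cmod_power2 Im by (simp add: power2_eq_square algebra_simps)
  also have "\<dots> = (1 / (hyp z')\<^sup>2 - 1 / (hyp z)\<^sup>2) * ((hyp z)\<^sup>2 * (hyp z')\<^sup>2)"
    using h by (simp add: field_simps)
  finally have "\<bar>Re z - Re z'\<bar> * \<bar>Re z + Re z'\<bar> = \<bar>1 / (hyp z)\<^sup>2 - 1 / (hyp z')\<^sup>2\<bar> * ((hyp z)\<^sup>2 * (hyp z')\<^sup>2)"
    by (metis abs_minus_commute abs_mult abs_of_nonneg h less_imp_le mult_pos_pos)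
  also have "\<dots> \<le> \<tau> * ((1 + R\<^sup>2) * (1 + R\<^sup>2))"
    using \<tau> hR h \<tau>0 by (intro mult_mono) auto
  finally have 1: "\<bar>Re z - Re z'\<bar> * \<bar>Re z + Re z'\<bar> \<le> \<tau> * (1 + R\<^sup>2)\<^sup>2"
    by (simp add: power2_eq_square)
  have "2 * \<kappa> \<le> \<bar>Re z + Re z'\<bar>" using s by auto
  then have "\<bar>Re z - Re z'\<bar> * (2 * \<kappa>) \<le> \<bar>Re z - Re z'\<bar> * \<bar>Re z + Re z'\<bar>"
    by (intro mult_left_mono) auto
  with 1 show ?thesis using \<kappa> by (simp add: pos_le_divide_eq)
qed

text \<open>The left side is twice the area of the triangle 0, u, u' with its horizontal side as
  base. The same area is |u| |u'| times the sine of the angle at 0, and the sine is at most the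
  chord.\<close>

lemma sgn_diff_same_slice:
  fixes u u' :: complex
  assumes "Im u = Im u'"
  shows "\<bar>Re u - Re u'\<bar> * \<bar>Im u\<bar> \<le> cmod u * cmod u' * cmod (sgn u - sgn u')"
proof -
  have "(Re u' - Re u) * Im u = Im (cnj u' * u)"
    using assms by (simp add: algebra_simps)
  also have "cnj u' * u = of_real (cmod u * cmod u') * (cnj (sgn u') * sgn u)"
    by (cases "u = 0 \<or> u' = 0") (auto simp: sgn_div_norm scaleR_conv_of_real field_simps)
  also have "Im \<dots> = cmod u * cmod u' * Im (cnj (sgn u') * sgn u)" by simp
  also have "Im (cnj (sgn u') * sgn u) = Im (cnj (sgn u') * (sgn u - sgn u'))"
    by (simp add: algebra_simps)
  finally have "\<bar>Re u - Re u'\<bar> * \<bar>Im u\<bar> = cmod u * cmod u' * \<bar>Im (cnj (sgn u') * (sgn u - sgn u'))\<bar>"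
    by (metis abs_minus_commute abs_mult abs_norm_cancel)
  also have "\<bar>Im (cnj (sgn u') * (sgn u - sgn u'))\<bar> \<le> cmod (sgn u') * cmod (sgn u - sgn u')"
    using abs_Im_le_cmod[of "cnj (sgn u') * (sgn u - sgn u')"] by (simp add: norm_mult)
  also have "\<dots> \<le> 1 * cmod (sgn u - sgn u')"
    by (intro mult_right_mono) (auto simp: norm_sgn)
  finally show ?thesis by (simp add: mult_left_mono)
qed

lemma hyp_inverse_square: "1 / (hyp z)\<^sup>2 = 1 - (cmod z / hyp z)\<^sup>2"
  unfolding power_divide hyp_square
  by (smt (verit) add_divide_distrib divide_self_if zero_le_power2)

lemma square_diff_le:
  fixes p q :: real
  assumes "0 \<le> p" "p \<le> 1" "0 \<le> q" "q \<le> 1" "\<bar>p - q\<bar> \<le> d"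
  shows "\<bar>p\<^sup>2 - q\<^sup>2\<bar> \<le> 2 * d"
proof -
  have "\<bar>p\<^sup>2 - q\<^sup>2\<bar> = \<bar>p - q\<bar> * (p + q)"
    using assms by (simp add: power2_eq_square square_diff_square_factored abs_mult)
  also have "\<dots> \<le> d * 2" using assms by (intro mult_mono) auto
  finally show ?thesis by simp
qed

lemma amp_small_imp_modulus:
  assumes z: "cmod (amp \<zeta> z c2 d1 d2) \<le> \<delta>" "cmod (amp \<zeta> z' c2 d1 d2) \<le> \<delta>" and ne: "d1 \<noteq> z" "d1 \<noteq> z'"
  shows "\<bar>1 / (hyp z)\<^sup>2 - 1 / (hyp z')\<^sup>2\<bar> \<le> 4 * \<delta>"
proof -
  let ?b = "cnj \<zeta> * (1 / complex_of_real (hyp c2) * sgn (d2 - c2))"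
  have *: "\<bar>cmod w / hyp w - cmod ?b\<bar> \<le> \<delta>" if "cmod (amp \<zeta> w c2 d1 d2) \<le> \<delta>" "d1 \<noteq> w" for w
  proof -
    let ?a = "- cnj w / complex_of_real (hyp w) * sgn (d1 - w)"
    have "cmod ?a = cmod w / hyp w" using that(2) by (simp add: norm_mult norm_divide norm_sgn)
    moreover have "\<bar>cmod ?a - cmod (- ?b)\<bar> \<le> cmod (?a - - ?b)" by (rule norm_triangle_ineq3)
    ultimately show ?thesis using that(1) unfolding amp_def norm_minus_cancel by simp
  qed
  have "\<bar>cmod z / hyp z - cmod z' / hyp z'\<bar> \<le> 2 * \<delta>"
    using *[OF z(1) ne(1)] *[OF z(2) ne(2)] by linarith
  then have "\<bar>(cmod z / hyp z)\<^sup>2 - (cmod z' / hyp z')\<^sup>2\<bar> \<le> 2 * (2 * \<delta>)"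
    by (intro square_diff_le) (auto simp: divide_le_eq cmod_le_hyp)
  then show ?thesis unfolding hyp_inverse_square by linarith
qed

text \<open>The mirror image for the second transmitter, whose term has modulus |\<zeta>| / hyp z;
  hence the division by |\<zeta>|.\<close>

lemma amp_small_imp_modulus':
  assumes z: "cmod (amp \<zeta> c1 z d1 d2) \<le> \<delta>" "cmod (amp \<zeta> c1 z' d1 d2) \<le> \<delta>" and ne: "d2 \<noteq> z" "d2 \<noteq> z'"
    and \<zeta>: "\<zeta> \<noteq> 0"
  shows "\<bar>1 / (hyp z)\<^sup>2 - 1 / (hyp z')\<^sup>2\<bar> \<le> 4 * (\<delta> / cmod \<zeta>)"
proof -
  let ?a = "- cnj c1 / complex_of_real (hyp c1) * sgn (d1 - c1)"
  have *: "\<bar>1 / hyp w - cmod ?a / cmod \<zeta>\<bar> \<le> \<delta> / cmod \<zeta>" if "cmod (amp \<zeta> c1 w d1 d2) \<le> \<delta>" "d2 \<noteq> w" for w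
  proof -
    let ?b = "cnj \<zeta> * (1 / complex_of_real (hyp w) * sgn (d2 - w))"
    have b: "cmod ?b = cmod \<zeta> * (1 / hyp w)" using that(2) by (simp add: norm_mult norm_divide norm_sgn)
    have "\<bar>cmod ?b - cmod (- ?a)\<bar> \<le> cmod (?b - - ?a)" by (rule norm_triangle_ineq3)
    also have "\<dots> \<le> \<delta>" using that(1) by (simp add: amp_def add.commute)
    finally have "\<bar>cmod \<zeta> * (1 / hyp w) - cmod ?a\<bar> \<le> \<delta>" unfolding b norm_minus_cancel .
    moreover have "\<bar>1 / hyp w - cmod ?a / cmod \<zeta>\<bar> = \<bar>cmod \<zeta> * (1 / hyp w) - cmod ?a\<bar> / cmod \<zeta>"
    proof -
      have "1 / hyp w - cmod ?a / cmod \<zeta> = (cmod \<zeta> * (1 / hyp w) - cmod ?a) / cmod \<zeta>"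
        using \<zeta> by (simp add: diff_divide_distrib)
      then show ?thesis by (simp only: abs_divide abs_norm_cancel)
    qed
    ultimately show ?thesis by (simp add: divide_right_mono)
  qed
  have "\<bar>1 / hyp z - 1 / hyp z'\<bar> \<le> 2 * (\<delta> / cmod \<zeta>)"
    using *[OF z(1) ne(1)] *[OF z(2) ne(2)] by linarith
  then have "\<bar>(1 / hyp z)\<^sup>2 - (1 / hyp z')\<^sup>2\<bar> \<le> 2 * (2 * (\<delta> / cmod \<zeta>))"
    by (intro square_diff_le) (auto simp: divide_le_eq hyp_ge_1)
  then show ?thesis by (simp add: power_divide)
qed

lemma sgn_coeff_small_imp_slice:
  fixes q b c z z' :: complex
  assumes z: "cmod (q * sgn (z - c) + b) \<le> \<delta>" "cmod (q * sgn (z' - c) + b) \<le> \<delta>"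
    and R: "cmod z \<le> R" "cmod z' \<le> R" "cmod c \<le> R" and q: "0 < q0" "q0 \<le> cmod q"
    and Im: "Im z = Im z'" and \<kappa>: "0 < \<kappa>" "\<kappa> \<le> \<bar>Im (z - c)\<bar>"
  shows "\<bar>Re z - Re z'\<bar> \<le> 8 * R\<^sup>2 * \<delta> / (q0 * \<kappa>)"
proof -
  define S where "S = cmod (sgn (z - c) - sgn (z' - c))"
  have R0: "0 \<le> R" using R(1) norm_ge_zero order_trans by blast
  have "q * (sgn (z - c) - sgn (z' - c)) = (q * sgn (z - c) + b) - (q * sgn (z' - c) + b)"
    by (simp add: algebra_simps)
  then have "cmod q * S \<le> 2 * \<delta>"
    unfolding S_def norm_mult[symmetric] using z norm_triangle_ineq4[of "q * sgn (z - c) + b" "q * sgn (z' - c) + b"] by simp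
  moreover have "q0 * S \<le> cmod q * S" using q by (intro mult_right_mono) (auto simp: S_def)
  ultimately have S: "q0 * S \<le> 2 * \<delta>" by linarith
  have "\<bar>Re z - Re z'\<bar> * \<kappa> \<le> \<bar>Re (z - c) - Re (z' - c)\<bar> * \<bar>Im (z - c)\<bar>"
    using \<kappa> by (simp add: mult_left_mono)
  also have "\<dots> \<le> cmod (z - c) * cmod (z' - c) * S"
    unfolding S_def using Im by (intro sgn_diff_same_slice) simp
  also have "\<dots> \<le> (2 * R) * (2 * R) * S"
    using R norm_triangle_ineq4[of z c] norm_triangle_ineq4[of z' c] R0
    by (intro mult_mono) (auto simp: S_def)
  finally have "\<bar>Re z - Re z'\<bar> * \<kappa> * q0 \<le> (2 * R) * (2 * R) * S * q0"
    using q by (intro mult_right_mono) auto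
  also have "\<dots> = 4 * R\<^sup>2 * (q0 * S)" by (simp add: power2_eq_square)
  also have "\<dots> \<le> 4 * R\<^sup>2 * (2 * \<delta>)" using S by (intro mult_left_mono) auto
  finally show ?thesis using \<kappa> q by (simp add: pos_le_divide_eq mult_ac)
qed

section \<open>Lipschitz estimates, for the upper bound on the interference and the convergence of
  the signal gain\<close>

lemma hyp_Lipschitz: "\<bar>hyp z - hyp w\<bar> \<le> cmod (z - w)"
proof -
  have 1: "hyp z = cmod (Complex 1 (cmod z))" for z by (simp add: hyp_def complex_norm)
  have "\<bar>hyp z - hyp w\<bar> \<le> cmod (Complex 1 (cmod z) - Complex 1 (cmod w))"
    unfolding 1 by (rule norm_triangle_ineq3)
  also have "\<dots> = \<bar>cmod z - cmod w\<bar>" by (simp add: cmod_def)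
  also have "\<dots> \<le> cmod (z - w)" by (rule norm_triangle_ineq3)
  finally show ?thesis .
qed

lemma inverse_hyp_Lipschitz: "\<bar>1 / hyp z - 1 / hyp w\<bar> \<le> cmod (z - w)"
proof -
  have "\<bar>1 / hyp z - 1 / hyp w\<bar> = \<bar>hyp z - hyp w\<bar> / (hyp z * hyp w)"
  proof -
    have "1 / hyp z - 1 / hyp w = (hyp w - hyp z) / (hyp z * hyp w)" by (simp add: field_simps)
    then show ?thesis by (simp add: abs_divide abs_mult abs_minus_commute)
  qed
  also have "\<dots> \<le> \<bar>hyp z - hyp w\<bar>"
    using mult_mono[OF hyp_ge_1[of z] hyp_ge_1[of w]]
    by (simp add: divide_le_eq mult_le_cancel_left1)
  also have "\<dots> \<le> cmod (z - w)" by (rule hyp_Lipschitz)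
  finally show ?thesis .
qed

text \<open>Only the reference point v must be nonzero; the perturbed u is arbitrary, so no
  separation of the estimates is presupposed.\<close>

lemma sgn_Lipschitz:
  fixes u v :: complex
  assumes "v \<noteq> 0"
  shows "cmod (sgn u - sgn v) \<le> 2 * cmod (u - v) / cmod v"
proof (cases "u = 0")
  case True
  then show ?thesis using assms by (simp add: norm_sgn)
next
  case False
  have "of_real (cmod v) * (sgn u - sgn v) = of_real (cmod v - cmod u) * sgn u + (u - v)"
    using assms False by (simp add: sgn_div_norm scaleR_conv_of_real algebra_simps)
  then have "cmod v * cmod (sgn u - sgn v) = cmod (of_real (cmod v - cmod u) * sgn u + (u - v))"
    by (metis abs_norm_cancel norm_mult norm_of_real)
  also have "\<dots> \<le> \<bar>cmod v - cmod u\<bar> + cmod (u - v)"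
    by (rule norm_triangle_le) (use False in \<open>simp add: norm_mult norm_sgn del: of_real_diff\<close>)
  also have "\<bar>cmod v - cmod u\<bar> \<le> cmod (u - v)"
    using norm_triangle_ineq3[of v u] by (simp add: norm_minus_commute)
  finally show ?thesis using assms by (simp add: pos_le_divide_eq mult.commute)
qed

lemma product_diff_le:
  fixes p p' s s' :: complex
  assumes "cmod (p - p') \<le> a" "cmod (s - s') \<le> b" "cmod s \<le> 1" "cmod p' \<le> 1"
  shows "cmod (p * s - p' * s') \<le> a + b"
proof -
  have "p * s - p' * s' = (p - p') * s + p' * (s - s')" by (simp add: algebra_simps)
  then have "cmod (p * s - p' * s') \<le> cmod (p - p') * cmod s + cmod p' * cmod (s - s')"
    by (metis norm_mult norm_triangle_ineq)
  also have "\<dots> \<le> a * 1 + 1 * b"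
    using assms order_trans[OF norm_ge_zero assms(1)] by (intro add_mono mult_mono) auto
  finally show ?thesis by simp
qed

text \<open>Comparison with the point where both transmitters are exact, so the constant depends on
  the channel alone: the beam entries contribute 1 + |c|, the phases 4 / |d - c|, since d_j - c_j
  moves by at most 2 r.\<close>

lemma amp_Lipschitz:
  assumes cd: "c \<noteq> d" and r: "cmod (c1 - c) \<le> r" "cmod (c2 - c) \<le> r" "cmod (d1 - d) \<le> r" "cmod (d2 - d) \<le> r"
  shows "cmod (amp \<zeta> c1 c2 d1 d2 - amp \<zeta> c c d d) \<le> (1 + cmod \<zeta>) * (1 + cmod c + 4 / cmod (d - c)) * r"
proof -
  have r0: "0 \<le> r" using r(1) norm_ge_zero order_trans by blast
  have s: "cmod (sgn (d' - c') - sgn (d - c)) \<le> 4 / cmod (d - c) * r"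
    if "cmod (c' - c) \<le> r" "cmod (d' - d) \<le> r" for c' d'
  proof -
    have "cmod ((d' - c') - (d - c)) \<le> 2 * r"
      using that norm_triangle_ineq4[of "d' - d" "c' - c"] by (simp add: algebra_simps)
    then have "2 * cmod ((d' - c') - (d - c)) / cmod (d - c) \<le> 2 * (2 * r) / cmod (d - c)"
      by (intro divide_right_mono mult_left_mono) auto
    with sgn_Lipschitz[of "d - c" "d' - c'"] cd show ?thesis by simp
  qed
  have n1: "cmod (sgn x) \<le> 1" for x :: complex by (simp add: norm_sgn)
  have 1: "cmod (- cnj c1 / complex_of_real (hyp c1) * sgn (d1 - c1) - - cnj c / complex_of_real (hyp c) * sgn (d - c))
      \<le> (1 + cmod c) * r + 4 / cmod (d - c) * r"
  proof (rule product_diff_le)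
    have "- cnj c1 / complex_of_real (hyp c1) - - cnj c / complex_of_real (hyp c)
       = - (cnj (c1 - c) / complex_of_real (hyp c1) + cnj c * complex_of_real (1 / hyp c1 - 1 / hyp c))"
      by (simp add: algebra_simps diff_divide_distrib)
    then have "cmod (- cnj c1 / complex_of_real (hyp c1) - - cnj c / complex_of_real (hyp c))
       \<le> cmod (cnj (c1 - c) / complex_of_real (hyp c1)) + cmod (cnj c * complex_of_real (1 / hyp c1 - 1 / hyp c))"
      by (metis norm_minus_cancel norm_triangle_ineq)
    also have "\<dots> = cmod (c1 - c) / hyp c1 + cmod c * \<bar>1 / hyp c1 - 1 / hyp c\<bar>"
      by (simp only: norm_divide norm_mult complex_mod_cnj norm_of_real abs_of_nonneg hyp_pos)
    also have "\<dots> \<le> r + cmod c * r"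
    proof (intro add_mono mult_left_mono)
      have "cmod (c1 - c) / hyp c1 \<le> cmod (c1 - c) / 1"
        using hyp_ge_1[of c1] by (intro divide_left_mono) auto
      then show "cmod (c1 - c) / hyp c1 \<le> r" using r(1) by simp
      show "\<bar>1 / hyp c1 - 1 / hyp c\<bar> \<le> r" using r(1) inverse_hyp_Lipschitz[of c1 c] by linarith
    qed simp
    finally show "cmod (- cnj c1 / complex_of_real (hyp c1) - - cnj c / complex_of_real (hyp c)) \<le> (1 + cmod c) * r"
      by (simp add: algebra_simps)
  qed (use s r n1 cmod_le_hyp in \<open>auto simp: norm_divide divide_le_eq\<close>)
  have 2: "cmod (1 / complex_of_real (hyp c2) * sgn (d2 - c2) - 1 / complex_of_real (hyp c) * sgn (d - c))
      \<le> r + 4 / cmod (d - c) * r"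
  proof (rule product_diff_le)
    have "1 / complex_of_real (hyp c2) - 1 / complex_of_real (hyp c) = complex_of_real (1 / hyp c2 - 1 / hyp c)"
      by simp
    then have "cmod (1 / complex_of_real (hyp c2) - 1 / complex_of_real (hyp c)) = \<bar>1 / hyp c2 - 1 / hyp c\<bar>"
      by (simp only: norm_of_real)
    then show "cmod (1 / complex_of_real (hyp c2) - 1 / complex_of_real (hyp c)) \<le> r"
      using r(2) inverse_hyp_Lipschitz[of c2 c] by linarith
  qed (use s r n1 hyp_ge_1 in \<open>auto simp: norm_divide divide_le_eq\<close>)
  have "amp \<zeta> c1 c2 d1 d2 - amp \<zeta> c c d d
     = (- cnj c1 / complex_of_real (hyp c1) * sgn (d1 - c1) - - cnj c / complex_of_real (hyp c) * sgn (d - c))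
     + cnj \<zeta> * (1 / complex_of_real (hyp c2) * sgn (d2 - c2) - 1 / complex_of_real (hyp c) * sgn (d - c))"
    unfolding amp_def by (simp add: algebra_simps)
  then have "cmod (amp \<zeta> c1 c2 d1 d2 - amp \<zeta> c c d d)
     \<le> ((1 + cmod c) * r + 4 / cmod (d - c) * r) + cmod \<zeta> * (r + 4 / cmod (d - c) * r)"
    using 1 mult_left_mono[OF 2, of "cmod \<zeta>"]
    by (simp only:) (rule norm_triangle_le, rule add_mono, simp_all add: norm_mult)
  also have "\<dots> \<le> ((1 + cmod c) * r + 4 / cmod (d - c) * r) + cmod \<zeta> * ((1 + cmod c) * r + 4 / cmod (d - c) * r)"
  proof -
    have "r \<le> (1 + cmod c) * r" using r0 by (simp add: algebra_simps)
    then show ?thesis by (intro add_mono mult_left_mono order_refl) auto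
  qed
  also have "\<dots> = (1 + cmod \<zeta>) * (1 + cmod c + 4 / cmod (d - c)) * r"
    by (simp add: algebra_simps add_divide_distrib)
  finally show ?thesis .
qed

text \<open>With shared exact estimates the beam vanishes at the nulled receiver \<zeta> = c and not
  at the served one, provided that the two slopes differ.\<close>

lemma amp_exact: "amp \<zeta> c c d d = (cnj \<zeta> - cnj c) / complex_of_real (hyp c) * sgn (d - c)"
  by (simp add: amp_def algebra_simps diff_divide_distrib)

section \<open>Lower bounds on the interference\<close>

lemma other_simps [simp]: "other 1 = 2" "other 2 = 1" "other (other l) = l" "other l \<noteq> l" "l \<noteq> other l"
  using exhaust_2[of l] by (auto simp: other_def)

lemma power2_powr: "(x powr s)\<^sup>2 = x powr (2 * s)" for x :: real
  by (simp add: power2_eq_square powr_add[symmetric])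

context fixed_channel
begin

lemma Im_ne_other: "Im (\<zeta> l) \<noteq> Im (\<zeta> (other l))"
  using Im_ne exhaust_2[of l] by auto

lemma \<zeta>_nz: "\<zeta> l \<noteq> 0"
  using Re_nz[of l] by auto

text \<open>For a positive scaling this follows from convergence to a slope off the imaginary axis.
  For scaling 0 the slope is kept out of a thin vertical strip by the union bound.\<close>

lemma Re_slope_ge:
  assumes \<eta>: "0 < \<eta>"
  shows "whp (\<lambda>P W. P powr (- \<eta>) \<le> \<bar>Re (Z P W l j)\<bar>)"
proof (cases "\<alpha> l j = 0")
  case True
  have "whp (\<lambda>P W. \<not> \<bar>Re (Z P W l j)\<bar> < P powr (- \<eta>))"
  \<comment> \<open>A strip of width of order P powr (- \<eta>) in a disc of radius P powr (\<eta> /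
    4) has area of order P powr (- 3 \<eta> / 4).\<close>
  proof (rule whp_avoid[where Q = "\<lambda>P W z. \<bar>Re z\<bar> < P powr (- \<eta>)" and \<epsilon> = "\<eta> / 4" and \<gamma> = "3 * \<eta> / 4" and C = 8])
    show "\<forall>\<^sub>F P in at_top. \<forall>W. emeasure lborel {z. \<bar>Re z\<bar> < P powr (- \<eta>) \<and> cmod (z - \<zeta> l) \<le> P powr (- \<alpha> l j / 2 + \<eta> / 4)}
      \<le> ennreal (8 * P powr (- \<alpha> l j - 3 * \<eta> / 4))"
      using eventually_gt_at_top[of 0]
    proof (eventually_elim, intro allI)
      fix P W assume P: "(0::real) < P"
      have "emeasure lborel {z. \<bar>Re z\<bar> < P powr (- \<eta>) \<and> cmod (z - \<zeta> l) \<le> P powr (- \<alpha> l j / 2 + \<eta> / 4)}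
         \<le> ennreal (4 * P powr (- \<alpha> l j / 2 + \<eta> / 4) * (2 * P powr (- \<eta>)))"
      proof (rule emeasure_lborel_le_slices[where c = "Im (\<zeta> l)"])
        fix z assume "z \<in> {z. \<bar>Re z\<bar> < P powr (- \<eta>) \<and> cmod (z - \<zeta> l) \<le> P powr (- \<alpha> l j / 2 + \<eta> / 4)}"
        then show "\<bar>Im z - Im (\<zeta> l)\<bar> \<le> P powr (- \<alpha> l j / 2 + \<eta> / 4)"
          using abs_Im_le_cmod[of "z - \<zeta> l"] by simp
      qed auto
      also have "\<dots> = ennreal (8 * P powr (- \<alpha> l j - 3 * \<eta> / 4))"
        using True by (simp add: powr_add[symmetric])
      finally show "emeasure lborel {z. \<bar>Re z\<bar> < P powr (- \<eta>) \<and> cmod (z - \<zeta> l) \<le> P powr (- \<alpha> l j / 2 + \<eta> / 4)}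
        \<le> ennreal (8 * P powr (- \<alpha> l j - 3 * \<eta> / 4))" .
    qed
  qed (use \<eta> in \<open>auto\<close>)
  then show ?thesis by (simp add: not_less)
next
  case False
  then have \<alpha>: "0 < \<alpha> l j" using \<alpha>_nonneg[of l j] by simp
  then have e: "0 < \<alpha> l j / 4" by simp
  show ?thesis
  proof (rule whp_mp[OF slope_close[OF e, of l j]])
    have neg: "- \<alpha> l j / 2 + \<alpha> l j / 4 < 0" "- \<eta> < 0" and pos: "0 < \<bar>Re (\<zeta> l)\<bar> / 2"
      using \<alpha> \<eta> Re_nz[of l] by auto
    from eventually_powr_small[OF neg(1) pos, of 1] eventually_powr_small[OF neg(2) pos, of 1]
    show "\<forall>\<^sub>F P in at_top. \<forall>W. cmod (Z P W l j - \<zeta> l) \<le> P powr (- \<alpha> l j / 2 + \<alpha> l j / 4) \<longrightarrow> P powr (- \<eta>) \<le> \<bar>Re (Z P W l j)\<bar>"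
    proof (eventually_elim, intro allI impI)
      fix P W assume "1 * P powr (- \<alpha> l j / 2 + \<alpha> l j / 4) < \<bar>Re (\<zeta> l)\<bar> / 2" "1 * P powr (- \<eta>) < \<bar>Re (\<zeta> l)\<bar> / 2"
        "cmod (Z P W l j - \<zeta> l) \<le> P powr (- \<alpha> l j / 2 + \<alpha> l j / 4)"
      then show "P powr (- \<eta>) \<le> \<bar>Re (Z P W l j)\<bar>"
        using abs_Re_le_cmod[of "Z P W l j - \<zeta> l"] unfolding minus_complex.simps by linarith
    qed
  qed
qed

lemma Im_gap_aux:
  assumes \<eta>: "0 < \<eta>" and le: "\<alpha> l j \<le> \<alpha> (other l) j"
  shows "whp (\<lambda>P W. P powr (- \<eta>) \<le> \<bar>Im (Z P W l j) - Im (Z P W (other l) j)\<bar>)"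
proof (cases "\<alpha> l j = 0")
  case True
  have "whp (\<lambda>P W. \<not> \<bar>Im (Z P W l j) - Im (Z P W (other l) j)\<bar> < P powr (- \<eta>))"
  proof (rule whp_avoid[where Q = "\<lambda>P W z. \<bar>Im z - Im (Z P W (other l) j)\<bar> < P powr (- \<eta>)"
        and \<epsilon> = "\<eta> / 4" and \<gamma> = "3 * \<eta> / 4" and C = 8])
    show "\<forall>\<^sub>F P in at_top. \<forall>W. emeasure lborel {z. \<bar>Im z - Im (Z P W (other l) j)\<bar> < P powr (- \<eta>) \<and> cmod (z - \<zeta> l) \<le> P powr (- \<alpha> l j / 2 + \<eta> / 4)}
      \<le> ennreal (8 * P powr (- \<alpha> l j - 3 * \<eta> / 4))"
      using eventually_gt_at_top[of 0]
    proof (eventually_elim, intro allI)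
      fix P W assume P: "(0::real) < P"
      let ?A = "{z. \<bar>Im z - Im (Z P W (other l) j)\<bar> < P powr (- \<eta>) \<and> cmod (z - \<zeta> l) \<le> P powr (- \<alpha> l j / 2 + \<eta> / 4)}"
      have "emeasure lborel ?A \<le> ennreal (4 * P powr (- \<eta>) * (2 * P powr (- \<alpha> l j / 2 + \<eta> / 4)))"
      proof (rule emeasure_lborel_le_slices[where c = "Im (Z P W (other l) j)"])
        fix z z' assume "z \<in> ?A" "z' \<in> ?A"
        then show "\<bar>Re z - Re z'\<bar> \<le> 2 * P powr (- \<alpha> l j / 2 + \<eta> / 4)"
          using abs_Re_le_cmod[of "z - \<zeta> l"] abs_Re_le_cmod[of "z' - \<zeta> l"]
          unfolding mem_Collect_eq minus_complex.simps by linarith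
      qed auto
      also have "\<dots> = ennreal (8 * P powr (- \<alpha> l j - 3 * \<eta> / 4))"
        using True by (simp add: powr_add[symmetric])
      finally show "emeasure lborel ?A \<le> ennreal (8 * P powr (- \<alpha> l j - 3 * \<eta> / 4))" .
    qed
  qed (use \<eta> in \<open>auto simp: slope_upd_other\<close>)
  then show ?thesis by (simp add: not_less)
next
  case False
  then have \<alpha>: "0 < \<alpha> l j" "0 < \<alpha> (other l) j" using \<alpha>_nonneg[of l j] le by auto
  then have e: "0 < \<alpha> l j / 4" "0 < \<alpha> (other l) j / 4" by auto
  show ?thesis
  proof (rule whp_mp[OF whp_conj[OF slope_close[OF e(1), of l j] slope_close[OF e(2), of "other l" j]]])
    define g where "g = \<bar>Im (\<zeta> l) - Im (\<zeta> (other l))\<bar> / 3"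
    have tri: "\<bar>Im (\<zeta> l) - Im (\<zeta> (other l))\<bar> \<le> \<bar>Im (Z P W l j) - Im (\<zeta> l)\<bar>
        + \<bar>Im (Z P W l j) - Im (Z P W (other l) j)\<bar> + \<bar>Im (Z P W (other l) j) - Im (\<zeta> (other l))\<bar>" for P W
      by linarith
    have neg: "- \<alpha> l j / 2 + \<alpha> l j / 4 < 0" "- \<alpha> (other l) j / 2 + \<alpha> (other l) j / 4 < 0" "- \<eta> < 0" and pos: "0 < g"
      using \<alpha> \<eta> Im_ne_other[of l] by (auto simp: g_def)
    from eventually_powr_small[OF neg(1) pos, of 1] eventually_powr_small[OF neg(2) pos, of 1] eventually_powr_small[OF neg(3) pos, of 1]
    show "\<forall>\<^sub>F P in at_top. \<forall>W. cmod (Z P W l j - \<zeta> l) \<le> P powr (- \<alpha> l j / 2 + \<alpha> l j / 4) \<and>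
        cmod (Z P W (other l) j - \<zeta> (other l)) \<le> P powr (- \<alpha> (other l) j / 2 + \<alpha> (other l) j / 4)
        \<longrightarrow> P powr (- \<eta>) \<le> \<bar>Im (Z P W l j) - Im (Z P W (other l) j)\<bar>"
    proof (eventually_elim, intro allI impI, elim conjE)
      fix P W
      assume "1 * P powr (- \<alpha> l j / 2 + \<alpha> l j / 4) < g" "1 * P powr (- \<alpha> (other l) j / 2 + \<alpha> (other l) j / 4) < g" "1 * P powr (- \<eta>) < g"
        "cmod (Z P W l j - \<zeta> l) \<le> P powr (- \<alpha> l j / 2 + \<alpha> l j / 4)"
        "cmod (Z P W (other l) j - \<zeta> (other l)) \<le> P powr (- \<alpha> (other l) j / 2 + \<alpha> (other l) j / 4)"
      note * = this
      have "\<bar>Im (Z P W l j) - Im (\<zeta> l)\<bar> < g"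
        using order.strict_trans1[OF order_trans[OF abs_Im_le_cmod *(4)]] *(1) by simp
      moreover have "\<bar>Im (Z P W (other l) j) - Im (\<zeta> (other l))\<bar> < g"
        using order.strict_trans1[OF order_trans[OF abs_Im_le_cmod *(5)]] *(2) by simp
      moreover have "3 * g = \<bar>Im (\<zeta> l) - Im (\<zeta> (other l))\<bar>" by (simp add: g_def)
      ultimately have "g < \<bar>Im (Z P W l j) - Im (Z P W (other l) j)\<bar>" using tri[of P W] by argo
      with *(3) show "P powr (- \<eta>) \<le> \<bar>Im (Z P W l j) - Im (Z P W (other l) j)\<bar>" by simp
    qed
  qed
qed

lemma Im_gap:
  assumes "0 < \<eta>"
  shows "whp (\<lambda>P W. P powr (- \<eta>) \<le> \<bar>Im (Z P W l j) - Im (Z P W (other l) j)\<bar>)"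
  using Im_gap_aux[OF assms, of l j] Im_gap_aux[OF assms, of "other l" j]
  by (cases "\<alpha> l j \<le> \<alpha> (other l) j") (auto simp: abs_minus_commute)

lemma slope_bounded:
  assumes \<eta>: "0 < \<eta>"
  shows "whp (\<lambda>P W. cmod (Z P W l j) \<le> P powr \<eta>)"
proof -
  have \<eta>2: "0 < \<eta> / 2" using \<eta> by simp
  show ?thesis
  proof (rule whp_mp[OF slope_close[OF \<eta>2, of l j]])
    show "\<forall>\<^sub>F P in at_top. \<forall>W. cmod (Z P W l j - \<zeta> l) \<le> P powr (- \<alpha> l j / 2 + \<eta> / 2) \<longrightarrow> cmod (Z P W l j) \<le> P powr \<eta>"
      using eventually_le_powr[OF \<eta>2, of "cmod (\<zeta> l) + 1"] eventually_ge_at_top[of 1]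
    proof (eventually_elim, intro allI impI)
      fix P W assume P: "cmod (\<zeta> l) + 1 \<le> P powr (\<eta> / 2)" "1 \<le> P"
        and W: "cmod (Z P W l j - \<zeta> l) \<le> P powr (- \<alpha> l j / 2 + \<eta> / 2)"
      have "P powr (- \<alpha> l j / 2 + \<eta> / 2) \<le> P powr (\<eta> / 2)"
        using P(2) \<alpha>_nonneg[of l j] by (intro powr_mono) auto
      then have "cmod (Z P W l j) \<le> cmod (\<zeta> l) + P powr (\<eta> / 2)"
        using W norm_triangle_sub[of "Z P W l j" "\<zeta> l"] by linarith
      also have "\<dots> \<le> (cmod (\<zeta> l) + 1) * P powr (\<eta> / 2)"
        using P mult_left_mono[of 1 "P powr (\<eta> / 2)" "cmod (\<zeta> l)"] ge_one_powr_ge_zero[of P "\<eta> / 2"] \<eta>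
        by (simp add: algebra_simps)
      also have "\<dots> \<le> P powr (\<eta> / 2) * P powr (\<eta> / 2)"
        using P by (intro mult_right_mono) auto
      also have "\<dots> = P powr \<eta>" by (simp add: powr_add[symmetric])
      finally show "cmod (Z P W l j) \<le> P powr \<eta>" .
    qed
  qed
qed

text \<open>Gain of the beam serving receiver \<open>m\<close>, seen at receiver \<open>i\<close>: the interference for \<open>m = other i\<close>.\<close>

definition gain :: "2 \<Rightarrow> 2 \<Rightarrow> real \<Rightarrow> (2 \<times> 2 \<Rightarrow> nat \<Rightarrow> cvec) \<Rightarrow> complex" where
  "gain i m P W = amp (\<zeta> i) (Z P W (other m) 1) (Z P W (other m) 2) (Z P W m 1) (Z P W m 2)"

lemma measurable_gain [measurable]: "(\<lambda>W. gain i m P W) \<in> borel_measurable (M P)"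
  unfolding gain_def by measurable

lemma interference_gt_own:
  assumes \<epsilon>: "0 < \<epsilon>"
  shows "whp (\<lambda>P W. P powr (- \<alpha> i j / 2 - \<epsilon>) < cmod (gain i (other i) P W))"
proof -
  \<comment> \<open>The budget: the slice width loses 5 \<eta> (4 from the slope bound, 1 from the
    distance to the imaginary axis) and the disc radius 1 more, in total \<epsilon> / 2; the
    remaining \<epsilon> / 2 is the decay required by \<open>whp_avoid\<close>.\<close>
  define \<eta> where "\<eta> = \<epsilon> / 12"
  have \<eta>: "0 < \<eta>" using \<epsilon> by (simp add: \<eta>_def)
  \<comment> \<open>One constant for both transmitters: it dominates the 1 needed for j = 1 and the
    1 / |\<zeta> i| needed for j = 2.\<close>
  define m where "m = 1 + 1 / cmod (\<zeta> i)"
  have m: "1 \<le> m" "1 / cmod (\<zeta> i) \<le> m" by (auto simp: m_def)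
  \<comment> \<open>The gain with a free variable in place of the randomised slope, so that the bad
    set does not look at codebook (i, j).\<close>
  define A where "A P W z = (if j = 1 then amp (\<zeta> i) z (Z P W i 2) (Z P W (other i) 1) (Z P W (other i) 2)
      else amp (\<zeta> i) (Z P W i 1) z (Z P W (other i) 1) (Z P W (other i) 2))" for P W z
  \<comment> \<open>The modulus determines Re z on a slice only up to sign, so the half-planes s = 1
    and s = -1 are avoided separately. The side conditions hold with high probability and are
    discharged at the end.\<close>
  define Q where "Q s P W z \<longleftrightarrow> P powr (- \<eta>) \<le> s * Re z \<and> cmod z \<le> P powr \<eta> \<and> 0 < cmod (z - Z P W (other i) j)
      \<and> cmod (A P W z) \<le> P powr (- \<alpha> i j / 2 - \<epsilon>)" for s P W z
  have gain: "A P W (Z P W i j) = gain i (other i) P W" for P W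
    using exhaust_2[of j] by (auto simp: A_def gain_def)
  have avoid: "whp (\<lambda>P W. \<not> Q s P W (Z P W i j))" if s: "s = 1 \<or> s = -1" for s
  proof (rule whp_avoid[where Q = "Q s" and l = i and j = j and \<epsilon> = \<eta> and \<gamma> = "\<epsilon> / 2" and C = "32 * m"])
    show "{W \<in> space (M P). Q s P W (Z P W i j)} \<in> sets (M P)" for P
      unfolding Q_def gain by measurable
    show "Q s P (W((i, j) := x)) z = Q s P W z" for P W x z
      using exhaust_2[of j] by (auto simp: Q_def A_def slope_upd_other)
    show "{z. Q s P W z} \<in> sets borel" for P W
      unfolding Q_def A_def using exhaust_2[of j] by (elim disjE) (simp_all del: split_paired_All, measurable)
    show "\<forall>\<^sub>F P in at_top. \<forall>W. emeasure lborel {z. Q s P W z \<and> cmod (z - \<zeta> i) \<le> P powr (- \<alpha> i j / 2 + \<eta>)}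
      \<le> ennreal (32 * m * P powr (- \<alpha> i j - \<epsilon> / 2))"
      using eventually_ge_at_top[of 1]
    proof (eventually_elim, intro allI)
      fix P W assume P: "(1::real) \<le> P"
      define \<delta> where "\<delta> = P powr (- \<alpha> i j / 2 - \<epsilon>)"
      have \<delta>: "0 \<le> \<delta>" by (simp add: \<delta>_def)
      let ?A = "{z. Q s P W z \<and> cmod (z - \<zeta> i) \<le> P powr (- \<alpha> i j / 2 + \<eta>)}"
      have "emeasure lborel ?A \<le> ennreal (4 * P powr (- \<alpha> i j / 2 + \<eta>) * (8 * m * P powr (- \<alpha> i j / 2 - \<epsilon> + 5 * \<eta>)))"
      proof (rule emeasure_lborel_le_slices[where c = "Im (\<zeta> i)"])
        have "{z. Q s P W z} \<inter> {z. cmod (z - \<zeta> i) \<le> P powr (- \<alpha> i j / 2 + \<eta>)} \<in> sets borel"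
          using \<open>\<And>P W. {z. Q s P W z} \<in> sets borel\<close> by (intro sets.Int) auto
        then show "?A \<in> sets borel" by (simp add: Collect_conj_eq)
        show "\<bar>Im z - Im (\<zeta> i)\<bar> \<le> P powr (- \<alpha> i j / 2 + \<eta>)" if "z \<in> ?A" for z
          using that abs_Im_le_cmod[of "z - \<zeta> i"] by simp
        fix z z' assume zz: "z \<in> ?A" "z' \<in> ?A" "Im z = Im z'"
        have "\<bar>1 / (hyp z)\<^sup>2 - 1 / (hyp z')\<^sup>2\<bar> \<le> 4 * \<delta> * m"
        proof (cases "j = 1")
          case True
          then have "\<bar>1 / (hyp z)\<^sup>2 - 1 / (hyp z')\<^sup>2\<bar> \<le> 4 * \<delta>"
            using zz by (intro amp_small_imp_modulus) (auto simp: Q_def A_def \<delta>_def)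
          also have "4 * \<delta> \<le> 4 * \<delta> * m" using \<delta> m by (simp add: mult_le_cancel_left1)
          finally show ?thesis .
        next
          case False
          then have j: "j = 2" using exhaust_2[of j] by simp
          then have "\<bar>1 / (hyp z)\<^sup>2 - 1 / (hyp z')\<^sup>2\<bar> \<le> 4 * (\<delta> / cmod (\<zeta> i))"
            using zz \<zeta>_nz by (intro amp_small_imp_modulus') (auto simp: Q_def A_def \<delta>_def)
          also have "\<dots> \<le> 4 * \<delta> * m" using mult_left_mono[OF m(2), of "4 * \<delta>"] \<delta> by simp
          finally show ?thesis .
        qed
        then have "\<bar>Re z - Re z'\<bar> \<le> (4 * \<delta> * m) * (1 + (P powr \<eta>)\<^sup>2)\<^sup>2 / (2 * P powr (- \<eta>))"
          using zz s P by (intro same_slice_modulus_diff[where s = s]) (auto simp: Q_def)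
        also have "\<dots> \<le> (4 * \<delta> * m) * (2 * P powr (2 * \<eta>))\<^sup>2 / (2 * P powr (- \<eta>))"
          using \<delta> m P \<eta> ge_one_powr_ge_zero[of P "2 * \<eta>"]
          by (intro divide_right_mono mult_left_mono power_mono) (auto simp: power2_powr)
        also have "\<dots> = 8 * m * (\<delta> * P powr (4 * \<eta>) * P powr \<eta>)"
          using P by (simp add: power_mult_distrib power2_powr powr_minus field_simps)
        also have "\<delta> * P powr (4 * \<eta>) * P powr \<eta> = P powr (- \<alpha> i j / 2 - \<epsilon> + 5 * \<eta>)"
          by (simp add: \<delta>_def powr_add[symmetric] algebra_simps)
        finally show "\<bar>Re z - Re z'\<bar> \<le> 8 * m * P powr (- \<alpha> i j / 2 - \<epsilon> + 5 * \<eta>)" .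
      qed (use m in auto)
      also have "4 * P powr (- \<alpha> i j / 2 + \<eta>) * (8 * m * P powr (- \<alpha> i j / 2 - \<epsilon> + 5 * \<eta>))
         = 32 * m * (P powr (- \<alpha> i j / 2 + \<eta>) * P powr (- \<alpha> i j / 2 - \<epsilon> + 5 * \<eta>))" by simp
      also have "P powr (- \<alpha> i j / 2 + \<eta>) * P powr (- \<alpha> i j / 2 - \<epsilon> + 5 * \<eta>) = P powr (- \<alpha> i j - \<epsilon> / 2)"
        by (simp add: \<eta>_def powr_add[symmetric] algebra_simps)
      finally show "emeasure lborel ?A \<le> ennreal (32 * m * P powr (- \<alpha> i j - \<epsilon> / 2))" .
    qed
  qed (use \<eta> \<epsilon> in auto)
  show ?thesis
  proof (rule whp_mp[OF whp_conj[OF whp_conj[OF avoid[of 1] avoid[of "-1"]]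
        whp_conj[OF Re_slope_ge[OF \<eta>, of i j] whp_conj[OF slope_bounded[OF \<eta>, of i j] Im_gap[OF \<eta>, of i j]]]]])
    show "\<forall>\<^sub>F P in at_top. \<forall>W. (\<not> Q 1 P W (Z P W i j) \<and> \<not> Q (-1) P W (Z P W i j)) \<and>
       P powr (- \<eta>) \<le> \<bar>Re (Z P W i j)\<bar> \<and> cmod (Z P W i j) \<le> P powr \<eta> \<and>
       P powr (- \<eta>) \<le> \<bar>Im (Z P W i j) - Im (Z P W (other i) j)\<bar> \<longrightarrow>
       P powr (- \<alpha> i j / 2 - \<epsilon>) < cmod (gain i (other i) P W)"
      using eventually_gt_at_top[of 0]
    proof (eventually_elim, intro allI impI, elim conjE)
      fix P W assume P: "(0::real) < P" and nQ: "\<not> Q 1 P W (Z P W i j)" "\<not> Q (-1) P W (Z P W i j)"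
        and R: "P powr (- \<eta>) \<le> \<bar>Re (Z P W i j)\<bar>" "cmod (Z P W i j) \<le> P powr \<eta>"
        "P powr (- \<eta>) \<le> \<bar>Im (Z P W i j) - Im (Z P W (other i) j)\<bar>"
      have "0 < P powr (- \<eta>)" using P by simp
      with R(3) have "Z P W i j \<noteq> Z P W (other i) j" by auto
      with nQ R show "P powr (- \<alpha> i j / 2 - \<epsilon>) < cmod (gain i (other i) P W)"
        unfolding Q_def gain by (auto simp: abs_if split: if_splits)
    qed
  qed simp_all
qed

lemma interference_gt_other:
  assumes \<epsilon>: "0 < \<epsilon>"
  shows "whp (\<lambda>P W. P powr (- \<alpha> (other i) j / 2 - \<epsilon>) < cmod (gain i (other i) P W))"
proof -
  let ?o = "other i"
  \<comment> \<open>The same budget: the slice width now loses R^3 / \<kappa>^2, again five factors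
    of P powr \<eta>, and the disc radius one more.\<close>
  define \<eta> where "\<eta> = \<epsilon> / 12"
  have \<eta>: "0 < \<eta>" using \<epsilon> by (simp add: \<eta>_def)
  define m where "m = 1 + 1 / cmod (\<zeta> i)"
  have m: "1 \<le> m" "1 / cmod (\<zeta> i) \<le> m" by (auto simp: m_def)
  \<comment> \<open>The interference is affine in the random phase: \<open>q\<close> is its
    coefficient and \<open>b\<close> the term of the other transmitter. Neither involves codebook
    (other i, j).\<close>
  define q b where "q P W = (if j = 1 then - cnj (Z P W i 1) / complex_of_real (hyp (Z P W i 1)) else cnj (\<zeta> i) * (1 / complex_of_real (hyp (Z P W i 2))))"
    and "b P W = (if j = 1 then cnj (\<zeta> i) * (1 / complex_of_real (hyp (Z P W i 2)) * sgn (Z P W ?o 2 - Z P W i 2))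
        else - cnj (Z P W i 1) / complex_of_real (hyp (Z P W i 1)) * sgn (Z P W ?o 1 - Z P W i 1))" for P W
  define Q where "Q P W z \<longleftrightarrow> P powr (- \<eta>) \<le> \<bar>Im (z - Z P W i j)\<bar> \<and> cmod z \<le> P powr \<eta> \<and> cmod (Z P W i j) \<le> P powr \<eta>
      \<and> P powr (- \<eta>) \<le> \<bar>Re (Z P W i j)\<bar> \<and> cmod (q P W * sgn (z - Z P W i j) + b P W) \<le> P powr (- \<alpha> ?o j / 2 - \<epsilon>)" for P W z
  have gain: "q P W * sgn (Z P W ?o j - Z P W i j) + b P W = gain i ?o P W" for P W
    using exhaust_2[of j] by (auto simp: q_def b_def gain_def amp_def)
  have measQ: "{z. Q P W z} \<in> sets borel" for P W
    unfolding Q_def by measurable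
  have avoid: "whp (\<lambda>P W. \<not> Q P W (Z P W ?o j))"
  proof (rule whp_avoid[where Q = Q and l = ?o and j = j and \<epsilon> = \<eta> and \<gamma> = "\<epsilon> / 2" and C = "64 * m"])
    show "{W \<in> space (M P). Q P W (Z P W ?o j)} \<in> sets (M P)" for P
      unfolding Q_def gain by measurable
    show "Q P (W((?o, j) := x)) z = Q P W z" for P W x z
      using exhaust_2[of j] by (auto simp: Q_def q_def b_def slope_upd_other)
    show "{z. Q P W z} \<in> sets borel" for P W by (rule measQ)
    show "\<forall>\<^sub>F P in at_top. \<forall>W. emeasure lborel {z. Q P W z \<and> cmod (z - \<zeta> ?o) \<le> P powr (- \<alpha> ?o j / 2 + \<eta>)}
      \<le> ennreal (64 * m * P powr (- \<alpha> ?o j - \<epsilon> / 2))"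
      using eventually_ge_at_top[of 1]
    proof (eventually_elim, intro allI)
      fix P W assume P: "(1::real) \<le> P"
      define \<delta> R \<kappa> where "\<delta> = P powr (- \<alpha> ?o j / 2 - \<epsilon>)" and "R = P powr \<eta>" and "\<kappa> = P powr (- \<eta>)"
      have \<delta>: "0 \<le> \<delta>" by (simp add: \<delta>_def)
      have R: "1 \<le> R" using P \<eta> by (simp add: R_def ge_one_powr_ge_zero)
      have \<kappa>: "0 < \<kappa>" "\<kappa> \<le> 1" using P \<eta> by (auto simp: \<kappa>_def powr_minus inverse_le_1_iff ge_one_powr_ge_zero)
      let ?A = "{z. Q P W z \<and> cmod (z - \<zeta> ?o) \<le> P powr (- \<alpha> ?o j / 2 + \<eta>)}"
      have "emeasure lborel ?A \<le> ennreal (4 * P powr (- \<alpha> ?o j / 2 + \<eta>) * (16 * m * P powr (- \<alpha> ?o j / 2 - \<epsilon> + 5 * \<eta>)))"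
      proof (rule emeasure_lborel_le_slices[where c = "Im (\<zeta> ?o)"])
        have "{z. Q P W z} \<inter> {z. cmod (z - \<zeta> ?o) \<le> P powr (- \<alpha> ?o j / 2 + \<eta>)} \<in> sets borel"
          using measQ by (intro sets.Int) auto
        then show "?A \<in> sets borel" by (simp add: Collect_conj_eq)
        show "\<bar>Im z - Im (\<zeta> ?o)\<bar> \<le> P powr (- \<alpha> ?o j / 2 + \<eta>)" if "z \<in> ?A" for z
          using that abs_Im_le_cmod[of "z - \<zeta> ?o"] by simp
        fix z z' assume zz: "z \<in> ?A" "z' \<in> ?A" "Im z = Im z'"
        define c where "c = Z P W i j"
        \<comment> \<open>A common lower bound on |q|: for j = 1 the coefficient |c| / hyp c needs c
          away from 0, which |Re c| \<ge> \<kappa> provides; for j = 2 it is |\<zeta> i| / hyp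
          c.\<close>
        define q0 where "q0 = \<kappa> / ((1 + R) * m)"
        have q0: "0 < q0" using \<kappa> R m by (simp add: q0_def)
        have c: "cmod c \<le> R" "\<kappa> \<le> \<bar>Re c\<bar>" using zz by (auto simp: Q_def c_def R_def \<kappa>_def)
        have hc: "hyp c \<le> 1 + R" using c hyp_le[of c] by linarith
        have "q0 \<le> cmod (q P W)"
        proof (cases "j = 1")
          case True
          have "q0 \<le> \<kappa> / (1 + R)"
            unfolding q0_def using \<kappa> R m by (intro divide_left_mono) (auto simp: mult_le_cancel_left1)
          also have "\<dots> \<le> cmod c / hyp c"
            using c hc \<kappa> R abs_Re_le_cmod[of c] by (intro frac_le) auto
          finally show ?thesis using True by (simp add: q_def c_def norm_divide)
        next
          case False
          then have j: "j = 2" using exhaust_2[of j] by simp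
          have \<zeta>: "0 < cmod (\<zeta> i)" using \<zeta>_nz by simp
          have "q0 \<le> 1 / ((1 + R) * (1 / cmod (\<zeta> i)))"
            unfolding q0_def using \<kappa> R m \<zeta> by (intro frac_le mult_left_mono) auto
          also have "\<dots> = cmod (\<zeta> i) / (1 + R)" by simp
          also have "\<dots> \<le> cmod (\<zeta> i) / hyp c"
            using hc R by (intro divide_left_mono) auto
          finally show ?thesis using j by (simp add: q_def c_def norm_mult norm_divide)
        qed
        then have "\<bar>Re z - Re z'\<bar> \<le> 8 * R\<^sup>2 * \<delta> / (q0 * \<kappa>)"
          using zz q0 \<kappa> by (intro sgn_coeff_small_imp_slice[where c = c and q = "q P W" and b = "b P W"])
             (auto simp: Q_def c_def R_def \<kappa>_def \<delta>_def)
        also have "\<dots> = 8 * m * (R\<^sup>2 * \<delta> * (1 + R) / \<kappa>\<^sup>2)"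
          using \<kappa> m R by (simp add: q0_def field_simps power2_eq_square)
        also have "\<dots> \<le> 8 * m * (R\<^sup>2 * \<delta> * (2 * R) / \<kappa>\<^sup>2)"
          using m R \<delta> \<kappa> by (intro mult_left_mono divide_right_mono) auto
        also have "\<dots> = 16 * m * (R\<^sup>2 * \<delta> * R / \<kappa>\<^sup>2)" by simp
        also have "R\<^sup>2 * \<delta> * R / \<kappa>\<^sup>2 = P powr (- \<alpha> ?o j / 2 - \<epsilon> + 5 * \<eta>)"
          unfolding R_def \<kappa>_def \<delta>_def power2_powr powr_add[symmetric] powr_diff[symmetric] by (simp add: algebra_simps)
        finally show "\<bar>Re z - Re z'\<bar> \<le> 16 * m * P powr (- \<alpha> ?o j / 2 - \<epsilon> + 5 * \<eta>)" .
      qed (use m in auto)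
      also have "4 * P powr (- \<alpha> ?o j / 2 + \<eta>) * (16 * m * P powr (- \<alpha> ?o j / 2 - \<epsilon> + 5 * \<eta>))
         = 64 * m * (P powr (- \<alpha> ?o j / 2 + \<eta>) * P powr (- \<alpha> ?o j / 2 - \<epsilon> + 5 * \<eta>))" by simp
      also have "P powr (- \<alpha> ?o j / 2 + \<eta>) * P powr (- \<alpha> ?o j / 2 - \<epsilon> + 5 * \<eta>) = P powr (- \<alpha> ?o j - \<epsilon> / 2)"
        by (simp add: \<eta>_def powr_add[symmetric] algebra_simps)
      finally show "emeasure lborel ?A \<le> ennreal (64 * m * P powr (- \<alpha> ?o j - \<epsilon> / 2))" .
    qed
  qed (use \<eta> \<epsilon> in auto)
  show ?thesis
  proof (rule whp_mp[OF whp_conj[OF whp_conj[OF avoid slope_bounded[OF \<eta>, of ?o j]]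
        whp_conj[OF Re_slope_ge[OF \<eta>, of i j] whp_conj[OF slope_bounded[OF \<eta>, of i j] Im_gap[OF \<eta>, of ?o j]]]]])
    show "\<forall>\<^sub>F P in at_top. \<forall>W. (\<not> Q P W (Z P W ?o j) \<and> cmod (Z P W ?o j) \<le> P powr \<eta>) \<and>
       P powr (- \<eta>) \<le> \<bar>Re (Z P W i j)\<bar> \<and> cmod (Z P W i j) \<le> P powr \<eta> \<and>
       P powr (- \<eta>) \<le> \<bar>Im (Z P W ?o j) - Im (Z P W (other ?o) j)\<bar> \<longrightarrow>
       P powr (- \<alpha> ?o j / 2 - \<epsilon>) < cmod (gain i ?o P W)"
      unfolding Q_def gain by (intro always_eventually allI impI) auto
  qed
qed

end

section \<open>Expected rate for a fixed channel\<close>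

lemma eventually_le_log:
  assumes e: "0 < e"
  shows "\<forall>\<^sub>F P in at_top. c \<le> e * log 2 P"
proof -
  have "\<forall>\<^sub>F P in at_top. 2 powr (c / e) \<le> P" by (rule eventually_ge_at_top)
  then show ?thesis
  proof eventually_elim
    case (elim P)
    have "0 < P" using elim by (smt (verit) powr_gt_zero)
    then have "c / e \<le> log 2 P" using elim by (subst le_log_iff) auto
    then show ?case using e by (simp add: pos_divide_le_eq mult.commute)
  qed
qed

context fixed_channel
begin

text \<open>All four slopes are at least as accurate as the worst scaling \<open>a\<close> permits;
  the channel-dependent Lipschitz constant is absorbed in P powr (\<epsilon> / 2).\<close>

lemma gain_accurate:
  assumes a: "\<And>l j. a \<le> \<alpha> l j" and \<epsilon>: "0 < \<epsilon>"
  shows "whp (\<lambda>P W. cmod (gain i m P W - amp (\<zeta> i) (\<zeta> (other m)) (\<zeta> (other m)) (\<zeta> m) (\<zeta> m)) \<le> P powr (- a / 2 + \<epsilon>))"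
proof -
  define L where "L = (1 + cmod (\<zeta> i)) * (1 + cmod (\<zeta> (other m)) + 4 / cmod (\<zeta> m - \<zeta> (other m)))"
  have \<epsilon>2: "0 < \<epsilon> / 2" using \<epsilon> by simp
  have ne: "\<zeta> (other m) \<noteq> \<zeta> m" using Im_ne_other[of m] by auto
  have close: "whp (\<lambda>P W. cmod (Z P W l j - \<zeta> l) \<le> P powr (- a / 2 + \<epsilon> / 2))" for l j
  proof (rule whp_mp[OF slope_close[OF \<epsilon>2, of l j]])
    show "\<forall>\<^sub>F P in at_top. \<forall>W. cmod (Z P W l j - \<zeta> l) \<le> P powr (- \<alpha> l j / 2 + \<epsilon> / 2) \<longrightarrow> cmod (Z P W l j - \<zeta> l) \<le> P powr (- a / 2 + \<epsilon> / 2)"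
      using eventually_ge_at_top[of 1]
    proof (eventually_elim, intro allI impI)
      fix P W assume "(1::real) \<le> P" and W: "cmod (Z P W l j - \<zeta> l) \<le> P powr (- \<alpha> l j / 2 + \<epsilon> / 2)"
      then have "P powr (- \<alpha> l j / 2 + \<epsilon> / 2) \<le> P powr (- a / 2 + \<epsilon> / 2)"
        using a[of l j] by (intro powr_mono) auto
      with W show "cmod (Z P W l j - \<zeta> l) \<le> P powr (- a / 2 + \<epsilon> / 2)" by linarith
    qed
  qed
  show ?thesis
  proof (rule whp_mp[OF whp_conj[OF whp_conj[OF close[of "other m" 1] close[of "other m" 2]] whp_conj[OF close[of m 1] close[of m 2]]]])
    show "\<forall>\<^sub>F P in at_top. \<forall>W. (cmod (Z P W (other m) 1 - \<zeta> (other m)) \<le> P powr (- a / 2 + \<epsilon> / 2) \<and>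
         cmod (Z P W (other m) 2 - \<zeta> (other m)) \<le> P powr (- a / 2 + \<epsilon> / 2)) \<and>
         cmod (Z P W m 1 - \<zeta> m) \<le> P powr (- a / 2 + \<epsilon> / 2) \<and> cmod (Z P W m 2 - \<zeta> m) \<le> P powr (- a / 2 + \<epsilon> / 2) \<longrightarrow>
         cmod (gain i m P W - amp (\<zeta> i) (\<zeta> (other m)) (\<zeta> (other m)) (\<zeta> m) (\<zeta> m)) \<le> P powr (- a / 2 + \<epsilon>)"
      using eventually_le_powr[OF \<epsilon>2, of L]
    proof (eventually_elim, intro allI impI, elim conjE)
      fix P W assume P: "L \<le> P powr (\<epsilon> / 2)"
        and W: "cmod (Z P W (other m) 1 - \<zeta> (other m)) \<le> P powr (- a / 2 + \<epsilon> / 2)"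
         "cmod (Z P W (other m) 2 - \<zeta> (other m)) \<le> P powr (- a / 2 + \<epsilon> / 2)"
         "cmod (Z P W m 1 - \<zeta> m) \<le> P powr (- a / 2 + \<epsilon> / 2)" "cmod (Z P W m 2 - \<zeta> m) \<le> P powr (- a / 2 + \<epsilon> / 2)"
      have "cmod (gain i m P W - amp (\<zeta> i) (\<zeta> (other m)) (\<zeta> (other m)) (\<zeta> m) (\<zeta> m)) \<le> L * P powr (- a / 2 + \<epsilon> / 2)"
        unfolding gain_def L_def by (rule amp_Lipschitz[OF ne W])
      also have "\<dots> \<le> P powr (\<epsilon> / 2) * P powr (- a / 2 + \<epsilon> / 2)"
        using P by (intro mult_right_mono) auto
      also have "\<dots> = P powr (- a / 2 + \<epsilon>)" by (simp add: powr_add[symmetric] algebra_simps)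
      finally show "cmod (gain i m P W - amp (\<zeta> i) (\<zeta> (other m)) (\<zeta> (other m)) (\<zeta> m) (\<zeta> m)) \<le> P powr (- a / 2 + \<epsilon>)" .
    qed
  qed
qed

text \<open>Bounded convergence in probability, argued directly because the underlying measure
  \<open>M P\<close> itself changes with P.\<close>

lemma whp_tendsto_expectation:
  fixes g :: "real \<Rightarrow> (2 \<times> 2 \<Rightarrow> nat \<Rightarrow> cvec) \<Rightarrow> real"
  assumes [measurable]: "\<And>P. g P \<in> borel_measurable (M P)"
    and bd: "\<forall>\<^sub>F P in at_top. \<forall>W. \<bar>g P W\<bar> \<le> C" and lim: "\<And>e. 0 < e \<Longrightarrow> whp (\<lambda>P W. \<bar>g P W - a\<bar> \<le> e)"
  shows "((\<lambda>P. \<integral>W. g P W \<partial>M P) \<longlongrightarrow> a) at_top"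
proof (rule tendstoI)
  fix e :: real assume e: "0 < e"
  define D where "D = \<bar>C\<bar> + \<bar>a\<bar> + 1"
  have D: "0 < D" by (simp add: D_def)
  obtain A where A: "\<And>P. A P \<in> sets (M P)" "((\<lambda>P. measure (M P) (A P)) \<longlongrightarrow> 0) at_top"
      "\<forall>\<^sub>F P in at_top. \<forall>W\<in>space (M P) - A P. \<bar>g P W - a\<bar> \<le> e / 2"
    using lim[of "e / 2"] e unfolding whp_def by auto
  have "\<forall>\<^sub>F P in at_top. measure (M P) (A P) < e / (2 * D)"
    using order_tendstoD(2)[OF A(2), of "e / (2 * D)"] e D by simp
  with bd A(3) show "\<forall>\<^sub>F P in at_top. dist (\<integral>W. g P W \<partial>M P) a < e"
  proof eventually_elim
    case (elim P)
    interpret prob_space "M P" by (rule prob_space_code_meas)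
    have [measurable]: "A P \<in> sets (M P)" by (rule A(1))
    have int: "integrable (M P) (g P)" using elim(1) by (intro integrable_const_bound[where B = C]) auto
    have "\<bar>(\<integral>W. g P W \<partial>M P) - a\<bar> = \<bar>\<integral>W. g P W - a \<partial>M P\<bar>"
      using int by (simp add: prob_space)
    also have "\<dots> \<le> (\<integral>W. \<bar>g P W - a\<bar> \<partial>M P)" by (rule integral_abs_bound)
    also have "\<dots> \<le> (\<integral>W. e / 2 + D * indicator (A P) W \<partial>M P)"
    proof (rule integral_mono)
      fix W assume W: "W \<in> space (M P)"
      show "\<bar>g P W - a\<bar> \<le> e / 2 + D * indicator (A P) W"
      proof (cases "W \<in> A P")
        case True
        have "\<bar>g P W\<bar> \<le> \<bar>C\<bar>" using elim(1) by (metis abs_ge_self order_trans)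
        then have "\<bar>g P W - a\<bar> \<le> D" unfolding D_def by linarith
        with True e show ?thesis by simp
      qed (use W elim(2) in auto)
    qed (use int in \<open>auto intro!: integrable_abs Bochner_Integration.integrable_diff Bochner_Integration.integrable_add integrable_mult_right integrable_real_indicator simp: less_top[symmetric]\<close>)
    also have "\<dots> = e / 2 + D * measure (M P) (A P)"
      by (subst Bochner_Integration.integral_add) (auto simp: prob_space less_top[symmetric] intro!: integrable_mult_right integrable_real_indicator)
    also have "\<dots> < e / 2 + D * (e / (2 * D))"
      using elim(3) D by (intro add_strict_left_mono mult_strict_left_mono) auto
    also have "\<dots> = e" using D by simp
    finally show ?case by (simp add: dist_real_def)
  qed
qed

text \<open>The factor \<open>k\<close> will be |H_i1|^2 / 2: the first channel entry pulled out of
  the gains, and the power split between two streams.\<close>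

definition sinr_rate :: "real \<Rightarrow> 2 \<Rightarrow> real \<Rightarrow> (2 \<times> 2 \<Rightarrow> nat \<Rightarrow> cvec) \<Rightarrow> real" where
  "sinr_rate k i P W = log 2 (1 + k * P * (cmod (gain i i P W))\<^sup>2 / (1 + k * P * (cmod (gain i (other i) P W))\<^sup>2))"

lemma measurable_sinr_rate [measurable]: "sinr_rate k i P \<in> borel_measurable (M P)"
proof -
  have "(\<lambda>W. sinr_rate k i P W) \<in> borel_measurable (M P)" unfolding sinr_rate_def by measurable
  then show ?thesis by simp
qed

lemma sinr_rate_nonneg:
  assumes "0 \<le> k" "0 \<le> P"
  shows "0 \<le> sinr_rate k i P W"
proof -
  have "0 \<le> k * P * (cmod (gain i i P W))\<^sup>2 / (1 + k * P * (cmod (gain i (other i) P W))\<^sup>2)"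
    using assms by simp
  then show ?thesis unfolding sinr_rate_def by (subst zero_le_log_cancel_iff) linarith+
qed

lemma sinr_rate_le:
  assumes "0 \<le> k" "0 \<le> P"
  shows "sinr_rate k i P W \<le> log 2 (1 + k * P * (1 + cmod (\<zeta> i))\<^sup>2)"
proof -
  have "k * P * (cmod (gain i i P W))\<^sup>2 / (1 + k * P * (cmod (gain i (other i) P W))\<^sup>2) \<le> k * P * (cmod (gain i i P W))\<^sup>2 / 1"
    using assms by (intro divide_left_mono) (auto intro!: add_pos_nonneg)
  also have "\<dots> \<le> k * P * (1 + cmod (\<zeta> i))\<^sup>2"
    using assms cmod_amp_le[of "\<zeta> i"] by (auto intro!: mult_left_mono power_mono simp: gain_def)
  finally show ?thesis
    unfolding sinr_rate_def using assms by (subst log_le_cancel_iff) (auto intro!: add_pos_nonneg)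
qed

text \<open>Dropping the noise leaves the ratio of squared gains, at most S^2 * P powr (a +
  \<epsilon> / 2). The estimate attaining the minimum concerns either the receiver itself or the
  other one, and the matching interference bound applies at every receiver.\<close>

lemma sinr_rate_upper:
  assumes k: "0 < k" and a: "0 \<le> a" "a = \<alpha> l0 j0" and \<epsilon>: "0 < \<epsilon>"
  shows "whp (\<lambda>P W. sinr_rate k i P W / log 2 P \<le> a + \<epsilon>)"
proof -
  define S where "S = 1 + cmod (\<zeta> i)"
  have \<epsilon>4: "0 < \<epsilon> / 4" "0 < \<epsilon> / 2" using \<epsilon> by auto
  have "whp (\<lambda>P W. P powr (- a / 2 - \<epsilon> / 4) < cmod (gain i (other i) P W))"
  proof (cases "l0 = i")
    case True
    then show ?thesis using interference_gt_own[OF \<epsilon>4(1), of i j0] a by simp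
  next
    case False
    then have "l0 = other i" using exhaust_2[of l0] exhaust_2[of i] by auto
    then show ?thesis using interference_gt_other[OF \<epsilon>4(1), of i j0] a by simp
  qed
  then show ?thesis
  proof (rule whp_mp)
    show "\<forall>\<^sub>F P in at_top. \<forall>W. P powr (- a / 2 - \<epsilon> / 4) < cmod (gain i (other i) P W) \<longrightarrow> sinr_rate k i P W / log 2 P \<le> a + \<epsilon>"
      using eventually_le_log[OF \<epsilon>4(2), of "log 2 (1 + S\<^sup>2)"] eventually_gt_at_top[of 1]
    proof (eventually_elim, intro allI impI)
      fix P W assume P: "log 2 (1 + S\<^sup>2) \<le> \<epsilon> / 2 * log 2 P" "1 < P"
        and W: "P powr (- a / 2 - \<epsilon> / 4) < cmod (gain i (other i) P W)"
      define s e where "s = cmod (gain i i P W)" and "e = cmod (gain i (other i) P W)"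
      have e: "P powr (- a / 2 - \<epsilon> / 4) \<le> e" using W by (simp add: e_def)
      have e0: "0 < e" using W P(2) by (smt (verit) e_def powr_gt_zero)
      have s: "0 \<le> s" "s \<le> S" using cmod_amp_le[of "\<zeta> i"] by (auto simp: s_def S_def gain_def)
      have ge1: "1 \<le> P powr (a + \<epsilon> / 2)" using P(2) a \<epsilon> by (intro ge_one_powr_ge_zero) auto
      have "k * P * s\<^sup>2 / (1 + k * P * e\<^sup>2) \<le> k * P * s\<^sup>2 / (k * P * e\<^sup>2)"
        using k P(2) e0 by (intro divide_left_mono) (auto intro!: mult_pos_pos add_pos_pos)
      also have "\<dots> = s\<^sup>2 / e\<^sup>2" using k P(2) by simp
      also have "\<dots> \<le> S\<^sup>2 / (P powr (- a / 2 - \<epsilon> / 4))\<^sup>2"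
        using s e P(2) by (intro frac_le power_mono) auto
      also have "\<dots> = S\<^sup>2 * P powr (a + \<epsilon> / 2)"
      proof -
        have sq: "(P powr (- a / 2 - \<epsilon> / 4))\<^sup>2 = P powr (- (a + \<epsilon> / 2))"
          by (simp add: power2_powr algebra_simps)
        show ?thesis unfolding sq powr_minus_divide by simp
      qed
      finally have "1 + k * P * s\<^sup>2 / (1 + k * P * e\<^sup>2) \<le> (1 + S\<^sup>2) * P powr (a + \<epsilon> / 2)"
        using ge1 unfolding distrib_right by linarith
      moreover have "0 < 1 + k * P * s\<^sup>2 / (1 + k * P * e\<^sup>2)"
        using k P(2) by (intro add_pos_nonneg) auto
      moreover have S1: "0 < 1 + S\<^sup>2" by (intro add_pos_nonneg) auto
      ultimately have "sinr_rate k i P W \<le> log 2 ((1 + S\<^sup>2) * P powr (a + \<epsilon> / 2))"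
        unfolding sinr_rate_def s_def e_def using P(2) by (subst log_le_cancel_iff) auto
      also have "\<dots> = log 2 (1 + S\<^sup>2) + (a + \<epsilon> / 2) * log 2 P"
        using P(2) S1 by (simp add: log_mult log_powr)
      also have "\<dots> \<le> (a + \<epsilon>) * log 2 P" using P(1) by (simp add: algebra_simps)
      finally show "sinr_rate k i P W / log 2 P \<le> a + \<epsilon>"
        using P(2) by (simp add: pos_divide_le_eq)
    qed
  qed
qed

text \<open>For a > 0 the signal gain converges to a positive limit and the interference power is at
  most of order P powr (1 - a + \<epsilon> / 2). For a = 0 the gains need not converge, but
  nonnegativity of the rate suffices.\<close>

lemma sinr_rate_lower:
  assumes k: "0 < k" and a: "0 \<le> a" "a \<le> 1" "\<And>l j. a \<le> \<alpha> l j" and \<epsilon>: "0 < \<epsilon>"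
  shows "whp (\<lambda>P W. a - \<epsilon> \<le> sinr_rate k i P W / log 2 P)"
proof (cases "a = 0")
  case True
  have "whp (\<lambda>P W. True)" by (rule whpI[where b = "\<lambda>_. 0"]) auto
  then show ?thesis
  proof (rule whp_mp)
    show "\<forall>\<^sub>F P in at_top. \<forall>W. True \<longrightarrow> a - \<epsilon> \<le> sinr_rate k i P W / log 2 P"
      using eventually_gt_at_top[of 1]
    proof (eventually_elim, intro allI impI)
      fix P W assume "(1::real) < P"
      then have "0 \<le> sinr_rate k i P W / log 2 P" using sinr_rate_nonneg[of k P i W] k by simp
      then show "a - \<epsilon> \<le> sinr_rate k i P W / log 2 P" using True \<epsilon> by simp
    qed
  qed
next
  case False
  then have a0: "0 < a" using a by simp
  \<comment> \<open>The cap a / 4 makes the gain error vanish, so the signal stays above s0 / 2; the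
    cap \<epsilon> / 4 controls the interference exponent.\<close>
  define e' where "e' = min (\<epsilon> / 4) (a / 4)"
  have e': "0 < e'" "e' \<le> \<epsilon> / 4" "- a / 2 + e' < 0" using a0 \<epsilon> by (auto simp: e'_def)
  define s0 where "s0 = cmod (amp (\<zeta> i) (\<zeta> (other i)) (\<zeta> (other i)) (\<zeta> i) (\<zeta> i))"
  have ne: "\<zeta> (other i) \<noteq> \<zeta> i" using Im_ne_other[of i] by auto
  have s0: "0 < s0"
  proof -
    have "cnj (\<zeta> i) - cnj (\<zeta> (other i)) \<noteq> 0" using ne by (metis complex_cnj_cancel_iff right_minus_eq)
    then show ?thesis unfolding s0_def amp_exact using ne by (simp add: sgn_eq_0_iff)
  qed
  have zero: "amp (\<zeta> i) (\<zeta> i) (\<zeta> i) (\<zeta> (other i)) (\<zeta> (other i)) = 0" by (simp add: amp_exact)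
  \<comment> \<open>Signal power divided by the bound (1 + k) * P powr (1 - a + \<epsilon> / 2) on
    noise plus interference, without the power of P.\<close>
  define c where "c = k * (s0 / 2)\<^sup>2 / (1 + k)"
  have c: "0 < c" using k s0 by (simp add: c_def)
  have \<epsilon>2: "0 < \<epsilon> / 2" using \<epsilon> by simp
  have s02: "0 < s0 / 2" using s0 by simp
  show ?thesis
  proof (rule whp_mp[OF whp_conj[OF gain_accurate[OF a(3) e'(1), of i i] gain_accurate[OF a(3) e'(1), of i "other i"]]], unfold other_simps(3) zero)
    show "\<forall>\<^sub>F P in at_top. \<forall>W.
       cmod (gain i i P W - amp (\<zeta> i) (\<zeta> (other i)) (\<zeta> (other i)) (\<zeta> i) (\<zeta> i)) \<le> P powr (- a / 2 + e') \<and>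
       cmod (gain i (other i) P W - 0) \<le> P powr (- a / 2 + e') \<longrightarrow> a - \<epsilon> \<le> sinr_rate k i P W / log 2 P"
      using eventually_powr_small[OF e'(3) s02, of 1] eventually_le_log[OF \<epsilon>2, of "- log 2 c"] eventually_gt_at_top[of 1]
    proof (eventually_elim, intro allI impI, elim conjE)
      fix P W assume P: "1 * P powr (- a / 2 + e') < s0 / 2" "- log 2 c \<le> \<epsilon> / 2 * log 2 P" "1 < P"
        and W: "cmod (gain i i P W - amp (\<zeta> i) (\<zeta> (other i)) (\<zeta> (other i)) (\<zeta> i) (\<zeta> i)) \<le> P powr (- a / 2 + e')"
          "cmod (gain i (other i) P W - 0) \<le> P powr (- a / 2 + e')"
      define s e where "s = cmod (gain i i P W)" and "e = cmod (gain i (other i) P W)"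
      have "s0 \<le> s + P powr (- a / 2 + e')"
        using W(1) norm_triangle_sub[of "amp (\<zeta> i) (\<zeta> (other i)) (\<zeta> (other i)) (\<zeta> i) (\<zeta> i)" "gain i i P W"]
        unfolding s_def s0_def by (simp add: norm_minus_commute)
      then have s: "s0 / 2 \<le> s" using P(1) by simp
      have "e \<le> P powr (- a / 2 + e')" using W(2) by (simp add: e_def)
      also have "\<dots> \<le> P powr (- a / 2 + \<epsilon> / 4)" using P(3) e' by (intro powr_mono) auto
      finally have "e\<^sup>2 \<le> (P powr (- a / 2 + \<epsilon> / 4))\<^sup>2" by (intro power_mono) (auto simp: e_def)
      also have "\<dots> = P powr (- a + \<epsilon> / 2)" by (simp add: power2_powr algebra_simps)
      finally have "P * e\<^sup>2 \<le> P powr 1 * P powr (- a + \<epsilon> / 2)"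
        using P(3) by (intro mult_mono) auto
      also have "\<dots> = P powr (1 - a + \<epsilon> / 2)" by (subst powr_add[symmetric]) (simp add: algebra_simps)
      finally have "k * (P * e\<^sup>2) \<le> k * P powr (1 - a + \<epsilon> / 2)" using k by (intro mult_left_mono) auto
      \<comment> \<open>Here a \<le> 1 enters: the unit noise is dominated by the interference
        bound.\<close>
      moreover have "1 \<le> P powr (1 - a + \<epsilon> / 2)" using P(3) a \<epsilon> by (intro ge_one_powr_ge_zero) auto
      ultimately have den: "1 + k * P * e\<^sup>2 \<le> (1 + k) * P powr (1 - a + \<epsilon> / 2)" by (simp add: algebra_simps)
      have "c * P powr (a - \<epsilon> / 2) = k * P * (s0 / 2)\<^sup>2 / ((1 + k) * P powr (1 - a + \<epsilon> / 2))"
      proof -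
        have "P powr (a - \<epsilon> / 2) = P powr 1 / P powr (1 - a + \<epsilon> / 2)"
          by (simp only: powr_diff[symmetric]) (simp add: algebra_simps)
        then have "P powr (a - \<epsilon> / 2) = P / P powr (1 - a + \<epsilon> / 2)" using P(3) by simp
        then show ?thesis by (simp add: c_def)
      qed
      also have "\<dots> \<le> k * P * s\<^sup>2 / (1 + k * P * e\<^sup>2)"
        using den s s0 k P(3) by (intro frac_le mult_left_mono power_mono) (auto intro!: add_pos_nonneg)
      also have "\<dots> \<le> 1 + k * P * s\<^sup>2 / (1 + k * P * e\<^sup>2)" by simp
      finally have "log 2 (c * P powr (a - \<epsilon> / 2)) \<le> sinr_rate k i P W"
        unfolding sinr_rate_def s_def e_def using c P(3)
        by (subst log_le_cancel_iff) (auto intro: less_le_trans[of 0 "c * P powr (a - \<epsilon> / 2)"])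
      moreover have "log 2 (c * P powr (a - \<epsilon> / 2)) = log 2 c + (a - \<epsilon> / 2) * log 2 P"
        using c P(3) by (simp add: log_mult log_powr)
      ultimately have "(a - \<epsilon>) * log 2 P \<le> sinr_rate k i P W"
        using P(2) by (simp add: algebra_simps)
      then show "a - \<epsilon> \<le> sinr_rate k i P W / log 2 P"
        using P(3) by (simp add: pos_le_divide_eq)
    qed
  qed
qed

lemma expected_sinr_rate_tendsto:
  assumes k: "0 < k" and a: "a \<le> 1" "a = \<alpha> l0 j0" "\<And>l j. a \<le> \<alpha> l j"
  shows "((\<lambda>P. (\<integral>W. sinr_rate k i P W \<partial>M P) / log 2 P) \<longlongrightarrow> a) at_top"
proof -
  have a0: "0 \<le> a" using a \<alpha>_nonneg by simp
  define S where "S = 1 + k * (1 + cmod (\<zeta> i))\<^sup>2"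
  have S: "0 < S" using k unfolding S_def by (intro add_pos_nonneg) auto
  have "((\<lambda>P. \<integral>W. sinr_rate k i P W / log 2 P \<partial>M P) \<longlongrightarrow> a) at_top"
  \<comment> \<open>The rate is at most log S + log P, and log S \<le> log P for large P; hence the
    bound 2.\<close>
  proof (rule whp_tendsto_expectation[where C = 2])
    show "\<forall>\<^sub>F P in at_top. \<forall>W. \<bar>sinr_rate k i P W / log 2 P\<bar> \<le> 2"
      using eventually_le_log[OF zero_less_one, of "log 2 S"] eventually_gt_at_top[of 1]
    proof (eventually_elim, intro allI)
      fix P W assume P: "log 2 S \<le> 1 * log 2 P" "1 < P"
      have "sinr_rate k i P W \<le> log 2 (1 + k * P * (1 + cmod (\<zeta> i))\<^sup>2)"
        using k P by (intro sinr_rate_le) auto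
      also have "\<dots> \<le> log 2 (S * P)"
        using k P S by (subst log_le_cancel_iff) (auto simp: S_def algebra_simps intro!: add_pos_nonneg)
      also have "\<dots> = log 2 S + log 2 P" using S P by (simp add: log_mult)
      finally have "sinr_rate k i P W / log 2 P \<le> 2" using P by (simp add: pos_divide_le_eq)
      moreover have "0 \<le> sinr_rate k i P W / log 2 P" using sinr_rate_nonneg[of k P i W] k P by simp
      ultimately show "\<bar>sinr_rate k i P W / log 2 P\<bar> \<le> 2" by simp
    qed
    fix e :: real assume e: "0 < e"
    show "whp (\<lambda>P W. \<bar>sinr_rate k i P W / log 2 P - a\<bar> \<le> e)"
      by (rule whp_mp[OF whp_conj[OF sinr_rate_upper[OF k a0 a(2) e, of i] sinr_rate_lower[OF k a0 a(1,3) e, of i]]])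
         (intro always_eventually allI impI, auto simp: abs_le_iff)
  qed measurable
  then show ?thesis by simp
qed

end

section \<open>Averaging over the channel\<close>

text \<open>Since 1 / ln 2 \<le> 2. This turns the channel-dependent part of the rate into an
  integrable quadratic majorant.\<close>

lemma log2_one_plus_le:
  fixes t :: real
  assumes t: "0 \<le> t"
  shows "log 2 (1 + t) \<le> 2 * t"
proof -
  have "ln (1 + t) \<le> t" using t by (rule ln_add_one_self_le_self)
  moreover have "1 \<le> 2 * ln (2::real)" using ln2_ge_two_thirds by simp
  then have "t * 1 \<le> t * (2 * ln 2)" using t by (intro mult_left_mono)
  ultimately show ?thesis unfolding log_def by (simp add: pos_divide_le_eq)
qed

section \<open>Null sets of slopes, channels and codebooks\<close>

lemma AE_cgauss_ratio_not_in:
  assumes "A \<in> sets borel" "emeasure lborel A = 0"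
  shows "AE g in cgauss_vec. ratio g \<notin> A"
proof -
  have [measurable]: "A \<in> sets borel" by fact
  have "emeasure cgauss_vec {g. ratio g \<in> A} = 0"
    using emeasure_cgauss_ratio_le[OF assms(1)] assms(2) by simp
  then show ?thesis
    by (subst AE_iff_measurable[where N = "{g. ratio g \<in> A}"]) auto
qed

lemma AE_cgauss_Re_ratio: "AE g in cgauss_vec. Re (ratio g) \<noteq> 0"
proof -
  have "(\<integral>\<^sup>+z. indicator {z. Re z = 0} z \<partial>lborel) = (\<integral>\<^sup>+x. \<integral>\<^sup>+y. indicator {z. Re z = 0} (Complex x y) \<partial>lborel \<partial>lborel)"
    by (rule nn_integral_complex) measurable
  also have "\<dots> = (\<integral>\<^sup>+x. 0 \<partial>(lborel :: real measure))"
    by (rule nn_integral_cong_AE, rule AE_mp[OF AE_lborel_singleton[of 0]]) (auto intro!: AE_I2)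
  finally have "emeasure lborel {z. Re z = 0} = 0" by simp
  from AE_cgauss_ratio_not_in[OF _ this] show ?thesis by simp
qed

lemma AE_cgauss_Im_ratio: "AE g in cgauss_vec. Im (ratio g) \<noteq> c"
proof -
  have "(\<integral>\<^sup>+z. indicator {z. Im z = c} z \<partial>lborel) = (\<integral>\<^sup>+x. \<integral>\<^sup>+y. indicator {z. Im z = c} (Complex x y) \<partial>lborel \<partial>lborel)"
    by (rule nn_integral_complex) measurable
  also have "\<dots> = (\<integral>\<^sup>+x. \<integral>\<^sup>+y. indicator {c} y \<partial>(lborel :: real measure) \<partial>(lborel :: real measure))"
    by (intro nn_integral_cong) (auto simp: indicator_def)
  also have "\<dots> = 0" by simp
  finally have "emeasure lborel {z. Im z = c} = 0" by simp
  from AE_cgauss_ratio_not_in[OF _ this] show ?thesis by simp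
qed

definition generic_channel :: "complex ^ 2 ^ 2 \<Rightarrow> bool" where
  "generic_channel H \<longleftrightarrow> (\<forall>l. H $ l $ 1 \<noteq> 0 \<and> Re (ratio (H $ l)) \<noteq> 0) \<and> Im (ratio (H $ 1)) \<noteq> Im (ratio (H $ 2))"

text \<open>By independence of the rows the first slope may be fixed; the second then has to avoid
  the imaginary axis and one horizontal line, both Lebesgue null.\<close>

lemma AE_generic_channel: "AE H in chan_meas. generic_channel H"
proof -
  interpret prob_space cgauss_vec by (rule prob_space_cgauss_vec)
  interpret p: pair_sigma_finite cgauss_vec cgauss_vec ..
  have [measurable]: "Measurable.pred borel generic_channel"
    unfolding generic_channel_def forall_2 by measurable
  have m: "(vec2 :: cvec \<times> cvec \<Rightarrow> _) \<in> measurable (cgauss_vec \<Otimes>\<^sub>M cgauss_vec) borel"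
  proof -
    have "sets (cgauss_vec \<Otimes>\<^sub>M cgauss_vec) = sets (borel :: (cvec \<times> cvec) measure)"
      unfolding borel_prod[symmetric] by (intro sets_pair_measure_cong) simp_all
    then show ?thesis using measurable_vec2 measurable_cong_sets[OF _ refl] by blast
  qed
  have "AE p in cgauss_vec \<Otimes>\<^sub>M cgauss_vec. generic_channel (vec2 p)"
  proof (rule p.AE_pair_measure)
    show "{p \<in> space (cgauss_vec \<Otimes>\<^sub>M cgauss_vec). generic_channel (vec2 p)} \<in> sets (cgauss_vec \<Otimes>\<^sub>M cgauss_vec)"
      using m by measurable
    show "AE x in cgauss_vec. AE y in cgauss_vec. generic_channel (vec2 (x, y))"
      using AE_cgauss_vec_nth_1_nonzero AE_cgauss_Re_ratio
    proof eventually_elim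
      case (elim x)
      show ?case
        using AE_cgauss_vec_nth_1_nonzero AE_cgauss_Re_ratio AE_cgauss_Im_ratio[of "Im (ratio x)"]
        by eventually_elim (use elim in \<open>auto simp: generic_channel_def forall_2\<close>)
    qed
  qed
  then show ?thesis
    unfolding chan_meas_eq_distr using m by (subst AE_distr_iff) auto
qed

lemma AE_code_meas_nonzero: "AE W in code_meas B P. \<forall>l j. \<forall>k<2 ^ B l j P. W (l, j) k $ 1 \<noteq> 0"
proof -
  have 1: "AE W in code_meas B P. W (l, j) k $ 1 \<noteq> 0" if k: "k < 2 ^ B l j P" for l j k
  proof -
    have "AE G in codebook_meas (B l j P). G k $ 1 \<noteq> 0"
      unfolding codebook_meas_def using k
      by (intro AE_PiM_component[where P = "\<lambda>g. g $ 1 \<noteq> 0"] prob_space_cgauss_vec AE_cgauss_vec_nth_1_nonzero) auto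
    then have "AE G in codebook_meas (B (fst (l, j)) (snd (l, j)) P). G k $ 1 \<noteq> 0"
      unfolding fst_conv snd_conv .
    then show ?thesis
      unfolding code_meas_def
      by (intro AE_PiM_component[where P = "\<lambda>G. G k $ 1 \<noteq> 0" and i = "(l, j)"] prob_space_codebook_meas) auto
  qed
  have "AE W in code_meas B P. \<forall>k\<in>{..<2 ^ B l j P}. W (l, j) k $ 1 \<noteq> 0" for l j
    using 1 by (subst AE_ball_countable) auto
  then have "AE W in code_meas B P. \<forall>l j. \<forall>k\<in>{..<2 ^ B l j P}. W (l, j) k $ 1 \<noteq> 0"
    by (simp only: AE_all_countable simp_thms)
  then show ?thesis by eventually_elim auto
qed

section \<open>The rate as a channel average of fixed-channel expectations\<close>

definition rate_integrand :: "(2 \<Rightarrow> 2 \<Rightarrow> real \<Rightarrow> nat) \<Rightarrow> 2 \<Rightarrow> real \<Rightarrow> (complex ^ 2 ^ 2) \<times> (2 \<times> 2 \<Rightarrow> nat \<Rightarrow> cvec) \<Rightarrow> real" where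
  "rate_integrand B i P \<omega> = log 2 (1 + (cmod (herm (fst \<omega> $ i) (eff_beam B P (fst \<omega>) (snd \<omega>) i)))\<^sup>2
      / (1 + (cmod (herm (fst \<omega> $ i) (eff_beam B P (fst \<omega>) (snd \<omega>) (other i))))\<^sup>2))"

lemma rate_cZF_eq: "rate_cZF B i P = (\<integral>\<omega>. rate_integrand B i P \<omega> \<partial>(chan_meas \<Otimes>\<^sub>M code_meas B P))"
  by (simp add: rate_cZF_def sys_meas_def code_meas_def rate_integrand_def split_beta)

lemma measurable_rate_integrand [measurable]:
  "rate_integrand B i P \<in> borel_measurable (chan_meas \<Otimes>\<^sub>M code_meas B P)"
proof -
  let ?M = "chan_meas \<Otimes>\<^sub>M code_meas B P"
  have H [measurable]: "(\<lambda>\<omega>. fst \<omega>) \<in> borel_measurable ?M"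
    using measurable_cong_sets[OF refl sets_chan_meas] measurable_fst[of chan_meas "code_meas B P"] by blast
  have est [measurable]: "(\<lambda>\<omega>. est B P (fst \<omega>) (snd \<omega>) l j) \<in> borel_measurable ?M" for l j
    unfolding est_def
  proof (rule measurable_quantize)
    fix k :: nat assume k: "k < 2 ^ B l j P"
    have "(\<lambda>\<omega>. snd \<omega> (l, j)) \<in> measurable ?M (codebook_meas (B l j P))"
      by (rule measurable_compose[OF measurable_snd measurable_code_component])
    from measurable_compose[OF this measurable_codebook_component[OF k]]
    show "(\<lambda>\<omega>. snd \<omega> (l, j) k) \<in> borel_measurable ?M" .
  qed simp_all
  have beam [measurable]: "(\<lambda>\<omega>. eff_beam B P (fst \<omega>) (snd \<omega>) m) \<in> borel_measurable ?M" for m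
    by (rule borel_measurable_cvecI) (simp_all add: eff_beam_def czf_def)
  have "(\<lambda>\<omega>. rate_integrand B i P \<omega>) \<in> borel_measurable ?M"
    unfolding rate_integrand_def by measurable
  then show ?thesis by simp
qed

context
  fixes B :: "2 \<Rightarrow> 2 \<Rightarrow> real \<Rightarrow> nat" and \<alpha> :: "2 \<Rightarrow> 2 \<Rightarrow> real"
  assumes \<alpha>01: "\<And>i j. 0 \<le> \<alpha> i j \<and> \<alpha> i j \<le> 1"
    and lim: "\<And>i j. ((\<lambda>P. real (B i j P) / log 2 P) \<longlongrightarrow> \<alpha> i j) at_top"
begin

lemma fixed_channel_generic: "generic_channel H \<Longrightarrow> fixed_channel B \<alpha> (\<lambda>l. ratio (H $ l))"
  using \<alpha>01 lim by unfold_locales (auto simp: generic_channel_def)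

text \<open>The slope description of the precoder is valid unless some codeword has first entry 0,
  which happens with probability 0.\<close>

lemma AE_rate_integrand:
  assumes H: "generic_channel H" and P: "0 \<le> P"
  shows "AE W in code_meas B P. rate_integrand B i P (H, W)
    = fixed_channel.sinr_rate B (\<lambda>l. ratio (H $ l)) ((cmod (H $ i $ 1))\<^sup>2 / 2) i P W"
  using AE_code_meas_nonzero
proof eventually_elim
  case (elim W)
  interpret fixed_channel B \<alpha> "\<lambda>l. ratio (H $ l)" by (rule fixed_channel_generic[OF H])
  have H1: "H $ l $ 1 \<noteq> 0" for l using H by (simp add: generic_channel_def)
  have est: "est B P H W l j = line_rep (Z P W l j)" for l j
    unfolding est_def slope_def using elim H1 by (intro quantize_eq_line_rep_sel) auto
  have h: "(cmod (herm (H $ i) (eff_beam B P H W m)))\<^sup>2 = (cmod (H $ i $ 1))\<^sup>2 / 2 * P * (cmod (gain i m P W))\<^sup>2" for m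
    unfolding herm_eff_beam[where Z = "Z P W", OF est H1] gain_def using P
    by (simp add: norm_mult power_mult_distrib)
  show ?case
    unfolding rate_integrand_def sinr_rate_def fst_conv snd_conv h ..
qed

text \<open>The slope may be unbounded, but k (1 + |\<zeta>|)^2 = (|H_i1| + |H_i2|)^2 / 2 is at most
  the squared norm of H. For P \<ge> 1 the power then factors out of the logarithm, leaving an
  integrable function of H.\<close>

lemma sinr_rate_bound:
  assumes H: "generic_channel H" and P: "1 \<le> P"
  shows "fixed_channel.sinr_rate B (\<lambda>l. ratio (H $ l)) ((cmod (H $ i $ 1))\<^sup>2 / 2) i P W \<le> log 2 P + 2 * (norm H)\<^sup>2"
    (is "?s \<le> _")
proof -
  interpret fixed_channel B \<alpha> "\<lambda>l. ratio (H $ l)" by (rule fixed_channel_generic[OF H])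
  have H1: "H $ i $ 1 \<noteq> 0" using H by (simp add: generic_channel_def)
  have "cmod (H $ i $ 1) * cmod (ratio (H $ i)) = cmod (H $ i $ 2)"
    using H1 by (simp add: ratio_def norm_divide)
  then have "(cmod (H $ i $ 1))\<^sup>2 * (1 + cmod (ratio (H $ i)))\<^sup>2 = (cmod (H $ i $ 1) + cmod (H $ i $ 2))\<^sup>2"
    by (simp add: power_mult_distrib[symmetric] distrib_left)
  also have "\<dots> \<le> 2 * (norm (H $ i))\<^sup>2"
    using sum_squares_bound[of "cmod (H $ i $ 1)" "cmod (H $ i $ 2)"] by (simp add: norm_cvec_square power2_sum)
  also have "\<dots> \<le> 2 * (norm H)\<^sup>2"
    using Finite_Cartesian_Product.norm_nth_le[of H i] by (simp add: power_mono)
  finally have q: "(cmod (H $ i $ 1))\<^sup>2 / 2 * (1 + cmod (ratio (H $ i)))\<^sup>2 \<le> (norm H)\<^sup>2" by simp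
  have "?s \<le> log 2 (1 + (cmod (H $ i $ 1))\<^sup>2 / 2 * P * (1 + cmod (ratio (H $ i)))\<^sup>2)"
    using P by (intro sinr_rate_le) auto
  also have "\<dots> \<le> log 2 (P * (1 + (norm H)\<^sup>2))"
  proof -
    have "P * ((cmod (H $ i $ 1))\<^sup>2 / 2 * (1 + cmod (ratio (H $ i)))\<^sup>2) \<le> P * (norm H)\<^sup>2"
      using q P by (intro mult_left_mono) auto
    then have "1 + (cmod (H $ i $ 1))\<^sup>2 / 2 * P * (1 + cmod (ratio (H $ i)))\<^sup>2 \<le> P * (1 + (norm H)\<^sup>2)"
      using P unfolding distrib_left by (simp only: mult_ac)
    moreover have "0 < 1 + (cmod (H $ i $ 1))\<^sup>2 / 2 * P * (1 + cmod (ratio (H $ i)))\<^sup>2"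
      using P by (intro add_pos_nonneg) auto
    ultimately show ?thesis by (subst log_le_cancel_iff) auto
  qed
  also have "\<dots> = log 2 P + log 2 (1 + (norm H)\<^sup>2)"
  proof -
    have "0 < 1 + (norm H)\<^sup>2" by (intro add_pos_nonneg) auto
    then show ?thesis using P by (simp add: log_mult)
  qed
  also have "\<dots> \<le> log 2 P + 2 * (norm H)\<^sup>2"
    using log2_one_plus_le[of "(norm H)\<^sup>2"] by simp
  finally show ?thesis .
qed

lemma AE_rate_integrand_bound:
  assumes H: "generic_channel H" and P: "1 \<le> P"
  shows "AE W in code_meas B P. \<bar>rate_integrand B i P (H, W)\<bar> \<le> log 2 P + 2 * (norm H)\<^sup>2"
proof -
  interpret fixed_channel B \<alpha> "\<lambda>l. ratio (H $ l)" by (rule fixed_channel_generic[OF H])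
  have P0: "0 \<le> P" using P by simp
  from AE_rate_integrand[OF H P0, of i] show ?thesis
  proof eventually_elim
    case (elim W)
    then show ?case
      using sinr_rate_bound[OF H P, of i W] sinr_rate_nonneg[of "(cmod (H $ i $ 1))\<^sup>2 / 2" P i W] P0 by simp
  qed
qed

lemma measurable_rate_section: "(\<lambda>W. rate_integrand B i P (H, W)) \<in> borel_measurable (code_meas B P)"
  by (rule measurable_compose[OF _ measurable_rate_integrand]) auto

lemma rate_cZF_iterated:
  assumes P: "1 \<le> P"
  shows "rate_cZF B i P = (\<integral>H. \<integral>W. rate_integrand B i P (H, W) \<partial>code_meas B P \<partial>chan_meas)"
proof -
  interpret H: prob_space chan_meas by (rule prob_space_chan_meas)
  interpret W: prob_space "code_meas B P" by (rule prob_space_code_meas)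
  interpret pair_sigma_finite chan_meas "code_meas B P" ..
  note measurable_rate_section [measurable]
  have int: "integrable (code_meas B P) (\<lambda>W. rate_integrand B i P (H, W))" if "generic_channel H" for H
    using AE_rate_integrand_bound[OF that P, of i]
    by (intro W.integrable_const_bound[where B = "log 2 P + 2 * (norm H)\<^sup>2"]) auto
  have "integrable (chan_meas \<Otimes>\<^sub>M code_meas B P) (rate_integrand B i P)"
  proof (rule Fubini_integrable)
    show "AE H in chan_meas. integrable (code_meas B P) (\<lambda>W. rate_integrand B i P (H, W))"
      using AE_generic_channel by eventually_elim (rule int)
    show "integrable chan_meas (\<lambda>H. \<integral>W. norm (rate_integrand B i P (H, W)) \<partial>code_meas B P)"
    proof (rule Bochner_Integration.integrable_bound[where f = "\<lambda>H. log 2 P + 2 * (norm H)\<^sup>2"])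
      show "integrable chan_meas (\<lambda>H. log 2 P + 2 * (norm H)\<^sup>2)"
        by (intro Bochner_Integration.integrable_add integrable_mult_right integrable_norm_square_chan_meas) auto
      show "AE H in chan_meas. norm (\<integral>W. norm (rate_integrand B i P (H, W)) \<partial>code_meas B P) \<le> norm (log 2 P + 2 * (norm H)\<^sup>2)"
        using AE_generic_channel
      proof eventually_elim
        case (elim H)
        have "(\<integral>W. norm (rate_integrand B i P (H, W)) \<partial>code_meas B P) \<le> (\<integral>W. log 2 P + 2 * (norm H)\<^sup>2 \<partial>code_meas B P)"
          using AE_rate_integrand_bound[OF elim P, of i] int[OF elim] by (intro integral_mono_AE) auto
        then show ?case using P by (simp add: W.prob_space)
      qed
    qed measurable
  qed measurable
  then show ?thesis
    unfolding rate_cZF_eq by (rule integral_fst'[symmetric])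
qed

text \<open>The channel law does not change with P, so dominated convergence applies to the inner
  expectations, whose limit \<open>a\<close> is the same for almost every channel and for both
  receivers.\<close>

lemma rate_cZF_tendsto:
  assumes a: "a = \<alpha> l0 j0" "\<And>l j. a \<le> \<alpha> l j"
  shows "((\<lambda>P. rate_cZF B i P / log 2 P) \<longlongrightarrow> a) at_top"
proof -
  interpret H: prob_space chan_meas by (rule prob_space_chan_meas)
  have sf: "sigma_finite_measure (code_meas B P)" for P
    using prob_space_code_meas by (rule prob_space_imp_sigma_finite)
  have "((\<lambda>P. \<integral>H. (\<integral>W. rate_integrand B i P (H, W) \<partial>code_meas B P) / log 2 P \<partial>chan_meas) \<longlongrightarrow> (\<integral>H. a \<partial>chan_meas)) at_top"
  proof (rule integral_dominated_convergence_at_top[where w = "\<lambda>H. 1 + 2 * (norm H)\<^sup>2"])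
    show "integrable chan_meas (\<lambda>H. 1 + 2 * (norm H)\<^sup>2)"
      by (intro Bochner_Integration.integrable_add integrable_mult_right integrable_norm_square_chan_meas) auto
    show "(\<lambda>H. (\<integral>W. rate_integrand B i P (H, W) \<partial>code_meas B P) / log 2 P) \<in> borel_measurable chan_meas" for P
    proof -
      interpret sigma_finite_measure "code_meas B P" by (rule sf)
      show ?thesis by measurable
    qed
    show "AE H in chan_meas. ((\<lambda>P. (\<integral>W. rate_integrand B i P (H, W) \<partial>code_meas B P) / log 2 P) \<longlongrightarrow> a) at_top"
      using AE_generic_channel
    proof eventually_elim
      case (elim H)
      interpret fixed_channel B \<alpha> "\<lambda>l. ratio (H $ l)" by (rule fixed_channel_generic[OF elim])
      define k where "k = (cmod (H $ i $ 1))\<^sup>2 / 2"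
      have k: "0 < k" using elim by (simp add: k_def generic_channel_def)
      have "((\<lambda>P. (\<integral>W. sinr_rate k i P W \<partial>M P) / log 2 P) \<longlongrightarrow> a) at_top"
        using k a \<alpha>01 by (intro expected_sinr_rate_tendsto) auto
      moreover have "\<forall>\<^sub>F P in at_top. (\<integral>W. sinr_rate k i P W \<partial>M P) / log 2 P = (\<integral>W. rate_integrand B i P (H, W) \<partial>M P) / log 2 P"
        using eventually_ge_at_top[of 0]
      proof eventually_elim
        fix P :: real assume P: "0 \<le> P"
        have "(\<integral>W. rate_integrand B i P (H, W) \<partial>M P) = (\<integral>W. sinr_rate k i P W \<partial>M P)"
          using AE_rate_integrand[OF elim P, of i] measurable_rate_section
          by (intro integral_cong_AE) (auto simp: k_def)
        then show "(\<integral>W. sinr_rate k i P W \<partial>M P) / log 2 P = (\<integral>W. rate_integrand B i P (H, W) \<partial>M P) / log 2 P"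
          by simp
      qed
      ultimately show ?case by (rule Lim_transform_eventually)
    qed
    show "\<forall>\<^sub>F P in at_top. AE H in chan_meas. norm ((\<integral>W. rate_integrand B i P (H, W) \<partial>code_meas B P) / log 2 P) \<le> 1 + 2 * (norm H)\<^sup>2"
      using eventually_ge_at_top[of 2]
    proof eventually_elim
      fix P :: real assume P: "2 \<le> P"
      interpret W: prob_space "code_meas B P" by (rule prob_space_code_meas)
      have P1: "1 \<le> P" using P by simp
      \<comment> \<open>From P = 2 on, division by log P does not increase the term 2 |H|^2, so the
        majorant 1 + 2 |H|^2 is free of P.\<close>
      have lg: "1 \<le> log 2 P" using P by simp
      show "AE H in chan_meas. norm ((\<integral>W. rate_integrand B i P (H, W) \<partial>code_meas B P) / log 2 P) \<le> 1 + 2 * (norm H)\<^sup>2"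
        using AE_generic_channel
      proof eventually_elim
        case (elim H)
        note measurable_rate_section [measurable]
        have int: "integrable (code_meas B P) (\<lambda>W. rate_integrand B i P (H, W))"
          using AE_rate_integrand_bound[OF elim P1, of i]
          by (intro W.integrable_const_bound[where B = "log 2 P + 2 * (norm H)\<^sup>2"]) auto
        have "\<bar>\<integral>W. rate_integrand B i P (H, W) \<partial>code_meas B P\<bar> \<le> (\<integral>W. \<bar>rate_integrand B i P (H, W)\<bar> \<partial>code_meas B P)"
          by (rule integral_abs_bound)
        also have "\<dots> \<le> (\<integral>W. log 2 P + 2 * (norm H)\<^sup>2 \<partial>code_meas B P)"
          using AE_rate_integrand_bound[OF elim P1, of i] int by (intro integral_mono_AE) auto
        also have "\<dots> = log 2 P + 2 * (norm H)\<^sup>2" by (simp add: W.prob_space)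
        also have "\<dots> \<le> log 2 P + 2 * (norm H)\<^sup>2 * log 2 P"
          using lg mult_left_mono[OF lg, of "2 * (norm H)\<^sup>2"] by simp
        finally have "\<bar>\<integral>W. rate_integrand B i P (H, W) \<partial>code_meas B P\<bar> \<le> (1 + 2 * (norm H)\<^sup>2) * log 2 P"
          by (simp add: algebra_simps)
        then show ?case using lg by (simp add: abs_divide pos_divide_le_eq)
      qed
    qed
  qed simp
  then have lim': "((\<lambda>P. \<integral>H. (\<integral>W. rate_integrand B i P (H, W) \<partial>code_meas B P) / log 2 P \<partial>chan_meas) \<longlongrightarrow> a) at_top"
    using H.prob_space by simp
  show ?thesis
  proof (rule Lim_transform_eventually[OF lim'])
    show "\<forall>\<^sub>F P in at_top. (\<integral>H. (\<integral>W. rate_integrand B i P (H, W) \<partial>code_meas B P) / log 2 P \<partial>chan_meas) = rate_cZF B i P / log 2 P"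
      using eventually_ge_at_top[of 1] by eventually_elim (simp add: rate_cZF_iterated)
  qed
qed

end

theorem theorem1:
  fixes B :: "2 \<Rightarrow> 2 \<Rightarrow> real \<Rightarrow> nat" and \<alpha> :: "2 \<Rightarrow> 2 \<Rightarrow> real"
  assumes "\<And>i j. 0 \<le> \<alpha> i j \<and> \<alpha> i j \<le> 1"
    and "\<And>i j. ((\<lambda>P. real (B i j P) / log 2 P) \<longlongrightarrow> \<alpha> i j) at_top"
  shows "\<exists>MG :: 2 \<Rightarrow> real.
           (\<forall>i. ((\<lambda>P. rate_cZF B i P / log 2 P) \<longlongrightarrow> MG i) at_top) \<and>
           MG 1 + MG 2 = 2 * Min {\<alpha> i j | i j. True}"
proof -
  define a where "a = Min {\<alpha> i j | i j. True}"
  have eq: "{\<alpha> i j | i j. True} = (\<lambda>(i, j). \<alpha> i j) ` UNIV" by auto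
  have fin: "finite {\<alpha> i j | i j. True}" unfolding eq by simp
  have "a \<in> {\<alpha> i j | i j. True}" unfolding a_def by (rule Min_in[OF fin]) auto
  then obtain l0 j0 where "a = \<alpha> l0 j0" by auto
  moreover have "a \<le> \<alpha> l j" for l j unfolding a_def by (rule Min_le[OF fin]) auto
  ultimately have "((\<lambda>P. rate_cZF B i P / log 2 P) \<longlongrightarrow> a) at_top" for i
    using rate_cZF_tendsto[of \<alpha> B, OF assms] by blast
  then show ?thesis by (intro exI[of _ "\<lambda>_. a"]) (simp add: a_def)
qed

end
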